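(* There exist absolute constants $C_0\in(0,43)$, $C>1$, $c>0$ such that the following holds. Consider the SSBM in the context with $\eta\in[0,1/2)$, $k\ge2$, $n\ge10$ and $\sqrt\rho>1-\frac{1}{4k(2+\sqrt k)}$. Let $\xi>0$ and $\delta\in\left(0,\sqrt{\frac{1}{12(16+8\xi)(k-1)}}\right)$. (Dense case) Suppose $p>\left(\frac{2C_0k}{\delta(1-2\eta)}\right)^2\frac{\ln n}{n}$ and set $V=V_{k-1}(\overline{L_{sym}})$; then with probability at least $1-\frac2n-n\exp(-\frac{np}{c})$ there exists an orthogonal $O\in\mathbb R^{(k-1)\times(k-1)}$ with $\|V-\Theta R_{k-1}O\|\le2\delta$ such that, for every $(1+\xi)$-approximate solution $(\tilde\Theta,\tilde R_{k-1})\in\mathbb M_{n,k}\times\mathbb R^{k\times(k-1)}$ of the $k$-means problem $\min_{\Theta'\in\mathbb M_{n,k},R\in\mathbb R^{k\times(k-1)}}\|\Theta'R-V\|_F^2$, setting $S_i=\{j\in C_i:\|(\tilde\Theta\tilde R_{k-1})_{j*}-(\Theta R_{k-1}O)_{j*}\|^2\ge\frac{2}{3n_i}\}$ and $\tilde V=\bigcup_{i=1}^kC_i\setminus S_i$, there is a permutation matrix $\pi\in\mathbb R^{k\times k}$ with $\tilde\Theta_{\tilde V*}=\hat\Theta_{\tilde V*}\pi$ and $$\sum_{i=1}^k\frac{|S_i|}{n_i}\le96(2+\xi)(k-1)\delta^2.$$ In particular the set of mis-clustered nodes is a subset of $\bigcup_iS_i$. (Sparse case) The same conclusion holds with $V=V_{k-1}(L_\gamma)$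 and probability at least $1-7e^{-2r}-\frac2n-ne^{-np/c}$, if instead $r\ge1$, $p>\left(\frac{2k(128Cr^2+1)}{\delta(1-2\eta)}\right)^8\frac2n$, and $\gamma^+,\gamma^-\ge0$ with $\gamma^++\gamma^-=\bar d^{7/8}$.
   Context: SSBM: integers $n\ge2,k\ge2$, $p\in(0,1]$, $\eta\in[0,1/2)$, partition of $[n]$ into nonempty clusters $C_1,\dots,C_k$, $|C_i|=n_i$. Independently for each unordered pair $j\ne j'$, an edge is present w.p. $p$, signed $+1$ if same cluster and $-1$ otherwise, then sign flipped independently w.p. $\eta$. $A$ symmetric signed adjacency (zero diagonal), $A^\pm=\max(\pm A,0)$, $\bar D=\mathrm{diag}((A^++A^-)\mathbf1)$, $\bar d=p(n-1)$, $\overline{L_{sym}}=I-\bar D^{-1/2}A\bar D^{-1/2}$. Regularized: $A_\gamma=A+\frac{\gamma^+-\gamma^-}{n}\mathbf1\mathbf1^\top$, $\gamma=\gamma^++\gamma^-$, $\bar D_\gamma=\bar D+\gamma I$, $L_\gamma=I-\bar D_\gamma^{-1/2}A_\gamma\bar D_\gamma^{-1/2}$. $\rho=\min_in_i/\max_in_i$. $\Theta_{ji}=1/\sqrt{n_i}$ if $j\in C_i$ else 0; $\hat\Theta_{ji}=1$ if $j\in C_i$ else 0. $\mathbb M_{n,k}$: $n\times k$ 0/1 matrices with exactly one 1 per row. A $(1+\xi)$-approximate solution has cost at most $(1+\xi)$ times the minimum cost. $V_{k-1}(M)$: orthonormal eigenvectors of the $k-1$ smallest eigenvalues. $\bar\alpha=1+\frac{p}{\bar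 d}(1-2\eta)$, $\bar C=\bar\alpha I_k-\bar B$ with $\bar B_{ii}=\frac{n_ip}{\bar d}(1-2\eta)$, $\bar B_{ii'}=-\frac{\sqrt{n_in_{i'}}p}{\bar d}(1-2\eta)$ ($i\ne i'$); $R_{k-1}\in\mathbb R^{k\times(k-1)}$: orthonormal eigenvectors of the $k-1$ smallest eigenvalues of $\bar C$. $M_{j*}$ is the $j$-th row, $M_{\tilde V*}$ the rows indexed by $\tilde V$. *)

theory Defs
  imports Complex_Main
begin

type_synonym rmat = "nat \<Rightarrow> nat \<Rightarrow> real"

definition mat_dims :: "nat \<Rightarrow> nat \<Rightarrow> rmat \<Rightarrow> bool" where
  "mat_dims r c M \<longleftrightarrow> (\<forall>i j. (r \<le> i \<or> c \<le> j) \<longrightarrow> M i j = 0)"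

definition mmul :: "nat \<Rightarrow> rmat \<Rightarrow> rmat \<Rightarrow> rmat" where
  "mmul m M N = (\<lambda>i j. \<Sum>l<m. M i l * N l j)"

definition msub :: "rmat \<Rightarrow> rmat \<Rightarrow> rmat" where
  "msub M N = (\<lambda>i j. M i j - N i j)"

definition opnorm :: "nat \<Rightarrow> nat \<Rightarrow> rmat \<Rightarrow> real" where
  "opnorm r c M = Sup {sqrt (\<Sum>i<r. (\<Sum>j<c. M i j * x j)\<^sup>2) | x. (\<Sum>j<c. (x j)\<^sup>2) \<le> 1}"

definition frob2 :: "nat \<Rightarrow> nat \<Rightarrow> rmat \<Rightarrow> real" where
  "frob2 r c M = (\<Sum>i<r. \<Sum>j<c. (M i j)\<^sup>2)"

definition row_norm2 :: "nat \<Rightarrow> rmat \<Rightarrow> nat \<Rightarrow> real" where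
  "row_norm2 c M i = (\<Sum>j<c. (M i j)\<^sup>2)"

definition orthogonal_mat :: "nat \<Rightarrow> rmat \<Rightarrow> bool" where
  "orthogonal_mat m Q \<longleftrightarrow> mat_dims m m Q \<and>
     (\<forall>a<m. \<forall>b<m. (\<Sum>j<m. Q j a * Q j b) = (if a = b then 1 else 0))"

definition perm_matrix :: "nat \<Rightarrow> rmat \<Rightarrow> bool" where
  "perm_matrix k P \<longleftrightarrow> mat_dims k k P \<and>
     (\<forall>i<k. \<forall>j<k. P i j \<in> {0, 1}) \<and>
     (\<forall>i<k. card {j. j < k \<and> P i j = 1} = 1) \<and>
     (\<forall>j<k. card {i. i < k \<and> P i j = 1} = 1)"

definition membership_mat :: "nat \<Rightarrow> nat \<Rightarrow> rmat \<Rightarrow> bool" where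
  "membership_mat n k T \<longleftrightarrow> mat_dims n k T \<and>
     (\<forall>j<n. \<forall>i<k. T j i \<in> {0, 1}) \<and>
     (\<forall>j<n. card {i. i < k \<and> T j i = 1} = 1)"

definition bottom_eigvecs :: "nat \<Rightarrow> nat \<Rightarrow> rmat \<Rightarrow> rmat \<Rightarrow> bool" where
  "bottom_eigvecs N m M V \<longleftrightarrow> mat_dims N m V \<and>
     (\<exists>U lam. (\<forall>a<N. \<forall>b<N. (\<Sum>j<N. U j a * U j b) = (if a = b then 1 else 0)) \<and>
              (\<forall>a<N. \<forall>j<N. (\<Sum>i<N. M j i * U i a) = lam a * U j a) \<and>
              (\<forall>a b. a \<le> b \<longrightarrow> b < N \<longrightarrow> lam a \<le> lam b) \<and>
              (\<forall>j<N. \<forall>a<m. V j a = U j a))"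

definition valid_partition :: "nat \<Rightarrow> nat \<Rightarrow> (nat \<Rightarrow> nat) \<Rightarrow> bool" where
  "valid_partition n k cl \<longleftrightarrow> (\<forall>j<n. cl j < k) \<and> (\<forall>i<k. \<exists>j<n. cl j = i)"

definition cluster :: "nat \<Rightarrow> (nat \<Rightarrow> nat) \<Rightarrow> nat \<Rightarrow> nat set" where
  "cluster n cl i = {j. j < n \<and> cl j = i}"

definition csize :: "nat \<Rightarrow> (nat \<Rightarrow> nat) \<Rightarrow> nat \<Rightarrow> real" where
  "csize n cl i = real (card (cluster n cl i))"

definition rho :: "nat \<Rightarrow> nat \<Rightarrow> (nat \<Rightarrow> nat) \<Rightarrow> real" where
  "rho n k cl = Min (csize n cl ` {..<k}) / Max (csize n cl ` {..<k})"

definition signed_adj :: "nat \<Rightarrow> rmat set" where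
  "signed_adj n = {A. (\<forall>i j. A i j \<in> {-1, 0, 1}) \<and> (\<forall>i j. A i j = A j i) \<and>
                      (\<forall>i. A i i = 0) \<and> mat_dims n n A}"

text \<open>Probability of the value a on one pair: edge present w.p. p, sign +1 within a
  cluster and -1 across, flipped w.p. eta.\<close>
definition edge_prob :: "real \<Rightarrow> real \<Rightarrow> bool \<Rightarrow> real \<Rightarrow> real" where
  "edge_prob p \<eta> same a =
     (if a = 0 then 1 - p
      else if a = (if same then 1 else -1) then p * (1 - \<eta>) else p * \<eta>)"

definition ssbm_weight :: "nat \<Rightarrow> (nat \<Rightarrow> nat) \<Rightarrow> real \<Rightarrow> real \<Rightarrow> rmat \<Rightarrow> real" where
  "ssbm_weight n cl p \<eta> A =
     (\<Prod>(i, j) \<in> {(i, j). i < j \<and> j < n}. edge_prob p \<eta> (cl i = cl j) (A i j))"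

definition ssbm_prob :: "nat \<Rightarrow> (nat \<Rightarrow> nat) \<Rightarrow> real \<Rightarrow> real \<Rightarrow> (rmat \<Rightarrow> bool) \<Rightarrow> real" where
  "ssbm_prob n cl p \<eta> E = (\<Sum>A \<in> {A \<in> signed_adj n. E A}. ssbm_weight n cl p \<eta> A)"

definition Apos :: "rmat \<Rightarrow> rmat" where "Apos A = (\<lambda>i j. max (A i j) 0)"
definition Aneg :: "rmat \<Rightarrow> rmat" where "Aneg A = (\<lambda>i j. max (- A i j) 0)"

definition degree :: "nat \<Rightarrow> rmat \<Rightarrow> nat \<Rightarrow> real" where
  "degree n A j = (\<Sum>j'<n. Apos A j j' + Aneg A j j')"

definition dbar :: "nat \<Rightarrow> real \<Rightarrow> real" where
  "dbar n p = p * (real n - 1)"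

text \<open>\<open>L_sym = I - D^{-1/2} A D^{-1/2}\<close> (with 1/sqrt 0 = 0 by Isabelle's convention).\<close>
definition Lsym :: "nat \<Rightarrow> rmat \<Rightarrow> rmat" where
  "Lsym n A = (\<lambda>i j. if i < n \<and> j < n then
      (if i = j then 1 else 0) - A i j / (sqrt (degree n A i) * sqrt (degree n A j))
    else 0)"

definition Lgamma :: "nat \<Rightarrow> real \<Rightarrow> real \<Rightarrow> rmat \<Rightarrow> rmat" where
  "Lgamma n gp gm A = (\<lambda>i j. if i < n \<and> j < n then
      (if i = j then 1 else 0)
        - (A i j + (gp - gm) / real n)
          / (sqrt (degree n A i + (gp + gm)) * sqrt (degree n A j + (gp + gm)))
    else 0)"

definition Theta :: "nat \<Rightarrow> nat \<Rightarrow> (nat \<Rightarrow> nat) \<Rightarrow> rmat" where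
  "Theta n k cl = (\<lambda>j i. if j < n \<and> i < k \<and> cl j = i then 1 / sqrt (csize n cl i) else 0)"

definition Theta_hat :: "nat \<Rightarrow> nat \<Rightarrow> (nat \<Rightarrow> nat) \<Rightarrow> rmat" where
  "Theta_hat n k cl = (\<lambda>j i. if j < n \<and> i < k \<and> cl j = i then 1 else 0)"

definition Cbar :: "nat \<Rightarrow> nat \<Rightarrow> (nat \<Rightarrow> nat) \<Rightarrow> real \<Rightarrow> real \<Rightarrow> rmat" where
  "Cbar n k cl p \<eta> = (\<lambda>i i'. if i < k \<and> i' < k then
      (if i = i' then 1 + p / dbar n p * (1 - 2 * \<eta>) else 0)
      - (if i = i' then csize n cl i * p / dbar n p * (1 - 2 * \<eta>)
         else - sqrt (csize n cl i * csize n cl i') * p / dbar n p * (1 - 2 * \<eta>))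
    else 0)"

definition kmeans_cost :: "nat \<Rightarrow> nat \<Rightarrow> rmat \<Rightarrow> rmat \<Rightarrow> rmat \<Rightarrow> real" where
  "kmeans_cost n k V T R = frob2 n (k - 1) (msub (mmul k T R) V)"

definition approx_kmeans :: "nat \<Rightarrow> nat \<Rightarrow> real \<Rightarrow> rmat \<Rightarrow> rmat \<Rightarrow> rmat \<Rightarrow> bool" where
  "approx_kmeans n k \<xi> V T R \<longleftrightarrow> membership_mat n k T \<and> mat_dims k (k - 1) R \<and>
     kmeans_cost n k V T R \<le> (1 + \<xi>) *
       (INF TR \<in> {(T', R'). membership_mat n k T' \<and> mat_dims k (k - 1) R'}.
          kmeans_cost n k V (fst TR) (snd TR))"

definition recovery_event ::
  "nat \<Rightarrow> nat \<Rightarrow> (nat \<Rightarrow> nat) \<Rightarrow> real \<Rightarrow> real \<Rightarrow> rmat \<Rightarrow> (rmat \<Rightarrow> rmat) \<Rightarrow> rmat \<Rightarrow> bool" where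
  "recovery_event n k cl \<xi> \<delta> R L A \<longleftrightarrow>
     (\<forall>V. bottom_eigvecs n (k - 1) (L A) V \<longrightarrow>
        (\<exists>Q. orthogonal_mat (k - 1) Q \<and>
             opnorm n (k - 1) (msub V (mmul (k - 1) (mmul k (Theta n k cl) R) Q)) \<le> 2 * \<delta> \<and>
             (\<forall>T Rt. approx_kmeans n k \<xi> V T Rt \<longrightarrow>
                (let TR = mmul k T Rt;
                     ThRO = mmul (k - 1) (mmul k (Theta n k cl) R) Q;
                     S = (\<lambda>i. {j \<in> cluster n cl i.
                            row_norm2 (k - 1) (msub TR ThRO) j \<ge> 2 / (3 * csize n cl i)});
                     Vt = (\<Union>i<k. cluster n cl i - S i)
                 in \<exists>P. perm_matrix k P \<and>
                      (\<forall>j\<in>Vt. \<forall>i<k. T j i = mmul k (Theta_hat n k cl) P j i) \<and>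
                      (\<Sum>i<k. real (card (S i)) / csize n cl i)
                          \<le> 96 * (2 + \<xi>) * (real k - 1) * \<delta>\<^sup>2 \<and>
                      {j. j < n \<and> (\<exists>i<k. T j i \<noteq> mmul k (Theta_hat n k cl) P j i)}
                          \<subseteq> (\<Union>i<k. S i)))))"

end

theory Submission
  imports Defs "HOL-Analysis.Analysis"
begin

text \<open>
  With \<open>c\<close> chosen large the claim is vacuous unless \<open>n p > c ln n\<close>, and then \<open>ln n\<close> exceeds any
  prescribed constant. So it suffices to have one logarithm-free bound
  \<open>\<parallel>A - E A\<parallel> \<le> K sqrt (n p)\<close>, with failure probability \<open>n exp (- n p)\<close>, for the signed and for the
  unsigned adjacency matrix. It comes from the trace method with exponent \<open>L\<close> of order \<open>n p\<close>: only closed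
  walks using every edge at least twice contribute, the number of those with \<open>t\<close> vertices is proportional to
  the falling factorial of the dimension, and hence the trace for dimension \<open>n\<close> is compared with that of a
  dense \<open>2 L \<times> 2 L\<close> matrix with subgaussian entries, whose norm is controlled by a net.

  Degrees enter \<open>D\<^sup>-\<^sup>1\<^sup>/\<^sup>2 (E A) D\<^sup>-\<^sup>1\<^sup>/\<^sup>2\<close> only through their mean square deviation, because \<open>E A\<close> has
  entries at most \<open>p\<close>; that deviation is the norm of \<open>|A| - E |A|\<close> applied to the all-ones vector. The
  Laplacian is therefore close to \<open>(1 + g) I - g \<Theta> M \<Theta>\<^sup>T\<close> with \<open>g = (1 - 2 \<eta>) / (n - 1)\<close> and
  \<open>M = 2 diag(n\<^sub>i) - v v\<^sup>T\<close>, \<open>v\<^sub>i = sqrt n\<^sub>i\<close>, whose spectral gap is at least \<open>(1 - 2 \<eta>) / k\<close>. Davis--Kahan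
  and a polar decomposition give the orthogonal matrix.

  For the clustering step, two nodes that are close to one common k-means centre in the sense of the threshold
  \<open>2 / (3 n\<^sub>i)\<close> need not belong to one cluster. Instead, the total error being below \<open>1 / 12\<close>, every cluster
  contains a node whose centre is very accurate; these centres are distinct, so they exhaust the \<open>k\<close> classes,
  and then the threshold does separate them.
\<close>

section \<open>Closed walks covering every edge at least twice\<close>

text \<open>Comparing walks across dimensions replaces any enumeration of them: a class of
  isomorphic walks with \<open>t\<close> vertices has at most \<open>n^t\<close> members in
  dimension \<open>n\<close>, each of expected weight at most \<open>2^L p^(t-1)\<close>, and at
  least \<open>2 L^t\<close> members in dimension \<open>2 L\<close>. So \<open>L \<ge> n p\<close>
  leaves only a prefactor \<open>n / (2 L)\<close> beside the dense count. In the dense matrix the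
  net has size exponential in \<open>L\<close>, which an \<open>L\<close>-th root turns into a
  constant. The price is an astronomical \<open>K\<close>, whereas the statement demands
  \<open>C\<^sub>0 < 43\<close>. Hence \<open>K\<close> is paid for by \<open>ln n\<close> in the
  dense case, and by the freely chosen \<open>C\<close> in the sparse case. Outside the vacuous
  range all degrees are at least half their mean with the required probability, so both Laplacians
  fall under one perturbation bound, the dense case being that of zero regularisation. Complete
  eigenbases of the Laplacian and of \<open>Cbar\<close> are part of \<open>bottom_eigvecs\<close>,
  so no spectral theorem has to be proved: the linear algebra rests on dimension counting and on one
  compactness argument, for the polar factor.\<close>

fun steps :: "nat list \<Rightarrow> (nat \<times> nat) list" where
  "steps (x # y # xs) = (min x y, max x y) # steps (y # xs)"
| "steps _ = []"

fun walk_prod :: "rmat \<Rightarrow> nat list \<Rightarrow> real" where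
  "walk_prod X (x # y # xs) = X x y * walk_prod X (y # xs)"
| "walk_prod X _ = 1"

text \<open>These are the walks whose expected weight can be nonzero when the entries above the
  diagonal are independent and centred and the diagonal vanishes. As \<open>steps\<close> sorts each
  edge, traversals in both directions count towards one multiplicity.\<close>

definition good_walk :: "nat list \<Rightarrow> bool" where
  "good_walk xs \<longleftrightarrow> (\<forall>e\<in>set (steps xs). fst e \<noteq> snd e \<and> 2 \<le> count_list (steps xs) e)"

definition walks :: "nat \<Rightarrow> nat \<Rightarrow> nat list set" where
  "walks n L = {xs. set xs \<subseteq> {..<n} \<and> length xs = Suc L \<and> hd xs = last xs}"

definition good_walks :: "nat \<Rightarrow> nat \<Rightarrow> nat list set" where
  "good_walks n L = {xs \<in> walks n L. good_walk xs}"

text \<open>Truncated subtraction makes this vanish for \<open>t > n\<close>, as it should: it counts injections.\<close>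

definition falling :: "nat \<Rightarrow> nat \<Rightarrow> real" where
  "falling n t = real (\<Prod>i<t. n - i)"

lemma finite_walks: "finite (walks n L)"
proof (rule finite_subset)
  show "walks n L \<subseteq> {xs. set xs \<subseteq> {..<n} \<and> length xs = Suc L}"
    by (auto simp: walks_def)
qed (rule finite_lists_length_eq, simp)

lemma finite_good_walks: "finite (good_walks n L)"
  using finite_walks unfolding good_walks_def by simp

lemma steps_subset: "e \<in> set (steps xs) \<Longrightarrow> fst e \<in> set xs \<and> snd e \<in> set xs \<and> fst e \<le> snd e"
  by (induction xs rule: steps.induct) (auto simp: min_def max_def split: if_splits)

lemma length_steps: "length (steps xs) = length xs - 1"
  by (induction xs rule: steps.induct) auto

lemma steps_map:
  "steps (map f xs) = map (\<lambda>e. (min (f (fst e)) (f (snd e)), max (f (fst e)) (f (snd e)))) (steps xs)"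
  by (induction xs rule: steps.induct) (auto simp: min_def max_def)

text \<open>The inequality between vertices and edges of a connected graph: reading the list from
  its end, a vertex not met before arrives on an edge not met before.\<close>

lemma card_set_le_card_steps: "card (set xs) \<le> Suc (card (set (steps xs)))"
proof (induction xs rule: steps.induct)
  case (1 x y xs)
  show ?case
  proof (cases "x \<in> set (y # xs)")
    case True
    then have "card (set (x # y # xs)) = card (set (y # xs))"
      by (simp add: insert_absorb)
    also have "\<dots> \<le> Suc (card (set (steps (y # xs))))" by (rule 1)
    also have "\<dots> \<le> Suc (card (set (steps (x # y # xs))))"
      by (auto intro!: card_mono)
    finally show ?thesis .
  next
    case False
    have "(min x y, max x y) \<notin> set (steps (y # xs))"
    proof
      assume "(min x y, max x y) \<in> set (steps (y # xs))"
      from steps_subset[OF this] False show False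
        by (auto simp: min_def max_def split: if_splits)
    qed
    with False 1 show ?thesis by simp
  qed
qed auto

text \<open>A relabelling need not be monotone, so an edge has to be sorted again after it; the
  sorted pair still determines the unordered one. Multiplicities of edges are therefore
  preserved.\<close>

lemma inj_on_edge_map:
  assumes "inj_on f S"
  shows "inj_on (\<lambda>e. (min (f (fst e)) (f (snd e)), max (f (fst e)) (f (snd e))))
           {e. fst e \<in> S \<and> snd e \<in> S \<and> fst e \<le> (snd e :: nat)}"
proof (rule inj_onI, clarsimp)
  fix a b a' b' :: nat
  assume *: "a \<in> S" "b \<in> S" "a \<le> b" "a' \<in> S" "b' \<in> S" "a' \<le> b'"
    and "min (f a) (f b) = min (f a') (f b')" "max (f a) (f b) = max (f a') (f b')"
  then have "(f a = f a' \<and> f b = f b') \<or> (f a = f b' \<and> f b = f a')"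
    by (auto simp: min_def max_def split: if_splits)
  with * assms have "(a = a' \<and> b = b') \<or> (a = b' \<and> b = a')"
    by (auto dest: inj_onD)
  with * show "a = a' \<and> b = b'" by auto
qed

lemma good_walk_map:
  assumes "inj_on f (set xs)"
  shows "good_walk (map f xs) \<longleftrightarrow> good_walk xs"
proof -
  let ?g = "\<lambda>e. (min (f (fst e)) (f (snd e)), max (f (fst e)) (f (snd e)))"
  have inj: "inj_on ?g (set (steps xs))"
    by (rule inj_on_subset[OF inj_on_edge_map[OF assms]]) (use steps_subset in blast)
  have *: "fst (?g e) \<noteq> snd (?g e) \<longleftrightarrow> fst e \<noteq> snd e" if "e \<in> set (steps xs)" for e
    using steps_subset[OF that] assms by (auto simp: min_def max_def dest: inj_onD)
  have "count_list (steps (map f xs)) (?g e) = count_list (steps xs) e" if "e \<in> set (steps xs)" for e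
    unfolding steps_map using count_list_inj_map[OF inj that] .
  then show ?thesis unfolding good_walk_def using * by (simp add: steps_map)
qed

lemma walk_map:
  assumes "xs \<in> walks n L" "f \<in> set xs \<rightarrow> {..<r}"
  shows "map f xs \<in> walks r L"
proof -
  from assms have "xs \<noteq> []" by (auto simp: walks_def)
  with assms show ?thesis by (auto simp: walks_def hd_map last_map)
qed

text \<open>Equality up to renaming vertices, which makes sense between walks in different
  dimensions.\<close>

definition iso_walk :: "nat list \<Rightarrow> nat list \<Rightarrow> bool" where
  "iso_walk xs ys \<longleftrightarrow> (\<exists>f. inj_on f (set xs) \<and> ys = map f xs)"

lemma iso_walk_sym: "iso_walk xs ys \<longleftrightarrow> iso_walk ys xs"
proof -
  have "iso_walk ys xs" if "iso_walk xs ys" for xs ys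
  proof -
    from that obtain f where f: "inj_on f (set xs)" "ys = map f xs" by (auto simp: iso_walk_def)
    let ?h = "inv_into (set xs) f"
    have "map ?h ys = xs" using f by (simp add: map_idI)
    moreover have "inj_on ?h (set ys)" using f by (auto intro: inj_on_inv_into)
    ultimately show ?thesis unfolding iso_walk_def by metis
  qed
  then show ?thesis by blast
qed

text \<open>Copies of \<open>xs\<close> among the vertices below \<open>r\<close> correspond to
  injections of its vertex set; goodness is inherited by every copy.\<close>

lemma card_iso_walk:
  assumes "xs \<in> good_walks n L"
  shows "real (card {ys \<in> good_walks r L. iso_walk xs ys}) = falling r (card (set xs))"
proof -
  have xs: "xs \<in> walks n L" "good_walk xs" using assms by (auto simp: good_walks_def)
  let ?F = "{f \<in> set xs \<rightarrow>\<^sub>E {..<r}. inj_on f (set xs)}"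
  have "{ys \<in> good_walks r L. iso_walk xs ys} = (\<lambda>f. map f xs) ` ?F"
  proof (intro equalityI subsetI)
    fix ys assume "ys \<in> {ys \<in> good_walks r L. iso_walk xs ys}"
    then obtain f where f: "inj_on f (set xs)" "ys = map f xs" "set ys \<subseteq> {..<r}"
      by (auto simp: iso_walk_def good_walks_def walks_def)
    \<comment> \<open>Restriction to the vertex set makes the relabelling extensional, so that the
      relabelled walk determines it.\<close>
    then have "restrict f (set xs) \<in> ?F" "ys = map (restrict f (set xs)) xs"
      by (auto simp: inj_on_def)
    then show "ys \<in> (\<lambda>f. map f xs) ` ?F" by blast
  next
    fix ys assume "ys \<in> (\<lambda>f. map f xs) ` ?F"
    then obtain f where f: "f \<in> ?F" "ys = map f xs" by blast
    then have "ys \<in> walks r L" using walk_map[OF xs(1)] by auto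
    with f xs show "ys \<in> {ys \<in> good_walks r L. iso_walk xs ys}"
      by (auto simp: good_walks_def good_walk_map iso_walk_def)
  qed
  moreover have "inj_on (\<lambda>f. map f xs) ?F"
  proof (rule inj_onI)
    fix f g assume fg: "f \<in> ?F" "g \<in> ?F" "map f xs = map g xs"
    show "f = g"
    proof (rule PiE_ext)
      show "f \<in> set xs \<rightarrow>\<^sub>E {..<r}" "g \<in> set xs \<rightarrow>\<^sub>E {..<r}" using fg by auto
      show "f x = g x" if "x \<in> set xs" for x using fg(3) that by simp
    qed
  qed
  moreover have "card ?F = (\<Prod>i<card (set xs). r - i)"
    using card_inj_on_subset_funcset[of "set xs" "{..<r}" "set xs"] by (simp add: atLeast0LessThan)
  ultimately show ?thesis by (simp add: card_image falling_def)
qed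

lemma card_set_walk:
  assumes "xs \<in> walks n L" "0 < L"
  shows "1 \<le> card (set xs)" "card (set xs) \<le> L"
proof -
  have len: "length xs = Suc L" and hl: "hd xs = last xs" using assms by (auto simp: walks_def)
  obtain x ys where xs: "xs = x # ys" using len by (cases xs) auto
  have "ys \<noteq> []" using len xs assms by auto
  then have "last xs \<in> set ys" using xs by simp
  then have "set xs = set ys" using xs hl by auto
  then show "card (set xs) \<le> L" using card_length[of ys] len xs by simp
  show "1 \<le> card (set xs)" using xs by (simp add: Suc_le_eq card_gt_0_iff)
qed

text \<open>Every factor of \<open>falling n t\<close> is at most \<open>n\<close>. Since
  \<open>t \<le> L\<close>, every factor of \<open>falling (2 * L) t\<close> is at least
  \<open>L\<close>. The \<open>t - 1\<close> later factors contribute \<open>n p / L \<le> 1\<close>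
  each, and the first ones leave \<open>n / (2 L)\<close>.\<close>

lemma falling_ratio:
  assumes "1 \<le> t" "t \<le> L" "0 \<le> p" "real n * p \<le> real L"
  shows "falling n t * p ^ (t - 1) / falling (2 * L) t \<le> real n / real (2 * L)"
    and "0 < falling (2 * L) t"
proof -
  obtain s where t: "t = Suc s" using assms by (cases t) auto
  have L: "0 < L" using assms by simp
  have "real (\<Prod>i<s. n - Suc i) \<le> real n ^ s"
    using prod_mono[of "{..<s}" "\<lambda>i. real (n - Suc i)" "\<lambda>_. real n"] by simp
  then have 1: "falling n t \<le> real n * real n ^ s"
    unfolding falling_def t by (subst prod.lessThan_Suc_shift) (simp add: mult_left_mono)
  have "real L ^ s \<le> real (\<Prod>i<s. 2 * L - Suc i)"
    using prod_mono[of "{..<s}" "\<lambda>_. real L" "\<lambda>i. real (2 * L - Suc i)"] assms t by simp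
  then have 2: "real (2 * L) * real L ^ s \<le> falling (2 * L) t"
    unfolding falling_def t by (subst prod.lessThan_Suc_shift) (simp add: mult_left_mono)
  show pos: "0 < falling (2 * L) t" by (rule less_le_trans[OF _ 2]) (use L in simp)
  have "falling n t * p ^ s \<le> real n * real n ^ s * p ^ s"
    by (rule mult_right_mono[OF 1]) (use assms in simp)
  also have "\<dots> = real n * (real n * p) ^ s" by (simp add: power_mult_distrib)
  also have "\<dots> \<le> real n * real L ^ s"
    by (intro mult_left_mono power_mono) (use assms in auto)
  also have "\<dots> = real n / real (2 * L) * (real (2 * L) * real L ^ s)" using L by simp
  also have "\<dots> \<le> real n / real (2 * L) * falling (2 * L) t"
    by (rule mult_left_mono[OF 2]) simp
  finally show "falling n t * p ^ (t - 1) / falling (2 * L) t \<le> real n / real (2 * L)"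
    using pos t by (simp add: divide_le_eq)
qed

text \<open>
  Double counting of pairs of isomorphic walks in dimensions \<open>n\<close> and \<open>2 L\<close>. The choice \<open>2 L\<close> leaves at least
  \<open>L \<ge> n p\<close> free vertices for each new vertex of a walk of length \<open>L\<close>.
\<close>

lemma sum_good_walks_le:
  assumes "0 < L" "0 \<le> p" "real n * p \<le> real L"
  shows "(\<Sum>w\<in>good_walks n L. p ^ (card (set w) - 1))
         \<le> real n / real (2 * L) * real (card (good_walks (2 * L) L))"
proof -
  define r where "r = 2 * L"
  let ?c = "\<lambda>w. card (set w)"
  let ?h = "\<lambda>w. p ^ (?c w - 1) / falling r (?c w)"
  have pos: "0 < falling r (?c w)" if "w \<in> good_walks m L" for w m
    unfolding r_def using that assms card_set_walk[of w m L]
    by (intro falling_ratio(2)[of _ _ 0 0]) (auto simp: good_walks_def)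
  have ceq: "?c w = ?c w'" if "iso_walk w w'" for w w'
    using that by (auto simp: iso_walk_def card_image)
  \<comment> \<open>The weight of each walk is spread evenly over its copies in dimension
    \<open>r\<close>; \<open>pos\<close> says that there are some. The share \<open>?h\<close>
    depends only on the number of vertices, hence agrees on isomorphic walks.\<close>
  have "(\<Sum>w\<in>good_walks n L. p ^ (?c w - 1))
      = (\<Sum>w\<in>good_walks n L. \<Sum>w'\<in>{w' \<in> good_walks r L. iso_walk w w'}. ?h w)"
  proof (rule sum.cong[OF refl])
    fix w assume w: "w \<in> good_walks n L"
    show "p ^ (?c w - 1) = (\<Sum>w'\<in>{w' \<in> good_walks r L. iso_walk w w'}. ?h w)"
      using card_iso_walk[OF w, of r] pos[OF w] by simp
  qed
  also have "\<dots> = (\<Sum>w'\<in>good_walks r L. \<Sum>w\<in>{w \<in> good_walks n L. iso_walk w w'}. ?h w)"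
    by (rule sum.swap_restrict) (auto simp: finite_good_walks)
  also have "\<dots> = (\<Sum>w'\<in>good_walks r L. falling n (?c w') * ?h w')"
  proof (rule sum.cong[OF refl])
    fix w' assume w': "w' \<in> good_walks r L"
    have "(\<Sum>w\<in>{w \<in> good_walks n L. iso_walk w w'}. ?h w)
        = (\<Sum>w\<in>{w \<in> good_walks n L. iso_walk w' w}. ?h w')"
      by (rule sum.cong) (auto simp: iso_walk_sym dest: ceq)
    then show "(\<Sum>w\<in>{w \<in> good_walks n L. iso_walk w w'}. ?h w) = falling n (?c w') * ?h w'"
      using card_iso_walk[OF w', of n] by simp
  qed
  also have "\<dots> \<le> (\<Sum>w'\<in>good_walks r L. real n / real r)"
  proof (rule sum_mono)
    fix w' assume "w' \<in> good_walks r L"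
    then have "1 \<le> ?c w'" "?c w' \<le> L" using card_set_walk assms by (auto simp: good_walks_def)
    from falling_ratio(1)[OF this assms(2,3)]
    show "falling n (?c w') * ?h w' \<le> real n / real r" by (simp add: r_def)
  qed
  finally show ?thesis by (simp add: r_def mult.commute)
qed

section \<open>Matrix powers as sums over walks\<close>

fun mpow :: "nat \<Rightarrow> rmat \<Rightarrow> nat \<Rightarrow> rmat" where
  "mpow n X 0 = (\<lambda>a b. if a = b then 1 else 0)"
| "mpow n X (Suc j) = (\<lambda>a b. \<Sum>c<n. X a c * mpow n X j c b)"

lemma mpow_eq_sum_walks:
  assumes "a < n" "b < n"
  shows "mpow n X j a b =
    (\<Sum>xs\<in>{xs. set xs \<subseteq> {..<n} \<and> length xs = Suc j \<and> hd xs = a \<and> last xs = b}. walk_prod X xs)"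
  using assms
proof (induction j arbitrary: a)
  case 0
  have "{xs. set xs \<subseteq> {..<n} \<and> length xs = Suc 0 \<and> hd xs = a \<and> last xs = b}
      = (if a = b then {[a]} else {})"
    using 0 by (auto simp: length_Suc_conv)
  then show ?case by simp
next
  case (Suc j)
  let ?W = "\<lambda>j a. {xs. set xs \<subseteq> {..<n} \<and> length xs = Suc j \<and> hd xs = a \<and> last xs = b}"
  have fin: "finite (?W j c)" for j c
    by (rule finite_subset[OF _ finite_lists_length_eq[of "{..<n}" "Suc j"]]) auto
  have eq: "?W (Suc j) a = (\<Union>c<n. (#) a ` ?W j c)"
  proof (intro equalityI subsetI)
    fix xs assume xs: "xs \<in> ?W (Suc j) a"
    then obtain ys where ys: "xs = a # ys" "length ys = Suc j" by (auto simp: length_Suc_conv)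
    then have "ys \<noteq> []" by auto
    with xs ys have "ys \<in> ?W j (hd ys)" "hd ys < n" by (cases ys; auto)+
    with ys show "xs \<in> (\<Union>c<n. (#) a ` ?W j c)" by blast
  next
    fix xs assume "xs \<in> (\<Union>c<n. (#) a ` ?W j c)"
    then show "xs \<in> ?W (Suc j) a" using Suc.prems by (auto simp: length_Suc_conv)
  qed
  have "(\<Sum>xs\<in>?W (Suc j) a. walk_prod X xs) = (\<Sum>c<n. \<Sum>xs\<in>(#) a ` ?W j c. walk_prod X xs)"
    unfolding eq by (rule sum.UNION_disjoint) (use fin in auto)
  also have "\<dots> = (\<Sum>c<n. X a c * mpow n X j c b)"
  proof (rule sum.cong[OF refl])
    fix c assume c: "c \<in> {..<n}"
    have "(\<Sum>xs\<in>(#) a ` ?W j c. walk_prod X xs) = (\<Sum>xs\<in>?W j c. walk_prod X (a # xs))"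
      by (subst sum.reindex) (auto simp: inj_on_def)
    also have "\<dots> = (\<Sum>xs\<in>?W j c. X a c * walk_prod X xs)"
      by (rule sum.cong) (auto simp: length_Suc_conv)
    also have "\<dots> = X a c * mpow n X j c b"
      using Suc.IH[of c] c Suc.prems by (simp add: sum_distrib_left)
    finally show "(\<Sum>xs\<in>(#) a ` ?W j c. walk_prod X xs) = X a c * mpow n X j c b" .
  qed
  finally show ?case by simp
qed

lemma trace_mpow_eq_sum_walks: "(\<Sum>a<n. mpow n X L a a) = (\<Sum>xs\<in>walks n L. walk_prod X xs)"
proof -
  let ?W = "\<lambda>a. {xs. set xs \<subseteq> {..<n} \<and> length xs = Suc L \<and> hd xs = a \<and> last xs = a}"
  have fin: "finite (?W c)" for c
    by (rule finite_subset[OF _ finite_lists_length_eq[of "{..<n}" "Suc L"]]) auto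
  have "walks n L = (\<Union>a<n. ?W a)"
  proof (intro equalityI subsetI)
    fix xs assume xs: "xs \<in> walks n L"
    then have "hd xs \<in> set xs" unfolding walks_def by (intro hd_in_set) auto
    with xs show "xs \<in> (\<Union>a<n. ?W a)" by (auto simp: walks_def)
  qed (auto simp: walks_def)
  then have "(\<Sum>xs\<in>walks n L. walk_prod X xs) = (\<Sum>xs\<in>(\<Union>a<n. ?W a). walk_prod X xs)"
    by simp
  also have "\<dots> = (\<Sum>a<n. \<Sum>xs\<in>?W a. walk_prod X xs)"
    by (rule sum.UNION_disjoint) (use fin in auto)
  also have "\<dots> = (\<Sum>a<n. mpow n X L a a)"
    by (rule sum.cong[OF refl]) (simp add: mpow_eq_sum_walks)
  finally show ?thesis by simp
qed

text \<open>Collects the factors edge by edge, the form in which independence applies. Edges of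
  \<open>I\<close> off the walk enter with exponent zero, so one index set serves all walks.\<close>

lemma walk_prod_eq_prod_power:
  assumes sym: "\<And>a b. X a b = X b a" and fin: "finite I" and sub: "set (steps xs) \<subseteq> I"
  shows "walk_prod X xs = (\<Prod>e\<in>I. X (fst e) (snd e) ^ count_list (steps xs) e)"
  using sub
proof (induction xs rule: steps.induct)
  case (1 x y xs)
  let ?e = "(min x y, max x y)" and ?c = "\<lambda>e. count_list (steps (y # xs)) e"
  have e: "?e \<in> I" using 1 by simp
  have "(\<Prod>e\<in>I. X (fst e) (snd e) ^ count_list (steps (x # y # xs)) e)
      = (\<Prod>e\<in>I. (if e = ?e then X (fst e) (snd e) else 1) * X (fst e) (snd e) ^ ?c e)"
    by (rule prod.cong) auto
  also have "\<dots> = X (min x y) (max x y) * (\<Prod>e\<in>I. X (fst e) (snd e) ^ ?c e)"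
    using e fin by (simp add: prod.distrib prod.delta)
  also have "X (min x y) (max x y) = X x y" using sym by (simp add: min_def max_def)
  finally show ?case using 1 by simp
qed auto

section \<open>Norms and traces of matrix powers\<close>

definition vnorm :: "nat \<Rightarrow> (nat \<Rightarrow> real) \<Rightarrow> real" where
  "vnorm n x = L2_set x {..<n}"

definition mulv :: "nat \<Rightarrow> rmat \<Rightarrow> (nat \<Rightarrow> real) \<Rightarrow> nat \<Rightarrow> real" where
  "mulv n M x = (\<lambda>i. \<Sum>j<n. M i j * x j)"

definition ip :: "nat \<Rightarrow> (nat \<Rightarrow> real) \<Rightarrow> (nat \<Rightarrow> real) \<Rightarrow> real" where
  "ip n x y = (\<Sum>i<n. x i * y i)"

text \<open>A bound on the operator norm without the supremum that occurs in \<open>opnorm\<close>;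
  the latter returns only at the end, through \<open>opnorm_le\<close>.\<close>

definition op_le :: "nat \<Rightarrow> nat \<Rightarrow> rmat \<Rightarrow> real \<Rightarrow> bool" where
  "op_le r c M B \<longleftrightarrow> (\<forall>x. vnorm r (mulv c M x) \<le> B * vnorm c x)"

lemma vnorm_nonneg [simp]: "0 \<le> vnorm n x"
  by (simp add: vnorm_def)

lemma vnorm_sq: "(vnorm n x)\<^sup>2 = (\<Sum>i<n. (x i)\<^sup>2)"
  by (simp add: vnorm_def L2_set_def sum_nonneg)

lemma vnorm_sq_ip: "(vnorm n x)\<^sup>2 = ip n x x"
  unfolding vnorm_sq ip_def by (simp add: power2_eq_square)

lemma ip_le_vnorm: "\<bar>ip n x y\<bar> \<le> vnorm n x * vnorm n y"
proof -
  have "\<bar>ip n x y\<bar> \<le> (\<Sum>i<n. \<bar>x i\<bar> * \<bar>y i\<bar>)"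
    unfolding ip_def using sum_abs[of "\<lambda>i. x i * y i" "{..<n}"] by (simp add: abs_mult)
  also have "\<dots> \<le> vnorm n x * vnorm n y" unfolding vnorm_def by (rule L2_set_mult_ineq)
  finally show ?thesis .
qed

lemma vnorm_triangle: "vnorm n (\<lambda>i. x i + y i) \<le> vnorm n x + vnorm n y"
  unfolding vnorm_def by (rule L2_set_triangle_ineq)

lemma vnorm_scale: "vnorm n (\<lambda>i. c * x i) = \<bar>c\<bar> * vnorm n x"
proof -
  have "(vnorm n (\<lambda>i. c * x i))\<^sup>2 = (\<bar>c\<bar> * vnorm n x)\<^sup>2"
    by (simp add: vnorm_sq power_mult_distrib sum_distrib_left)
  then show ?thesis by (simp add: power2_eq_iff_nonneg)
qed

lemma vnorm_cong: "(\<And>i. i < n \<Longrightarrow> x i = y i) \<Longrightarrow> vnorm n x = vnorm n y"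
  unfolding vnorm_def by (rule L2_set_cong) auto

lemma mulv_cong: "(\<And>i. i < n \<Longrightarrow> x i = y i) \<Longrightarrow> mulv n M x = mulv n M y"
  unfolding mulv_def by (intro ext sum.cong) auto

lemma ip_cong: "(\<And>i. i < n \<Longrightarrow> x i = x' i) \<Longrightarrow> (\<And>i. i < n \<Longrightarrow> y i = y' i) \<Longrightarrow> ip n x y = ip n x' y'"
  unfolding ip_def by (intro sum.cong) auto

lemma ip_commute: "ip n x y = ip n y x"
  by (simp add: ip_def mult.commute)

lemma ip_mulv:
  "ip r x (mulv c M y) = ip c (mulv r (\<lambda>i j. M j i) x) y"
  unfolding ip_def mulv_def sum_distrib_left sum_distrib_right
  by (subst sum.swap) (simp add: mult_ac)

lemma mulv_mpow: "mulv n (mpow n X j) x i = ((mulv n X ^^ j) x) i" if "i < n"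
  using that
proof (induction j arbitrary: i)
  case 0
  have "(\<Sum>k<n. (if i = k then 1 else 0) * x k) = (\<Sum>k<n. if i = k then x k else 0)"
    by (rule sum.cong) auto
  then show ?case using 0 by (simp add: mulv_def)
next
  case (Suc j)
  have "mulv n (mpow n X (Suc j)) x i = (\<Sum>c<n. X i c * mulv n (mpow n X j) x c)"
    unfolding mulv_def mpow.simps sum_distrib_left sum_distrib_right
    by (subst sum.swap) (simp add: mult_ac)
  also have "\<dots> = (\<Sum>c<n. X i c * (mulv n X ^^ j) x c)"
    by (rule sum.cong) (use Suc.IH in auto)
  finally show ?case by (simp add: mulv_def[of n X "(mulv n X ^^ j) x"])
qed

lemma ip_mulv_pow:
  assumes "\<And>a b. X a b = X b a"
  shows "ip n x ((mulv n X ^^ (i + j)) y) = ip n ((mulv n X ^^ i) x) ((mulv n X ^^ j) y)"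
proof (induction i arbitrary: x)
  case (Suc i)
  have "ip n x ((mulv n X ^^ (Suc i + j)) y) = ip n (mulv n X x) ((mulv n X ^^ (i + j)) y)"
    using ip_mulv[of n x n X "(mulv n X ^^ (i + j)) y"] assms by simp
  also have "\<dots> = ip n ((mulv n X ^^ i) (mulv n X x)) ((mulv n X ^^ j) y)" by (rule Suc)
  finally show ?case by (simp add: funpow_swap1)
qed simp

text \<open>For symmetric \<open>X\<close> the trace of \<open>X^(2m)\<close> is the squared
  Frobenius norm of \<open>X^m\<close>. Nonnegativity and both comparisons of trace and norm follow
  from this.\<close>

lemma trace_mpow_double:
  assumes sym: "\<And>a b. X a b = X b a"
  shows "(\<Sum>a<n. mpow n X (m + m) a a) = (\<Sum>a<n. (vnorm n ((mulv n X ^^ m) (\<lambda>b. if b = a then 1 else 0)))\<^sup>2)"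
proof (rule sum.cong[OF refl])
  fix a assume a: "a \<in> {..<n}"
  let ?e = "\<lambda>b. if b = a then 1 else (0::real)"
  have 1: "mulv n (mpow n X j) ?e i = mpow n X j i a" for i j
    using a by (simp add: mulv_def if_distrib cong: if_cong)
  have "(vnorm n ((mulv n X ^^ m) ?e))\<^sup>2 = ip n ?e ((mulv n X ^^ (m + m)) ?e)"
    unfolding vnorm_sq_ip by (rule ip_mulv_pow[OF sym, symmetric])
  also have "\<dots> = ip n ?e (mulv n (mpow n X (m + m)) ?e)"
    by (rule ip_cong) (simp_all add: mulv_mpow)
  also have "\<dots> = mpow n X (m + m) a a"
    using a unfolding ip_def 1 by (simp add: if_distrib if_distribR cong: if_cong)
  finally show "mpow n X (m + m) a a = (vnorm n ((mulv n X ^^ m) ?e))\<^sup>2" ..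
qed

lemma vnorm_mulv_pow_le:
  assumes "op_le n n X B" "0 \<le> B"
  shows "vnorm n ((mulv n X ^^ m) x) \<le> B ^ m * vnorm n x"
proof (induction m)
  case (Suc m)
  have "vnorm n ((mulv n X ^^ Suc m) x) \<le> B * vnorm n ((mulv n X ^^ m) x)"
    using assms(1) by (simp add: op_le_def)
  also have "\<dots> \<le> B * (B ^ m * vnorm n x)" using Suc assms(2) by (rule mult_left_mono)
  finally show ?case by (simp add: mult_ac)
qed simp

lemma trace_mpow_le:
  assumes sym: "\<And>a b. X a b = X b a" and B: "op_le n n X B" "0 \<le> B"
  shows "(\<Sum>a<n. mpow n X (2 * m) a a) \<le> real n * B ^ (2 * m)"
proof -
  have "(\<Sum>a<n. mpow n X (2 * m) a a) = (\<Sum>a<n. (vnorm n ((mulv n X ^^ m) (\<lambda>b. if b = a then 1 else 0)))\<^sup>2)"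
    using trace_mpow_double[OF sym, where n=n and m=m] by (simp add: mult_2)
  also have "\<dots> \<le> (\<Sum>a<n. B ^ (2 * m))"
  proof (rule sum_mono)
    fix a assume "a \<in> {..<n}"
    then have "(vnorm n (\<lambda>b. if b = a then 1 else 0))\<^sup>2 = 1"
      unfolding vnorm_sq by (simp add: if_distrib[of "\<lambda>z. z\<^sup>2"] cong: if_cong)
    then have "vnorm n (\<lambda>b. if b = a then 1 else 0) = 1"
      by (metis abs_of_nonneg power2_eq_1_iff vnorm_nonneg abs_1 abs_minus_cancel)
    then have "vnorm n ((mulv n X ^^ m) (\<lambda>b. if b = a then 1 else 0)) \<le> B ^ m"
      using vnorm_mulv_pow_le[OF B, of m "\<lambda>b. if b = a then 1 else 0"] by simp
    then have "(vnorm n ((mulv n X ^^ m) (\<lambda>b. if b = a then 1 else 0)))\<^sup>2 \<le> (B ^ m)\<^sup>2"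
      by (rule power_mono) simp
    then show "(vnorm n ((mulv n X ^^ m) (\<lambda>b. if b = a then 1 else 0)))\<^sup>2 \<le> B ^ (2 * m)"
      by (simp add: power_mult[symmetric] mult.commute)
  qed
  finally show ?thesis by simp
qed

lemma trace_mpow_nonneg:
  assumes sym: "\<And>a b. X a b = X b a"
  shows "0 \<le> (\<Sum>a<n. mpow n X (2 * m) a a)"
  using trace_mpow_double[OF sym, where n=n and m=m] by (simp add: mult_2 sum_nonneg)

text \<open>The operator norm of \<open>X^m\<close> is at most its Frobenius norm.\<close>

lemma mulv_pow_le_trace:
  assumes sym: "\<And>a b. X a b = X b a"
  shows "(vnorm n ((mulv n X ^^ m) x))\<^sup>2 \<le> (\<Sum>a<n. mpow n X (2 * m) a a) * (vnorm n x)\<^sup>2"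
proof -
  have sy: "mpow n X m i a = (mulv n X ^^ m) (\<lambda>b. if b = a then 1 else 0) i" if "a < n" "i < n" for i a
    using mulv_mpow[OF that(2), of X m "\<lambda>b. if b = a then 1 else 0"] that
    by (simp add: mulv_def if_distrib cong: if_cong)
  have "(vnorm n ((mulv n X ^^ m) x))\<^sup>2 = (\<Sum>i<n. (mulv n (mpow n X m) x i)\<^sup>2)"
    unfolding vnorm_sq by (rule sum.cong) (auto simp: mulv_mpow)
  also have "\<dots> \<le> (\<Sum>i<n. (\<Sum>a<n. (mpow n X m i a)\<^sup>2) * (vnorm n x)\<^sup>2)"
    unfolding mulv_def vnorm_sq by (intro sum_mono Cauchy_Schwarz_ineq_sum)
  also have "\<dots> = (\<Sum>a<n. \<Sum>i<n. (mpow n X m i a)\<^sup>2) * (vnorm n x)\<^sup>2"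
    unfolding sum_distrib_right[symmetric] by (subst sum.swap) simp
  also have "(\<Sum>a<n. \<Sum>i<n. (mpow n X m i a)\<^sup>2) = (\<Sum>a<n. (vnorm n ((mulv n X ^^ m) (\<lambda>b. if b = a then 1 else 0)))\<^sup>2)"
    unfolding vnorm_sq by (intro sum.cong refl) (simp add: sy)
  also have "\<dots> = (\<Sum>a<n. mpow n X (2 * m) a a)"
    using trace_mpow_double[OF sym, where n=n and m=m] by (simp add: mult_2)
  finally show ?thesis .
qed

text \<open>Repeated squaring: \<open>|X^m x|^2 = (x, X^(2m) x) \<le> |X^(2m) x|\<close> on the unit
  ball. This replaces diagonalisation of \<open>X\<close>, and it is the reason why trace exponents
  are powers of two.\<close>

lemma vnorm_mulv_power_two_le:
  assumes sym: "\<And>a b. X a b = X b a" and x: "vnorm n x \<le> 1"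
  shows "vnorm n (mulv n X x) ^ (2 ^ l) \<le> vnorm n ((mulv n X ^^ (2 ^ l)) x)"
proof (induction l)
  case (Suc l)
  let ?m = "2 ^ l :: nat" and ?y = "\<lambda>j. (mulv n X ^^ j) x"
  have "vnorm n (mulv n X x) ^ (2 ^ Suc l) = (vnorm n (mulv n X x) ^ ?m)\<^sup>2"
    by (simp add: power_mult[symmetric] mult.commute)
  also have "\<dots> \<le> (vnorm n (?y ?m))\<^sup>2" by (rule power_mono[OF Suc]) simp
  also have "\<dots> = ip n x (?y (?m + ?m))"
    unfolding vnorm_sq_ip by (rule ip_mulv_pow[OF sym, symmetric])
  also have "\<dots> \<le> vnorm n x * vnorm n (?y (?m + ?m))" using ip_le_vnorm abs_le_D1 by blast
  also have "\<dots> \<le> 1 * vnorm n (?y (?m + ?m))" using x by (rule mult_right_mono) simp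
  finally show ?case by (simp add: mult_2)
qed simp

lemma vnorm_mulv_le_of_trace:
  assumes sym: "\<And>a b. X a b = X b a" and L: "L = 2 * 2 ^ l"
    and tr: "(\<Sum>a<n. mpow n X L a a) \<le> B ^ L" and B: "0 \<le> B"
  shows "op_le n n X B"
proof -
  let ?m = "2 ^ l :: nat"
  have unit: "vnorm n (mulv n X x) \<le> B" if x: "vnorm n x \<le> 1" for x
  proof -
    have "(vnorm n (mulv n X x)) ^ L = (vnorm n (mulv n X x) ^ ?m)\<^sup>2"
      by (simp add: L power_mult[symmetric] mult.commute)
    also have "\<dots> \<le> (vnorm n ((mulv n X ^^ ?m) x))\<^sup>2"
      by (intro power_mono vnorm_mulv_power_two_le[OF sym x]) simp
    also have "\<dots> \<le> (\<Sum>a<n. mpow n X (2 * ?m) a a) * (vnorm n x)\<^sup>2" by (rule mulv_pow_le_trace[OF sym])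
    also have "\<dots> \<le> (\<Sum>a<n. mpow n X (2 * ?m) a a) * 1"
      by (intro mult_left_mono trace_mpow_nonneg[OF sym]) (use x in \<open>simp add: power_le_one\<close>)
    also have "\<dots> \<le> B ^ L" using tr L by simp
    finally show ?thesis
      by (subst (asm) power_mono_iff) (use B L in auto)
  qed
  show ?thesis unfolding op_le_def
  proof
    fix x
    show "vnorm n (mulv n X x) \<le> B * vnorm n x"
    proof (cases "vnorm n x = 0")
      case True
      then have "\<And>i. i < n \<Longrightarrow> x i = 0" by (simp add: vnorm_def L2_set_eq_0_iff)
      then have "mulv n X x = (\<lambda>_. 0)" by (simp add: mulv_def)
      then show ?thesis using B by (simp add: vnorm_def L2_set_def sum_nonneg)
    next
      case False
      then have pos: "0 < vnorm n x" using vnorm_nonneg[of n x] by linarith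
      let ?u = "\<lambda>i. (1 / vnorm n x) * x i"
      have "vnorm n ?u = 1" unfolding vnorm_scale using pos by simp
      then have "vnorm n (mulv n X ?u) \<le> B" by (intro unit) simp
      moreover have "mulv n X ?u = (\<lambda>i. (1 / vnorm n x) * mulv n X x i)"
        by (simp add: mulv_def sum_divide_distrib)
      ultimately have "(1 / vnorm n x) * vnorm n (mulv n X x) \<le> B"
        using pos by (simp only: vnorm_scale) simp
      then show ?thesis using pos by (simp add: field_simps)
    qed
  qed
qed

section \<open>Expected traces over product spaces\<close>

text \<open>Independent coordinates with values in a finite set, so that expectations are finite
  sums. The comparison matrix and the block model are both instances.\<close>

locale finite_product =
  fixes I :: "'e set" and \<Omega> :: "'a set" and wt :: "'e \<Rightarrow> 'a \<Rightarrow> real"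
  assumes finite_I: "finite I" and finite_Om: "finite \<Omega>"
    and wt_nonneg: "\<And>e a. e \<in> I \<Longrightarrow> a \<in> \<Omega> \<Longrightarrow> 0 \<le> wt e a"
    and wt_sum: "\<And>e. e \<in> I \<Longrightarrow> (\<Sum>a\<in>\<Omega>. wt e a) = 1"
begin

definition Ex :: "(('e \<Rightarrow> 'a) \<Rightarrow> real) \<Rightarrow> real" where
  "Ex F = (\<Sum>h\<in>PiE I (\<lambda>_. \<Omega>). (\<Prod>e\<in>I. wt e (h e)) * F h)"

text \<open>Independence is used in this form throughout: for walk weights, for moment generating
  functions and for degrees.\<close>

lemma Ex_prod: "Ex (\<lambda>h. \<Prod>e\<in>I. f e (h e)) = (\<Prod>e\<in>I. \<Sum>a\<in>\<Omega>. wt e a * f e a)"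
  unfolding Ex_def prod.distrib[symmetric]
  by (rule prod_sum_PiE[symmetric]) (auto simp: finite_I finite_Om)

lemma weight_nonneg: "h \<in> PiE I (\<lambda>_. \<Omega>) \<Longrightarrow> 0 \<le> (\<Prod>e\<in>I. wt e (h e))"
  by (rule prod_nonneg) (auto intro!: wt_nonneg)

lemma Ex_mono: "(\<And>h. h \<in> PiE I (\<lambda>_. \<Omega>) \<Longrightarrow> F h \<le> G h) \<Longrightarrow> Ex F \<le> Ex G"
  unfolding Ex_def by (intro sum_mono mult_left_mono weight_nonneg)

lemma Ex_nonneg: "(\<And>h. h \<in> PiE I (\<lambda>_. \<Omega>) \<Longrightarrow> 0 \<le> F h) \<Longrightarrow> 0 \<le> Ex F"
  unfolding Ex_def by (intro sum_nonneg mult_nonneg_nonneg weight_nonneg)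

lemma Ex_one: "Ex (\<lambda>_. 1) = 1"
  using Ex_prod[of "\<lambda>_ _. 1"] by (simp add: wt_sum)

lemma Ex_cmult: "Ex (\<lambda>h. c * F h) = c * Ex F"
  unfolding Ex_def by (simp add: sum_distrib_left mult_ac)

lemma Ex_sum: "Ex (\<lambda>h. \<Sum>j\<in>J. F j h) = (\<Sum>j\<in>J. Ex (F j))"
  unfolding Ex_def by (simp add: sum_distrib_left) (rule sum.swap)

lemma Ex_add: "Ex (\<lambda>h. F h + G h) = Ex F + Ex G"
  unfolding Ex_def by (simp add: sum.distrib distrib_left)

end

section \<open>Random symmetric matrices indexed by vertex pairs\<close>

definition pairs :: "nat \<Rightarrow> (nat \<times> nat) set" where
  "pairs n = {(i, j). i < j \<and> j < n}"

lemma finite_pairs: "finite (pairs n)"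
  by (rule finite_subset[of _ "{..<n} \<times> {..<n}"]) (auto simp: pairs_def)

definition sym_mat :: "nat \<Rightarrow> (nat \<times> nat \<Rightarrow> real) \<Rightarrow> rmat" where
  "sym_mat n v = (\<lambda>a b. if a < n \<and> b < n \<and> a \<noteq> b then v (min a b, max a b) else 0)"

lemma sym_mat_sym: "sym_mat n v a b = sym_mat n v b a"
  by (auto simp: sym_mat_def min.commute max.commute)

lemma walk_prod_loop:
  assumes "e \<in> set (steps xs)" "fst e = snd e" "\<And>a. X a a = 0"
  shows "walk_prod X xs = 0"
  using assms by (induction xs rule: steps.induct) (auto simp: min_def max_def split: if_splits)

lemma steps_in_pairs:
  assumes "xs \<in> walks n L" "\<forall>e\<in>set (steps xs). fst e \<noteq> snd e"
  shows "set (steps xs) \<subseteq> pairs n"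
proof
  fix e assume e: "e \<in> set (steps xs)"
  then have "snd e < n" using steps_subset[OF e] assms by (auto simp: walks_def)
  moreover have "fst e \<noteq> snd e" using assms(2) e by blast
  ultimately have "fst e < snd e \<and> snd e < n" using steps_subset[OF e] by linarith
  then show "e \<in> pairs n" by (cases e) (simp add: pairs_def)
qed

lemma walk_prod_sym_mat:
  assumes "xs \<in> walks n L"
  shows "walk_prod (sym_mat n v) xs =
    (if \<forall>e\<in>set (steps xs). fst e \<noteq> snd e then \<Prod>e\<in>pairs n. v e ^ count_list (steps xs) e else 0)"
proof (cases "\<forall>e\<in>set (steps xs). fst e \<noteq> snd e")
  case True
  note sub = steps_in_pairs[OF assms True]
  have "walk_prod (sym_mat n v) xs
      = (\<Prod>e\<in>pairs n. sym_mat n v (fst e) (snd e) ^ count_list (steps xs) e)"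
    by (rule walk_prod_eq_prod_power[OF sym_mat_sym finite_pairs sub])
  also have "\<dots> = (\<Prod>e\<in>pairs n. v e ^ count_list (steps xs) e)"
    by (rule prod.cong) (auto simp: pairs_def sym_mat_def)
  finally show ?thesis using True by simp
next
  case False
  then obtain e where "e \<in> set (steps xs)" "fst e = snd e" by blast
  then have "walk_prod (sym_mat n v) xs = 0" by (rule walk_prod_loop) (simp add: sym_mat_def)
  then show ?thesis using False by auto
qed

text \<open>The sample \<open>h e\<close> and the matrix entry \<open>g e (h e)\<close> are kept
  apart, so that one law of the edges yields both the centred signed and the centred unsigned
  adjacency matrix.\<close>

locale edge_product = finite_product "pairs n" \<Omega> wt
  for n :: nat and \<Omega> :: "'a set" and wt :: "nat \<times> nat \<Rightarrow> 'a \<Rightarrow> real" +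
  fixes g :: "nat \<times> nat \<Rightarrow> 'a \<Rightarrow> real"
  assumes centred: "\<And>e. e \<in> pairs n \<Longrightarrow> (\<Sum>a\<in>\<Omega>. wt e a * g e a) = 0"
begin

abbreviation "moment e k \<equiv> (\<Sum>a\<in>\<Omega>. wt e a * g e a ^ k)"

lemma moment_0: "e \<in> pairs n \<Longrightarrow> moment e 0 = 1"
  by (simp add: wt_sum)

text \<open>After factorisation over edges, an edge that is used exactly once contributes its mean,
  which is zero.\<close>

lemma Ex_walk_prod:
  assumes "xs \<in> walks n L"
  shows "Ex (\<lambda>h. walk_prod (sym_mat n (\<lambda>e. g e (h e))) xs) =
    (if good_walk xs then \<Prod>e\<in>pairs n. moment e (count_list (steps xs) e) else 0)"
proof (cases "\<forall>e\<in>set (steps xs). fst e \<noteq> snd e")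
  case True
  then have "Ex (\<lambda>h. walk_prod (sym_mat n (\<lambda>e. g e (h e))) xs)
      = Ex (\<lambda>h. \<Prod>e\<in>pairs n. g e (h e) ^ count_list (steps xs) e)"
    by (simp add: walk_prod_sym_mat[OF assms])
  also have "\<dots> = (\<Prod>e\<in>pairs n. moment e (count_list (steps xs) e))"
    by (rule Ex_prod)
  finally have eq: "Ex (\<lambda>h. walk_prod (sym_mat n (\<lambda>e. g e (h e))) xs)
      = (\<Prod>e\<in>pairs n. moment e (count_list (steps xs) e))" .
  have "(\<Prod>e\<in>pairs n. moment e (count_list (steps xs) e)) = 0" if bad: "\<not> good_walk xs"
  proof -
    from bad True obtain e where e: "e \<in> set (steps xs)" "\<not> 2 \<le> count_list (steps xs) e"
      by (auto simp: good_walk_def)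
    then have "count_list (steps xs) e = Suc 0" using count_list_0_iff[of "steps xs" e] by auto
    moreover have "e \<in> pairs n" using e steps_in_pairs[OF assms True] by blast
    ultimately have "\<exists>e\<in>pairs n. moment e (count_list (steps xs) e) = 0"
      using centred[of e] by (intro bexI[of _ e]) simp_all
    then show ?thesis by (rule prod_zero[OF finite_pairs])
  qed
  then show ?thesis using eq by (cases "good_walk xs") simp_all
next
  case False
  then have "\<not> good_walk xs" by (auto simp: good_walk_def)
  then show ?thesis using False by (subst walk_prod_sym_mat[OF assms]) (simp only: if_False, simp add: Ex_def)
qed

lemma Ex_trace:
  "Ex (\<lambda>h. \<Sum>a<n. mpow n (sym_mat n (\<lambda>e. g e (h e))) L a a) =
    (\<Sum>xs\<in>good_walks n L. \<Prod>e\<in>pairs n. moment e (count_list (steps xs) e))"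
proof -
  have "Ex (\<lambda>h. \<Sum>a<n. mpow n (sym_mat n (\<lambda>e. g e (h e))) L a a)
      = (\<Sum>xs\<in>walks n L. Ex (\<lambda>h. walk_prod (sym_mat n (\<lambda>e. g e (h e))) xs))"
    unfolding trace_mpow_eq_sum_walks by (rule Ex_sum)
  also have "\<dots> = (\<Sum>xs\<in>walks n L. if good_walk xs then \<Prod>e\<in>pairs n. moment e (count_list (steps xs) e) else 0)"
    by (rule sum.cong) (auto simp: Ex_walk_prod)
  also have "\<dots> = (\<Sum>xs\<in>good_walks n L. \<Prod>e\<in>pairs n. moment e (count_list (steps xs) e))"
    unfolding good_walks_def by (simp add: sum.inter_filter finite_walks)
  finally show ?thesis .
qed

text \<open>On a good walk every multiplicity is zero or at least two, so every factor is at least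
  one. A moment condition thus turns an expected trace into a count of walks.\<close>

lemma Ex_trace_ge:
  assumes "\<And>e k. e \<in> pairs n \<Longrightarrow> 2 \<le> k \<Longrightarrow> 1 \<le> moment e k"
  shows "real (card (good_walks n L)) \<le> Ex (\<lambda>h. \<Sum>a<n. mpow n (sym_mat n (\<lambda>e. g e (h e))) L a a)"
proof -
  have "(\<Sum>xs\<in>good_walks n L. 1) \<le> (\<Sum>xs\<in>good_walks n L. \<Prod>e\<in>pairs n. moment e (count_list (steps xs) e))"
  proof (intro sum_mono prod_ge_1)
    fix xs e assume xs: "xs \<in> good_walks n L" and e: "e \<in> pairs n"
    have "count_list (steps xs) e = 0 \<or> 2 \<le> count_list (steps xs) e"
      using xs by (cases "e \<in> set (steps xs)") (auto simp: good_walks_def good_walk_def)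
    then show "1 \<le> moment e (count_list (steps xs) e)"
      using assms[OF e] moment_0[OF e] by auto
  qed
  then show ?thesis by (simp add: Ex_trace)
qed

text \<open>A moment of order \<open>k \<ge> 2\<close> is at most \<open>2^k p\<close>. The
  multiplicities along a walk sum to \<open>L\<close>, and there are at least as many distinct edges
  as vertices minus one; \<open>p \<le> 1\<close> then allows the exponent of \<open>p\<close> to be
  lowered.\<close>

lemma Ex_trace_le:
  assumes p: "0 \<le> p" "p \<le> 1" and bd: "\<And>e a. e \<in> pairs n \<Longrightarrow> a \<in> \<Omega> \<Longrightarrow> \<bar>g e a\<bar> \<le> 2"
    and var: "\<And>e. e \<in> pairs n \<Longrightarrow> moment e 2 \<le> p"
  shows "Ex (\<lambda>h. \<Sum>a<n. mpow n (sym_mat n (\<lambda>e. g e (h e))) L a a)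
    \<le> 2 ^ L * (\<Sum>xs\<in>good_walks n L. p ^ (card (set xs) - 1))"
proof -
  have mom: "\<bar>moment e k\<bar> \<le> 2 ^ k * p" if e: "e \<in> pairs n" and k: "2 \<le> k" for e k
  proof -
    obtain j where j: "k = j + 2" using k by (metis add.commute le_iff_add)
    have "\<bar>moment e k\<bar> \<le> (\<Sum>a\<in>\<Omega>. \<bar>wt e a * g e a ^ k\<bar>)" by (rule sum_abs)
    also have "\<dots> \<le> (\<Sum>a\<in>\<Omega>. 2 ^ j * (wt e a * g e a ^ 2))"
    proof (rule sum_mono)
      fix a assume a: "a \<in> \<Omega>"
      have "\<bar>wt e a * g e a ^ k\<bar> = \<bar>g e a\<bar> ^ j * (wt e a * g e a ^ 2)"
        unfolding j abs_mult power_abs power_add power2_abs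
        by (simp only: abs_of_nonneg[OF wt_nonneg[OF e a]] mult_ac)
      also have "\<dots> \<le> 2 ^ j * (wt e a * g e a ^ 2)"
        using bd[OF e a] wt_nonneg[OF e a] by (intro mult_right_mono power_mono) auto
      finally show "\<bar>wt e a * g e a ^ k\<bar> \<le> 2 ^ j * (wt e a * g e a ^ 2)" .
    qed
    also have "\<dots> = 2 ^ j * moment e 2" by (simp add: sum_distrib_left)
    also have "\<dots> \<le> 2 ^ j * p" using var[OF e] by simp
    also have "\<dots> \<le> 2 ^ k * p" using p j by (intro mult_right_mono) auto
    finally show ?thesis .
  qed
  have "(\<Sum>xs\<in>good_walks n L. \<Prod>e\<in>pairs n. moment e (count_list (steps xs) e))
      \<le> (\<Sum>xs\<in>good_walks n L. 2 ^ L * p ^ (card (set xs) - 1))"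
  proof (rule sum_mono)
    fix xs assume xs: "xs \<in> good_walks n L"
    then have w: "xs \<in> walks n L" "good_walk xs" by (auto simp: good_walks_def)
    have sub: "set (steps xs) \<subseteq> pairs n"
      using steps_in_pairs[OF w(1)] w(2) by (auto simp: good_walk_def)
    have "(\<Prod>e\<in>pairs n. moment e (count_list (steps xs) e))
        = (\<Prod>e\<in>set (steps xs). moment e (count_list (steps xs) e))"
      by (rule prod.mono_neutral_right[OF finite_pairs sub]) (simp add: count_notin wt_sum)
    also have "\<dots> \<le> (\<Prod>e\<in>set (steps xs). \<bar>moment e (count_list (steps xs) e)\<bar>)"
      unfolding abs_prod[symmetric] by (rule abs_ge_self)
    also have "\<dots> \<le> (\<Prod>e\<in>set (steps xs). 2 ^ count_list (steps xs) e * p)"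
    proof (rule prod_mono, intro conjI)
      fix e assume e: "e \<in> set (steps xs)"
      then have "2 \<le> count_list (steps xs) e" using w(2) by (simp add: good_walk_def)
      then show "\<bar>moment e (count_list (steps xs) e)\<bar> \<le> 2 ^ count_list (steps xs) e * p"
        using mom e sub by blast
    qed simp
    also have "\<dots> = 2 ^ (\<Sum>e\<in>set (steps xs). count_list (steps xs) e) * p ^ card (set (steps xs))"
      by (simp add: prod.distrib power_sum)
    also have "(\<Sum>e\<in>set (steps xs). count_list (steps xs) e) = L"
      using w by (simp add: sum_count_set length_steps walks_def)
    also have "2 ^ L * p ^ card (set (steps xs)) \<le> 2 ^ L * p ^ (card (set xs) - 1)"
      using card_set_le_card_steps[of xs] p by (intro mult_left_mono power_decreasing) auto
    finally show "(\<Prod>e\<in>pairs n. moment e (count_list (steps xs) e)) \<le> 2 ^ L * p ^ (card (set xs) - 1)" .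
  qed
  then show ?thesis by (simp add: Ex_trace sum_distrib_left)
qed

end

section \<open>A grid net for the operator norm\<close>

text \<open>Integer coordinates of the points of the unit ball on the lattice of mesh
  \<open>1 / (4 sqrt r)\<close>. The box, which follows from the norm constraint, makes finiteness
  immediate and lets sums factorise.\<close>

definition grid :: "nat \<Rightarrow> (nat \<Rightarrow> int) set" where
  "grid r = {u \<in> {..<r} \<rightarrow>\<^sub>E {- int (16 * r)..int (16 * r)}. (\<Sum>i<r. (u i)\<^sup>2) \<le> int (16 * r)}"

definition grid_vec :: "nat \<Rightarrow> (nat \<Rightarrow> int) \<Rightarrow> nat \<Rightarrow> real" where
  "grid_vec r u = (\<lambda>i. real_of_int (u i) / (4 * sqrt (real r)))"

lemma finite_grid: "finite (grid r)"
proof -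
  have "finite ({..<r} \<rightarrow>\<^sub>E {- int (16 * r)..int (16 * r)})" by (rule finite_PiE) auto
  then show ?thesis unfolding grid_def by simp
qed

lemma vnorm_grid_vec:
  assumes "u \<in> grid r"
  shows "vnorm r (grid_vec r u) \<le> 1"
proof (cases "r = 0")
  case False
  have "(vnorm r (grid_vec r u))\<^sup>2 = real_of_int (\<Sum>i<r. (u i)\<^sup>2) / (16 * real r)"
    unfolding vnorm_sq grid_vec_def by (simp add: power_divide power_mult_distrib sum_divide_distrib)
  also have "\<dots> \<le> real_of_int (int (16 * r)) / (16 * real r)"
    by (intro divide_right_mono) (use assms in \<open>simp_all add: grid_def del: of_int_sum\<close>)
  also have "\<dots> = 1" using False by simp
  finally show ?thesis by (simp add: abs_square_le_1)
qed (simp add: vnorm_def)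

text \<open>From \<open>exp (- v^2) \<le> 2^(-|v|)\<close>: each half line contributes at most the
  geometric series 2.\<close>

lemma sum_exp_square_le: "(\<Sum>v\<in>{- int K..int K}. exp (- (real_of_int v)\<^sup>2)) \<le> 4"
proof -
  have half: "exp (- 1 :: real) \<le> 1 / 2"
    using exp_ge_add_one_self[of "1::real"] by (simp add: exp_minus field_simps)
  have b: "exp (- (real j)\<^sup>2) \<le> (1 / 2) ^ j" for j
  proof -
    have "exp (- (real j)\<^sup>2) \<le> exp (real j * (-1))"
      using self_le_power[of "real j" 2] by (cases "j = 0") auto
    also have "\<dots> = exp (-1) ^ j" by (rule exp_of_nat_mult)
    also have "\<dots> \<le> (1 / 2) ^ j" by (rule power_mono[OF half]) simp
    finally show ?thesis .
  qed
  have geo: "(\<Sum>j\<le>K. (1 / 2 :: real) ^ j) \<le> 2"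
  proof -
    have "(1 - 1 / 2) * (\<Sum>j\<le>K. (1 / 2 :: real) ^ j) \<le> 1" by (subst sum_gp_basic) simp
    then show ?thesis by simp
  qed
  have "{- int K..int K} \<subseteq> int ` {..K} \<union> (\<lambda>j. - int j) ` {..K}"
  proof
    fix v assume v: "v \<in> {- int K..int K}"
    show "v \<in> int ` {..K} \<union> (\<lambda>j. - int j) ` {..K}"
    proof (cases "0 \<le> v")
      case True
      then have "v = int (nat v)" "nat v \<le> K" using v by auto
      then show ?thesis by blast
    next
      case False
      then have "v = - int (nat (- v))" "nat (- v) \<le> K" using v by auto
      then show ?thesis by blast
    qed
  qed
  then have "(\<Sum>v\<in>{- int K..int K}. exp (- (real_of_int v)\<^sup>2))
      \<le> (\<Sum>v\<in>int ` {..K} \<union> (\<lambda>j. - int j) ` {..K}. exp (- (real_of_int v)\<^sup>2))"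
    by (intro sum_mono2) auto
  also have "\<dots> \<le> (\<Sum>v\<in>int ` {..K}. exp (- (real_of_int v)\<^sup>2))
      + (\<Sum>v\<in>(\<lambda>j. - int j) ` {..K}. exp (- (real_of_int v)\<^sup>2))"
    by (subst sum_Un) (auto intro!: sum_nonneg)
  also have "\<dots> = (\<Sum>j\<le>K. exp (- (real j)\<^sup>2)) + (\<Sum>j\<le>K. exp (- (real j)\<^sup>2))"
    using sum.reindex[of int "{..K}" "\<lambda>v. exp (- (real_of_int v)\<^sup>2)"]
      sum.reindex[of "\<lambda>j. - int j" "{..K}" "\<lambda>v. exp (- (real_of_int v)\<^sup>2)"]
    by (simp add: inj_on_def)
  also have "\<dots> \<le> (\<Sum>j\<le>K. (1 / 2) ^ j) + (\<Sum>j\<le>K. (1 / 2) ^ j)"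
    by (intro add_mono sum_mono b)
  finally show ?thesis using geo by simp
qed

text \<open>Each grid point is counted with weight \<open>exp (16 r - |u|^2) \<ge> 1\<close>;
  extended to the whole box, the sum of these weights is a product of one-dimensional sums.\<close>

lemma card_grid_le: "real (card (grid r)) \<le> (4 * exp 16) ^ r"
proof -
  let ?P = "{..<r} \<rightarrow>\<^sub>E {- int (16 * r)..int (16 * r)}"
  have fin: "finite ?P" by (rule finite_PiE) auto
  have "real (card (grid r)) = (\<Sum>u\<in>grid r. 1)" by simp
  also have "\<dots> \<le> (\<Sum>u\<in>grid r. \<Prod>i<r. exp 16 * exp (- (real_of_int (u i))\<^sup>2))"
  proof (rule sum_mono)
    fix u assume u: "u \<in> grid r"
    then have "(\<Sum>i<r. (u i)\<^sup>2) \<le> int (16 * r)" by (simp add: grid_def)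
    then have "real_of_int (\<Sum>i<r. (u i)\<^sup>2) \<le> real_of_int (int (16 * r))"
      by (simp only: of_int_le_iff)
    then have "(\<Sum>i<r. 16 - (real_of_int (u i))\<^sup>2) \<ge> 0" by (simp add: sum_subtractf)
    then have "1 \<le> exp (\<Sum>i<r. 16 - (real_of_int (u i))\<^sup>2)" by simp
    also have "\<dots> = (\<Prod>i<r. exp 16 * exp (- (real_of_int (u i))\<^sup>2))"
      unfolding exp_sum[OF finite_lessThan] by (intro prod.cong) (simp_all add: mult_exp_exp)
    finally show "1 \<le> (\<Prod>i<r. exp 16 * exp (- (real_of_int (u i))\<^sup>2))" .
  qed
  also have "\<dots> \<le> (\<Sum>u\<in>?P. \<Prod>i<r. exp 16 * exp (- (real_of_int (u i))\<^sup>2))"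
    by (rule sum_mono2[OF fin]) (simp_all add: grid_def prod_nonneg)
  also have "\<dots> = (\<Prod>i<r. \<Sum>v\<in>{- int (16 * r)..int (16 * r)}. exp 16 * exp (- (real_of_int v)\<^sup>2))"
    by (rule prod_sum_PiE[symmetric]) auto
  also have "\<dots> \<le> (\<Prod>i<r. 4 * exp 16)"
  proof (rule prod_mono, intro conjI)
    fix i
    show "(\<Sum>v\<in>{- int (16 * r)..int (16 * r)}. exp 16 * exp (- (real_of_int v)\<^sup>2)) \<le> 4 * exp 16"
      unfolding sum_distrib_left[symmetric] mult.commute[of 4]
      by (rule mult_left_mono[OF sum_exp_square_le]) simp
  qed (auto intro!: sum_nonneg)
  finally show ?thesis by simp
qed

text \<open>Coordinates are rounded towards zero, so the rounded vector stays in the ball. Each of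
  the \<open>r\<close> coordinates is off by at most one mesh width, which adds up to
  \<open>1 / 4\<close> in norm.\<close>

lemma grid_approx:
  assumes x: "vnorm r x \<le> 1" and r: "0 < r"
  obtains u where "u \<in> grid r" "vnorm r (\<lambda>i. x i - grid_vec r u i) \<le> 1 / 4"
proof -
  let ?s = "4 * sqrt (real r)"
  have s: "0 < ?s" using r by simp
  define u where "u = (\<lambda>i\<in>{..<r}. if 0 \<le> x i then \<lfloor>?s * x i\<rfloor> else - \<lfloor>?s * (- x i)\<rfloor>)"
  have u1: "\<bar>real_of_int (u i)\<bar> \<le> \<bar>?s * x i\<bar>" "\<bar>?s * x i - real_of_int (u i)\<bar> \<le> 1" if "i < r" for i
  proof -
    have A: "\<bar>real_of_int \<lfloor>?s * y\<rfloor>\<bar> \<le> \<bar>?s * y\<bar>" "\<bar>?s * y - real_of_int \<lfloor>?s * y\<rfloor>\<bar> \<le> 1"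
      if y: "0 \<le> y" for y
    proof -
      have "0 \<le> ?s * y" using s y by simp
      then have "0 \<le> \<lfloor>?s * y\<rfloor>" by (simp add: zero_le_floor)
      then show "\<bar>real_of_int \<lfloor>?s * y\<rfloor>\<bar> \<le> \<bar>?s * y\<bar>" using \<open>0 \<le> ?s * y\<close> by linarith
      show "\<bar>?s * y - real_of_int \<lfloor>?s * y\<rfloor>\<bar> \<le> 1" by linarith
    qed
    show "\<bar>real_of_int (u i)\<bar> \<le> \<bar>?s * x i\<bar>" "\<bar>?s * x i - real_of_int (u i)\<bar> \<le> 1"
      unfolding atomize_conj
    proof (cases "0 \<le> x i")
      case True
      then show "\<bar>real_of_int (u i)\<bar> \<le> \<bar>?s * x i\<bar> \<and> \<bar>?s * x i - real_of_int (u i)\<bar> \<le> 1"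
        using A[of "x i"] that by (simp add: u_def)
    next
      case False
      define f where "f = real_of_int \<lfloor>?s * (- x i)\<rfloor>"
      have "real_of_int (u i) = - f" using False that by (simp add: u_def f_def)
      moreover have "\<bar>f\<bar> \<le> \<bar>- (?s * x i)\<bar>" "\<bar>- (?s * x i) - f\<bar> \<le> 1"
        using A[of "- x i"] False by (auto simp: f_def)
      ultimately show "\<bar>real_of_int (u i)\<bar> \<le> \<bar>?s * x i\<bar> \<and> \<bar>?s * x i - real_of_int (u i)\<bar> \<le> 1"
        by linarith
    qed
  qed
  have "(\<Sum>i<r. (real_of_int (u i))\<^sup>2) \<le> (\<Sum>i<r. (?s * x i)\<^sup>2)"
    by (rule sum_mono) (use u1 in \<open>auto simp: abs_le_square_iff[symmetric]\<close>)
  also have "\<dots> = 16 * real r * (vnorm r x)\<^sup>2"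
    by (simp add: vnorm_sq power_mult_distrib sum_distrib_left mult_ac)
  also have "\<dots> \<le> 16 * real r * 1" using x by (intro mult_left_mono power_le_one) auto
  finally have "real_of_int (\<Sum>i<r. (u i)\<^sup>2) \<le> real_of_int (int (16 * r))" by simp
  then have sq: "(\<Sum>i<r. (u i)\<^sup>2) \<le> int (16 * r)" by (simp only: of_int_le_iff)
  have "u i \<in> {- int (16 * r)..int (16 * r)}" if "i < r" for i
  proof -
    have "\<bar>u i\<bar> \<le> (u i)\<^sup>2"
      using self_le_power[of "\<bar>u i\<bar>" 2] by (cases "u i = 0") auto
    also have "(u i)\<^sup>2 \<le> (\<Sum>i<r. (u i)\<^sup>2)" using that by (intro member_le_sum) auto
    finally show ?thesis using sq by auto
  qed
  then have "u \<in> grid r" using sq by (auto simp: grid_def u_def)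
  moreover have "vnorm r (\<lambda>i. x i - grid_vec r u i) \<le> 1 / 4"
  proof -
    have "(vnorm r (\<lambda>i. x i - grid_vec r u i))\<^sup>2 \<le> (\<Sum>i<r. (1 / ?s)\<^sup>2)"
      unfolding vnorm_sq
    proof (rule sum_mono)
      fix i assume "i \<in> {..<r}"
      then have "\<bar>?s * x i - real_of_int (u i)\<bar> / ?s \<le> 1 / ?s"
        using u1(2)[of i] s by (intro divide_right_mono) auto
      moreover have "\<bar>?s * x i - real_of_int (u i)\<bar> / ?s = \<bar>x i - grid_vec r u i\<bar>"
      proof -
        have "x i - grid_vec r u i = (?s * x i - real_of_int (u i)) / ?s"
          using s by (simp add: grid_vec_def diff_divide_distrib)
        then show ?thesis using s by (simp add: abs_divide)
      qed
      ultimately have "\<bar>x i - grid_vec r u i\<bar> \<le> 1 / ?s" by simp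
      then have "\<bar>x i - grid_vec r u i\<bar>\<^sup>2 \<le> (1 / ?s)\<^sup>2" by (rule power_mono) simp
      then show "(x i - grid_vec r u i)\<^sup>2 \<le> (1 / ?s)\<^sup>2" by simp
    qed
    also have "\<dots> = (1 / 4)\<^sup>2" using r by (simp add: power_divide power_mult_distrib)
    finally show ?thesis by (rule power2_le_imp_le) simp
  qed
  ultimately show thesis using that by blast
qed

definition bil :: "nat \<Rightarrow> rmat \<Rightarrow> (nat \<Rightarrow> real) \<Rightarrow> (nat \<Rightarrow> real) \<Rightarrow> real" where
  "bil r M x y = ip r x (mulv r M y)"

lemma bil_add_left: "bil r M (\<lambda>i. x i + x' i) y = bil r M x y + bil r M x' y"
  by (simp add: bil_def ip_def distrib_right sum.distrib)

lemma bil_add_right: "bil r M x (\<lambda>i. y i + y' i) = bil r M x y + bil r M x y'"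
  by (simp add: bil_def ip_def mulv_def distrib_left sum.distrib)

lemma bil_scale: "bil r M (\<lambda>i. c * x i) (\<lambda>i. d * y i) = c * d * bil r M x y"
  by (simp add: bil_def ip_def mulv_def sum_distrib_left mult_ac)

lemma op_le_frob: "op_le r c M (sqrt (\<Sum>i<r. \<Sum>j<c. (M i j)\<^sup>2))"
  unfolding op_le_def
proof
  fix x
  have "(vnorm r (mulv c M x))\<^sup>2 \<le> (\<Sum>i<r. (\<Sum>j<c. (M i j)\<^sup>2) * (vnorm c x)\<^sup>2)"
    unfolding mulv_def vnorm_sq by (intro sum_mono Cauchy_Schwarz_ineq_sum)
  also have "\<dots> = (sqrt (\<Sum>i<r. \<Sum>j<c. (M i j)\<^sup>2) * vnorm c x)\<^sup>2"
    by (simp add: sum_distrib_right[symmetric] power_mult_distrib sum_nonneg)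
  finally show "vnorm r (mulv c M x) \<le> sqrt (\<Sum>i<r. \<Sum>j<c. (M i j)\<^sup>2) * vnorm c x"
    by (rule power2_le_imp_le) (simp add: sum_nonneg)
qed

lemma vnorm_zero_bil: "vnorm r x = 0 \<Longrightarrow> bil r M x y = 0" "vnorm r y = 0 \<Longrightarrow> bil r M x y = 0"
  by (auto simp: vnorm_def L2_set_eq_0_iff bil_def ip_def mulv_def)

lemma op_le_of_bil:
  assumes "\<And>x y. vnorm r x \<le> 1 \<Longrightarrow> vnorm r y \<le> 1 \<Longrightarrow> \<bar>bil r M x y\<bar> \<le> B"
  shows "op_le r r M B" and "\<bar>bil r M x y\<bar> \<le> B * (vnorm r x * vnorm r y)"
proof -
  have *: "\<bar>bil r M x y\<bar> \<le> B * (vnorm r x * vnorm r y)" for x y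
  proof (cases "vnorm r x = 0 \<or> vnorm r y = 0")
    case True
    then show ?thesis using vnorm_zero_bil by auto
  next
    case False
    then have pos: "0 < vnorm r x" "0 < vnorm r y" using vnorm_nonneg[of r x] vnorm_nonneg[of r y] by linarith+
    let ?a = "1 / vnorm r x" and ?b = "1 / vnorm r y"
    have "\<bar>bil r M (\<lambda>i. ?a * x i) (\<lambda>i. ?b * y i)\<bar> \<le> B"
      by (rule assms) (simp_all only: vnorm_scale, use pos in simp_all)
    then have "\<bar>?a * ?b * bil r M x y\<bar> \<le> B" by (simp only: bil_scale)
    then have "?a * ?b * \<bar>bil r M x y\<bar> \<le> B" using pos by (simp add: abs_mult)
    then show ?thesis using pos by (simp add: field_simps)
  qed
  then show "\<bar>bil r M x y\<bar> \<le> B * (vnorm r x * vnorm r y)" .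
  show "op_le r r M B" unfolding op_le_def
  proof
    fix x
    have "vnorm r (mulv r M x) * vnorm r (mulv r M x) \<le> (B * vnorm r x) * vnorm r (mulv r M x)"
      using *[of "mulv r M x" x] vnorm_sq_ip[of r "mulv r M x"]
      by (simp add: bil_def power2_eq_square mult_ac)
    moreover have "0 \<le> B" using assms[of "\<lambda>_. 0" "\<lambda>_. 0"] by (simp add: vnorm_def L2_set_def bil_def ip_def)
    ultimately show "vnorm r (mulv r M x) \<le> B * vnorm r x"
      using vnorm_nonneg[of r "mulv r M x"] vnorm_nonneg[of r x]
      by (cases "vnorm r (mulv r M x) = 0") (simp_all add: mult_le_cancel_right)
  qed
qed

text \<open>Self-improvement of the supremum \<open>\<beta>\<close> of the bilinear form over two
  unit balls: moving either argument to the grid costs \<open>\<beta> / 4\<close>, hence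
  \<open>\<beta> \<le> B + \<beta> / 2\<close>. The Frobenius bound ensures that
  \<open>\<beta>\<close> is finite.\<close>

lemma op_le_of_grid:
  assumes r: "0 < r"
    and B: "\<And>u v. u \<in> grid r \<Longrightarrow> v \<in> grid r \<Longrightarrow> \<bar>bil r M (grid_vec r u) (grid_vec r v)\<bar> \<le> B"
  shows "op_le r r M (2 * B)"
proof -
  let ?S = "{\<bar>bil r M x y\<bar> | x y. vnorm r x \<le> 1 \<and> vnorm r y \<le> 1}"
  define \<beta> where "\<beta> = Sup ?S"
  let ?F = "sqrt (\<Sum>i<r. \<Sum>j<r. (M i j)\<^sup>2)"
  have bdd: "bdd_above ?S"
  proof (rule bdd_aboveI)
    fix z assume "z \<in> ?S"
    then obtain x y where z: "z = \<bar>bil r M x y\<bar>" "vnorm r x \<le> 1" "vnorm r y \<le> 1" by blast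
    have "z \<le> vnorm r x * vnorm r (mulv r M y)" unfolding z bil_def by (rule ip_le_vnorm)
    also have "\<dots> \<le> 1 * (?F * vnorm r y)"
      using op_le_frob[of r r M] z(2) by (intro mult_mono) (auto simp: op_le_def)
    also have "\<dots> \<le> ?F * 1" unfolding mult_1 by (rule mult_left_mono[OF z(3)]) (simp add: sum_nonneg)
    finally show "z \<le> ?F" by simp
  qed
  have ub: "\<bar>bil r M x y\<bar> \<le> \<beta>" if "vnorm r x \<le> 1" "vnorm r y \<le> 1" for x y
    unfolding \<beta>_def by (rule cSup_upper[OF _ bdd]) (use that in blast)
  note ub' = op_le_of_bil(2)[OF ub]
  have b0: "0 \<le> \<beta>" using ub[of "\<lambda>_. 0" "\<lambda>_. 0"] by (simp add: vnorm_def L2_set_def bil_def ip_def)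
  have "\<beta> \<le> B + \<beta> / 2" unfolding \<beta>_def[symmetric]
    unfolding \<beta>_def
  proof (rule cSup_least)
    have "vnorm r (\<lambda>_. 0) \<le> 1" by (simp add: vnorm_def L2_set_def)
    then show "?S \<noteq> {}" by blast
  next
    fix z assume "z \<in> ?S"
    then obtain x y where z: "z = \<bar>bil r M x y\<bar>" "vnorm r x \<le> 1" "vnorm r y \<le> 1" by blast
    obtain u where u: "u \<in> grid r" "vnorm r (\<lambda>i. x i - grid_vec r u i) \<le> 1 / 4"
      using grid_approx[OF z(2) r] by blast
    obtain v where v: "v \<in> grid r" "vnorm r (\<lambda>i. y i - grid_vec r v i) \<le> 1 / 4"
      using grid_approx[OF z(3) r] by blast
    let ?z = "grid_vec r u" and ?w = "grid_vec r v"
    have "bil r M x y = bil r M (\<lambda>i. ?z i + (x i - ?z i)) y" by simp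
    also have "\<dots> = bil r M ?z y + bil r M (\<lambda>i. x i - ?z i) y" by (rule bil_add_left)
    also have "bil r M ?z y = bil r M ?z (\<lambda>i. ?w i + (y i - ?w i))" by simp
    also have "\<dots> = bil r M ?z ?w + bil r M ?z (\<lambda>i. y i - ?w i)" by (rule bil_add_right)
    finally have eq: "bil r M x y = bil r M ?z ?w + bil r M ?z (\<lambda>i. y i - ?w i) + bil r M (\<lambda>i. x i - ?z i) y" .
    have "\<bar>bil r M ?z (\<lambda>i. y i - ?w i)\<bar> \<le> \<beta> * (1 * (1 / 4))"
      by (rule order_trans[OF ub' mult_left_mono[OF mult_mono b0]]) (use v vnorm_grid_vec[OF u(1)] in auto)
    moreover have "\<bar>bil r M (\<lambda>i. x i - ?z i) y\<bar> \<le> \<beta> * ((1 / 4) * 1)"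
      by (rule order_trans[OF ub' mult_left_mono[OF mult_mono b0]]) (use u z in auto)
    moreover have "\<bar>bil r M ?z ?w\<bar> \<le> B" using B u v by blast
    ultimately show "z \<le> B + Sup ?S / 2" unfolding z(1) eq \<beta>_def[symmetric] by linarith
  qed
  then have "\<beta> \<le> 2 * B" by simp
  then show ?thesis by (intro op_le_of_bil(1) order_trans[OF ub])
qed

section \<open>Norm concentration for sparse symmetric random matrices\<close>

lemma sum_pairs:
  fixes f :: "nat \<Rightarrow> nat \<Rightarrow> real"
  assumes "\<And>i. f i i = 0"
  shows "(\<Sum>i<r. \<Sum>j<r. f i j) = (\<Sum>e\<in>pairs r. f (fst e) (snd e) + f (snd e) (fst e))"
proof -
  let ?D = "{..<r} \<times> {..<r}"
  let ?P = "pairs r" and ?Q = "prod.swap ` pairs r" and ?E = "(\<lambda>i. (i, i)) ` {..<r}"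
  have D: "?D = ?P \<union> ?Q \<union> ?E"
    by (auto simp: pairs_def image_iff)
  have disj: "(?P \<union> ?Q) \<inter> ?E = {}" "?P \<inter> ?Q = {}" by (auto simp: pairs_def)
  have "(\<Sum>i<r. \<Sum>j<r. f i j) = (\<Sum>e\<in>?D. f (fst e) (snd e))"
    by (simp add: sum.cartesian_product case_prod_beta)
  also have "\<dots> = (\<Sum>e\<in>?P \<union> ?Q. f (fst e) (snd e)) + (\<Sum>e\<in>?E. f (fst e) (snd e))"
    unfolding D by (rule sum.union_disjoint) (use finite_pairs disj in auto)
  also have "(\<Sum>e\<in>?E. f (fst e) (snd e)) = 0" by (rule sum.neutral) (auto simp: assms)
  also have "(\<Sum>e\<in>?P \<union> ?Q. f (fst e) (snd e)) = (\<Sum>e\<in>?P. f (fst e) (snd e)) + (\<Sum>e\<in>?Q. f (fst e) (snd e))"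
    by (rule sum.union_disjoint) (use finite_pairs disj in auto)
  also have "(\<Sum>e\<in>?Q. f (fst e) (snd e)) = (\<Sum>e\<in>?P. f (snd e) (fst e))"
    by (subst sum.reindex) auto
  finally show ?thesis by (simp add: sum.distrib)
qed

text \<open>For negative \<open>x = - y\<close> the claim reduces, by
  \<open>1 + y \<le> exp y\<close>, to
  \<open>(1 - y + y^2) (1 + y) = 1 + y^3 \<ge> 1\<close>.\<close>

lemma exp_le_quadratic:
  fixes x :: real
  assumes "\<bar>x\<bar> \<le> 1"
  shows "exp x \<le> 1 + x + x\<^sup>2"
proof (cases "0 \<le> x")
  case True
  then show ?thesis using assms exp_bound[of x] by simp
next
  case False
  define y where "y = - x"
  have y: "0 < y" "y \<le> 1" using False assms by (auto simp: y_def)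
  have "1 + y \<le> exp y" by (rule exp_ge_add_one_self)
  moreover have "(1 - y + y\<^sup>2) * (1 + y) = 1 + y ^ 3" by algebra
  moreover have "0 \<le> 1 - y + y\<^sup>2" using y by (smt (verit) zero_le_power2)
  moreover have "0 \<le> y ^ 3" using y by simp
  ultimately have "1 \<le> (1 - y + y\<^sup>2) * exp y"
    using mult_left_mono[of "1 + y" "exp y" "1 - y + y\<^sup>2"] by linarith
  then have "exp (- y) \<le> (1 - y + y\<^sup>2) * exp y * exp (- y)"
    by (metis exp_ge_zero mult_cancel_right1 mult_right_mono)
  then show ?thesis by (simp add: y_def mult.assoc mult_exp_exp)
qed

text \<open>Subgaussian bound for the law with value 2 of probability \<open>1/3\<close> and value
  -1 of probability \<open>2/3\<close>. For small \<open>s\<close> the linear terms cancel because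
  the mean is zero; for \<open>|s| > 1/2\<close> the quadratic exponent exceeds both linear
  ones.\<close>

lemma skew_mgf_le: "exp (2 * s) / 3 + 2 * exp (- s) / 3 \<le> exp (4 * s\<^sup>2)" for s :: real
proof (cases "\<bar>s\<bar> \<le> 1 / 2")
  case True
  have "exp (2 * s) \<le> 1 + 2 * s + (2 * s)\<^sup>2" by (rule exp_le_quadratic) (use True in auto)
  moreover have "exp (- s) \<le> 1 + - s + (- s)\<^sup>2" by (rule exp_le_quadratic) (use True in auto)
  ultimately have "exp (2 * s) / 3 + 2 * exp (- s) / 3 \<le> 1 + 2 * s\<^sup>2"
    by (simp add: power_mult_distrib) 
  also have "\<dots> \<le> 1 + 4 * s\<^sup>2" by simp
  also have "\<dots> \<le> exp (4 * s\<^sup>2)" by (rule exp_ge_add_one_self)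
  finally show ?thesis .
next
  case False
  then have "1 / 2 * \<bar>s\<bar> \<le> \<bar>s\<bar> * \<bar>s\<bar>" by (intro mult_right_mono) auto
  then have le: "2 * \<bar>s\<bar> \<le> 4 * s\<^sup>2" by (simp add: power2_eq_square)
  have "2 * s \<le> 4 * s\<^sup>2" "- s \<le> 4 * s\<^sup>2" using le by linarith+
  then have "exp (2 * s) \<le> exp (4 * s\<^sup>2)" "exp (- s) \<le> exp (4 * s\<^sup>2)" by auto
  then show ?thesis by linarith
qed

text \<open>
  A centred two-point law all of whose moments of order at least two are at least one, odd orders included; so the
  expected trace dominates the number of good walks without a preliminary symmetrisation.
\<close>

definition skew_wt :: "nat \<times> nat \<Rightarrow> real \<Rightarrow> real" where
  "skew_wt e a = (if a = 2 then 1 / 3 else 2 / 3)"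

interpretation skew: edge_product r "{2, -1 :: real}" skew_wt "\<lambda>e a. a" for r
  by unfold_locales (auto simp: finite_pairs skew_wt_def)

lemma skew_moment_ge: "2 \<le> k \<Longrightarrow> 1 \<le> (\<Sum>a\<in>{2, -1 :: real}. skew_wt e a * a ^ k)"
proof -
  assume k: "2 \<le> k"
  have "(\<Sum>a\<in>{2, -1 :: real}. skew_wt e a * a ^ k) = (2 ^ k + 2 * (-1) ^ k) / 3"
    by (simp add: skew_wt_def add_divide_distrib)
  moreover have "3 \<le> (2 :: real) ^ k + 2 * (-1) ^ k"
  proof (cases "even k")
    case True
    have "(2 :: real) ^ 2 \<le> 2 ^ k" using k by (intro power_increasing) auto
    then show ?thesis using True by simp
  next
    case False
    then have "3 \<le> k" using k by (cases "k = 2") auto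
    then have "(2 :: real) ^ 3 \<le> 2 ^ k" by (intro power_increasing) auto
    then show ?thesis using False by simp
  qed
  ultimately show ?thesis by simp
qed

abbreviation skew_mat :: "nat \<Rightarrow> (nat \<times> nat \<Rightarrow> real) \<Rightarrow> rmat" where
  "skew_mat \<equiv> sym_mat"

lemma bil_sym_mat:
  "bil r (sym_mat r v) x y = (\<Sum>e\<in>pairs r. v e * (x (fst e) * y (snd e) + x (snd e) * y (fst e)))"
proof -
  have "bil r (sym_mat r v) x y = (\<Sum>i<r. \<Sum>j<r. sym_mat r v i j * (x i * y j))"
    by (simp add: bil_def ip_def mulv_def sum_distrib_left mult_ac)
  also have "\<dots> = (\<Sum>e\<in>pairs r. sym_mat r v (fst e) (snd e) * (x (fst e) * y (snd e))
       + sym_mat r v (snd e) (fst e) * (x (snd e) * y (fst e)))"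
    by (rule sum_pairs) (simp add: sym_mat_def)
  also have "\<dots> = (\<Sum>e\<in>pairs r. v e * (x (fst e) * y (snd e) + x (snd e) * y (fst e)))"
    by (rule sum.cong) (auto simp: pairs_def sym_mat_def min_def max_def distrib_left)
  finally show ?thesis .
qed

text \<open>An entry above the diagonal occurs twice in the form, with coefficient
  \<open>x_i y_j + x_j y_i\<close>. The squares of these coefficients sum to at most
  \<open>2 |x|^2 |y|^2\<close>, whence \<open>4 s^2 * 2\<close>.\<close>

lemma skew_exp_bil:
  assumes "vnorm r x \<le> 1" "vnorm r y \<le> 1"
  shows "skew.Ex r (\<lambda>h. exp (s * bil r (skew_mat r h) x y)) \<le> exp (8 * s\<^sup>2)"
proof -
  let ?c = "\<lambda>e. x (fst e) * y (snd e) + x (snd e) * y (fst e)"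
  have "skew.Ex r (\<lambda>h. exp (s * bil r (skew_mat r h) x y)) = skew.Ex r (\<lambda>h. \<Prod>e\<in>pairs r. exp (s * ?c e * h e))"
    unfolding bil_sym_mat sum_distrib_left exp_sum[OF finite_pairs] by (simp add: mult_ac)
  also have "\<dots> = (\<Prod>e\<in>pairs r. \<Sum>a\<in>{2, -1}. skew_wt e a * exp (s * ?c e * a))"
    by (rule skew.Ex_prod)
  also have "\<dots> \<le> (\<Prod>e\<in>pairs r. exp (4 * (s * ?c e)\<^sup>2))"
  proof (rule prod_mono, intro conjI)
    fix e
    show "(\<Sum>a\<in>{2, -1}. skew_wt e a * exp (s * ?c e * a)) \<le> exp (4 * (s * ?c e)\<^sup>2)"
      using skew_mgf_le[of "s * ?c e"] by (simp add: skew_wt_def mult.commute)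
    show "0 \<le> (\<Sum>a\<in>{2, -1}. skew_wt e a * exp (s * ?c e * a))"
      by (intro sum_nonneg) (auto simp: skew_wt_def)
  qed
  also have "\<dots> = exp (4 * s\<^sup>2 * (\<Sum>e\<in>pairs r. (?c e)\<^sup>2))"
    by (simp add: exp_sum[OF finite_pairs, symmetric] power_mult_distrib sum_distrib_left mult_ac)
  also have "\<dots> \<le> exp (8 * s\<^sup>2)"
  proof -
    let ?f = "\<lambda>i j. if i = j then 0 else 2 * ((x i)\<^sup>2 * (y j)\<^sup>2)"
    have "(\<Sum>e\<in>pairs r. (?c e)\<^sup>2) \<le> (\<Sum>e\<in>pairs r. ?f (fst e) (snd e) + ?f (snd e) (fst e))"
    proof (rule sum_mono)
      fix e assume "e \<in> pairs r"
      then have ne: "fst e \<noteq> snd e" by (auto simp: pairs_def)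
      have "(a + b)\<^sup>2 \<le> 2 * a\<^sup>2 + 2 * b\<^sup>2" for a b :: real
        using zero_le_power2[of "a - b"] by (simp add: power2_eq_square algebra_simps)
      from this[of "x (fst e) * y (snd e)" "x (snd e) * y (fst e)"]
      show "(?c e)\<^sup>2 \<le> ?f (fst e) (snd e) + ?f (snd e) (fst e)"
        using ne by (simp add: power_mult_distrib)
    qed
    also have "\<dots> = (\<Sum>i<r. \<Sum>j<r. ?f i j)" by (rule sum_pairs[symmetric]) simp
    also have "\<dots> \<le> (\<Sum>i<r. \<Sum>j<r. 2 * ((x i)\<^sup>2 * (y j)\<^sup>2))" by (intro sum_mono) auto
    also have "\<dots> = 2 * ((vnorm r x)\<^sup>2 * (vnorm r y)\<^sup>2)"
      unfolding vnorm_sq sum_product by (simp only: sum_distrib_left)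
    also have "\<dots> \<le> 2 * (1 * 1)"
      by (intro mult_left_mono mult_mono power_le_one assms) auto
    finally have "(\<Sum>e\<in>pairs r. (?c e)\<^sup>2) \<le> 2" by simp
    then have "4 * s\<^sup>2 * (\<Sum>e\<in>pairs r. (?c e)\<^sup>2) \<le> 4 * s\<^sup>2 * 2" by (rule mult_left_mono) simp
    then show ?thesis by simp
  qed
  finally show ?thesis .
qed

lemma power_le_exp:
  assumes "0 \<le> (x::real)" "0 < L"
  shows "x ^ L \<le> real L ^ L * exp x"
proof -
  have "(x / real L) ^ L \<le> (1 + x / real L) ^ L"
    using assms by (intro power_mono) auto
  also have "\<dots> \<le> exp x" using assms by (intro exp_ge_one_plus_x_over_n_power_n) auto
  finally show ?thesis using assms by (simp add: power_divide field_simps)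
qed

text \<open>The exponential moment is taken at \<open>s = sqrt L\<close>: there
  \<open>exp (8 s^2)\<close> is the \<open>L\<close>-th power of a constant, and
  \<open>L^L / s^L\<close> reduces to \<open>s^L\<close>.\<close>

lemma skew_bil_moment:
  assumes "vnorm r x \<le> 1" "vnorm r y \<le> 1" "0 < L"
  shows "skew.Ex r (\<lambda>h. \<bar>bil r (skew_mat r h) x y\<bar> ^ L) \<le> 2 * (sqrt (real L) * exp 8) ^ L"
proof -
  let ?s = "sqrt (real L)"
  have s: "0 < ?s" "?s\<^sup>2 = real L" using assms by auto
  have pt: "\<bar>w\<bar> ^ L \<le> ?s ^ L * (exp (?s * w) + exp (- ?s * w))" for w
  proof -
    have "(?s * \<bar>w\<bar>) ^ L \<le> real L ^ L * exp (?s * \<bar>w\<bar>)" by (rule power_le_exp) (use assms in auto)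
    also have "real L ^ L = ?s ^ L * ?s ^ L"
      unfolding power_mult_distrib[symmetric] using s by (simp add: power2_eq_square)
    finally have "\<bar>w\<bar> ^ L \<le> ?s ^ L * exp (?s * \<bar>w\<bar>)" using s by (simp add: power_mult_distrib mult.assoc)
    also have "\<dots> \<le> ?s ^ L * (exp (?s * w) + exp (- ?s * w))"
      by (intro mult_left_mono) (auto simp: abs_if)
    finally show ?thesis .
  qed
  have "skew.Ex r (\<lambda>h. \<bar>bil r (skew_mat r h) x y\<bar> ^ L)
      \<le> skew.Ex r (\<lambda>h. ?s ^ L * (exp (?s * bil r (skew_mat r h) x y) + exp (- ?s * bil r (skew_mat r h) x y)))"
    by (rule skew.Ex_mono) (rule pt)
  also have "\<dots> = ?s ^ L * (skew.Ex r (\<lambda>h. exp (?s * bil r (skew_mat r h) x y))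
      + skew.Ex r (\<lambda>h. exp (- ?s * bil r (skew_mat r h) x y)))"
    by (simp only: skew.Ex_cmult skew.Ex_add)
  also have "\<dots> \<le> ?s ^ L * (exp (8 * ?s\<^sup>2) + exp (8 * (- ?s)\<^sup>2))"
    by (intro mult_left_mono add_mono skew_exp_bil assms) simp
  also have "\<dots> = 2 * (?s ^ L * exp (real L * 8))" using s by (simp add: mult.commute)
  also have "exp (real L * 8) = exp 8 ^ L" by (rule exp_of_nat_mult)
  finally show ?thesis by (simp add: power_mult_distrib)
qed

text \<open>The count is at most the expected trace, hence at most \<open>r\<close> times the
  expectation of \<open>(2 B)^L\<close> with \<open>B\<close> the maximum of the form over pairs of
  grid points. As \<open>r = 2 L\<close>, the number of such pairs is at most
  \<open>(4 exp 16)^(4 L)\<close> and merely changes the base of the \<open>L\<close>-th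
  power.\<close>

lemma card_good_walks_le:
  assumes L: "L = 2 * m" "0 < m"
  shows "real (card (good_walks (2 * L) L)) \<le> 4 * real L * (2 * (4 * exp 16) ^ 4 * exp 8 * sqrt (real L)) ^ L"
proof -
  define r where "r = 2 * L"
  have r: "0 < r" "0 < L" using L by (auto simp: r_def)
  let ?b = "\<lambda>h u v. \<bar>bil r (skew_mat r h) (grid_vec r u) (grid_vec r v)\<bar>"
  have tr: "(\<Sum>a<r. mpow r (skew_mat r h) L a a) \<le> real r * (2 ^ L * (\<Sum>u\<in>grid r. \<Sum>v\<in>grid r. ?b h u v ^ L))" for h
  proof -
    let ?S = "(\<lambda>(u, v). ?b h u v) ` (grid r \<times> grid r)"
    obtain u0 where "u0 \<in> grid r" using grid_approx[of r "\<lambda>_. 0"] r by (auto simp: vnorm_def L2_set_def)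
    then have ne: "?S \<noteq> {}" and fin: "finite ?S" using finite_grid by auto
    \<comment> \<open>The maximum is attained at a pair of grid points, so its \<open>L\<close>-th
      power is one term of the double sum over the grid.\<close>
    define B where "B = Max ?S"
    have "B \<in> ?S" unfolding B_def by (rule Max_in[OF fin ne])
    then obtain u v where uv: "u \<in> grid r" "v \<in> grid r" "B = ?b h u v" by auto
    have "?b h u v \<le> B" if "u \<in> grid r" "v \<in> grid r" for u v
      unfolding B_def by (rule Max_ge[OF fin]) (use that in force)
    then have "op_le r r (skew_mat r h) (2 * B)" by (rule op_le_of_grid[OF r(1)])
    moreover have "0 \<le> B" unfolding uv(3) by simp
    ultimately have "(\<Sum>a<r. mpow r (skew_mat r h) (2 * m) a a) \<le> real r * (2 * B) ^ (2 * m)"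
      by (intro trace_mpow_le sym_mat_sym) auto
    also have "\<dots> = real r * (2 ^ L * ?b h u v ^ L)" by (simp add: L uv(3) power_mult_distrib)
    also have "\<dots> \<le> real r * (2 ^ L * (\<Sum>u\<in>grid r. \<Sum>v\<in>grid r. ?b h u v ^ L))"
    proof -
      have "?b h u v ^ L \<le> (\<Sum>v\<in>grid r. ?b h u v ^ L)"
        by (rule member_le_sum[OF uv(2)]) (auto simp: finite_grid)
      also have "\<dots> \<le> (\<Sum>u\<in>grid r. \<Sum>v\<in>grid r. ?b h u v ^ L)"
        by (rule member_le_sum[OF uv(1)]) (auto simp: finite_grid intro!: sum_nonneg)
      finally show ?thesis by (intro mult_left_mono) auto
    qed
    finally show ?thesis using L by simp
  qed
  have "real (card (good_walks r L)) \<le> skew.Ex r (\<lambda>h. \<Sum>a<r. mpow r (skew_mat r h) L a a)"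
    by (rule skew.Ex_trace_ge) (rule skew_moment_ge)
  also have "\<dots> \<le> skew.Ex r (\<lambda>h. real r * (2 ^ L * (\<Sum>u\<in>grid r. \<Sum>v\<in>grid r. ?b h u v ^ L)))"
    by (rule skew.Ex_mono) (rule tr)
  also have "\<dots> = real r * (2 ^ L * (\<Sum>u\<in>grid r. \<Sum>v\<in>grid r. skew.Ex r (\<lambda>h. ?b h u v ^ L)))"
    by (simp only: skew.Ex_cmult skew.Ex_sum)
  also have "\<dots> \<le> real r * (2 ^ L * (\<Sum>u\<in>grid r. \<Sum>v\<in>grid r. 2 * (sqrt (real L) * exp 8) ^ L))"
    by (intro mult_left_mono sum_mono skew_bil_moment vnorm_grid_vec r) auto
  also have "\<dots> = 4 * real L * (2 ^ L * (real (card (grid r)) * real (card (grid r)) * (sqrt (real L) * exp 8) ^ L))"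
    by (simp add: r_def)
  also have "\<dots> \<le> 4 * real L * (2 ^ L * ((4 * exp 16) ^ r * (4 * exp 16) ^ r * (sqrt (real L) * exp 8) ^ L))"
    by (intro mult_left_mono mult_right_mono mult_mono card_grid_le) auto
  also have "(4 * exp 16 :: real) ^ r * (4 * exp 16) ^ r = ((4 * exp 16) ^ 4) ^ L"
    by (simp only: power_add[symmetric] power_mult[symmetric] r_def) simp
  also have "4 * real L * (2 ^ L * (((4 * exp 16) ^ 4) ^ L * (sqrt (real L) * exp 8) ^ L))
      = 4 * real L * (2 * (4 * exp 16) ^ 4 * exp 8 * sqrt (real L)) ^ L"
    by (simp only: power_mult_distrib mult_ac)
  finally show ?thesis by (simp add: r_def)
qed

definition conc_const :: real where
  "conc_const = 4 * exp 2 * (2 * (4 * exp 16) ^ 4 * exp 8)"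

lemma conc_const_pos: "0 < conc_const"
  by (simp add: conc_const_def)

text \<open>Supplies the trace exponent: of the form that repeated squaring requires, and within a
  factor two above the target \<open>n p\<close>.\<close>

lemma power_of_two_between:
  assumes "2 \<le> (q::real)"
  obtains l :: nat where "q \<le> 2 * 2 ^ l" "2 * 2 ^ l \<le> 2 * q"
proof -
  have ex: "\<exists>k. q \<le> 2 ^ k" using real_arch_pow[of 2 q] by (auto intro: less_imp_le)
  define k where "k = (LEAST k. q \<le> 2 ^ k)"
  have k: "q \<le> 2 ^ k" unfolding k_def by (rule LeastI_ex[OF ex])
  have "k \<noteq> 0" using k assms by (intro notI) auto
  then obtain l where l: "k = Suc l" by (cases k) auto
  have "\<not> q \<le> 2 ^ l" using not_less_Least[of l "\<lambda>k. q \<le> 2 ^ k"] l by (simp add: k_def)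
  then show thesis using that[of l] k l by simp
qed

section \<open>The norm tail of sparse centred matrices\<close>

context edge_product
begin

text \<open>Markov's inequality for the trace of \<open>X^L\<close> with
  \<open>n p \<le> L \<le> 2 n p\<close>. The preceding bounds combine to
  \<open>2 n (2 ?K sqrt L)^L\<close> for the expectation, and \<open>B\<close> exceeds the base of
  this power by the factor \<open>exp 2\<close>.\<close>

lemma op_norm_tail:
  assumes p: "0 \<le> p" "p \<le> 1" and bd: "\<And>e a. e \<in> pairs n \<Longrightarrow> a \<in> \<Omega> \<Longrightarrow> \<bar>g e a\<bar> \<le> 2"
    and var: "\<And>e. e \<in> pairs n \<Longrightarrow> moment e 2 \<le> p" and np: "2 \<le> real n * p"
  shows "Ex (\<lambda>h. of_bool (\<not> op_le n n (sym_mat n (\<lambda>e. g e (h e))) (conc_const * sqrt (real n * p))))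
    \<le> real n * exp (- (real n * p))"
proof -
  let ?X = "\<lambda>h. sym_mat n (\<lambda>e. g e (h e))"
  let ?K = "2 * (4 * exp 16) ^ 4 * exp 8 :: real"
  obtain l where l: "real n * p \<le> 2 * 2 ^ l" "2 * 2 ^ l \<le> 2 * (real n * p)"
    using power_of_two_between[OF np] by blast
  define L :: nat where "L = 2 * 2 ^ l"
  have L: "real n * p \<le> real L" "real L \<le> 2 * (real n * p)" "0 < L" using l by (auto simp: L_def)
  \<comment> \<open>In \<open>conc_const\<close>, the factor 4 on \<open>?K\<close> is 2 from the
    moments times 2 from \<open>sqrt L \<le> 2 sqrt (n p)\<close>; \<open>exp 2\<close> is the decay
    per step of the walk.\<close>
  define B where "B = conc_const * sqrt (real n * p)"
  have "sqrt (real L) \<le> sqrt (2 * (real n * p))" using L by simp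
  also have "\<dots> = sqrt 2 * sqrt (real n * p)" by (simp add: real_sqrt_mult)
  also have "\<dots> \<le> 2 * sqrt (real n * p)" using sqrt2_less_2 np by (intro mult_right_mono) auto
  finally have "2 * exp 2 * ?K * sqrt (real L) \<le> 2 * exp 2 * ?K * (2 * sqrt (real n * p))"
    by (rule mult_left_mono) simp
  then have BL: "exp 2 * (2 * (?K * sqrt (real L))) \<le> B" by (simp add: B_def conc_const_def mult_ac)
  have norm_eq: "(1 / b) * (2 ^ L * (real n / real (2 * L) * (4 * real L * x ^ L)))
      = 2 * real n * ((2 * x) ^ L / b)" for x b :: real
    using L by (simp add: power_mult_distrib)
  have Bpos: "0 < B" using np by (auto simp: B_def conc_const_pos)
  have "Ex (\<lambda>h. of_bool (\<not> op_le n n (?X h) B)) \<le> Ex (\<lambda>h. (1 / B ^ L) * (\<Sum>a<n. mpow n (?X h) L a a))"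
  proof (rule Ex_mono)
    fix h
    have tr0: "0 \<le> (\<Sum>a<n. mpow n (?X h) L a a)"
      unfolding L_def by (rule trace_mpow_nonneg) (rule sym_mat_sym)
    show "of_bool (\<not> op_le n n (?X h) B) \<le> (1 / B ^ L) * (\<Sum>a<n. mpow n (?X h) L a a)"
    proof (cases "op_le n n (?X h) B")
      case True
      then show ?thesis using tr0 Bpos by simp
    next
      case False
      have "\<not> (\<Sum>a<n. mpow n (?X h) L a a) \<le> B ^ L"
      proof
        assume "(\<Sum>a<n. mpow n (?X h) L a a) \<le> B ^ L"
        then have "op_le n n (?X h) B"
          by (intro vnorm_mulv_le_of_trace[OF sym_mat_sym L_def]) (use Bpos in auto)
        with False show False ..
      qed
      then show ?thesis using False Bpos by (simp add: field_simps)
    qed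
  qed
  also have "\<dots> = (1 / B ^ L) * Ex (\<lambda>h. \<Sum>a<n. mpow n (?X h) L a a)" by (rule Ex_cmult)
  also have "\<dots> \<le> (1 / B ^ L) * (2 ^ L * (\<Sum>xs\<in>good_walks n L. p ^ (card (set xs) - 1)))"
    using Bpos by (intro mult_left_mono Ex_trace_le p bd var) auto
  also have "\<dots> \<le> (1 / B ^ L) * (2 ^ L * (real n / real (2 * L) * real (card (good_walks (2 * L) L))))"
    using Bpos by (intro mult_left_mono sum_good_walks_le p L) auto
  also have "\<dots> \<le> (1 / B ^ L) * (2 ^ L * (real n / real (2 * L) * (4 * real L * (?K * sqrt (real L)) ^ L)))"
    using Bpos by (intro mult_left_mono card_good_walks_le[OF L_def]) auto
  also have "\<dots> = 2 * real n * ((2 * (?K * sqrt (real L))) ^ L / B ^ L)"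
    by (rule norm_eq)
  also have "\<dots> \<le> 2 * real n * exp (- 2 * real L)"
  proof (rule mult_left_mono)
    have "exp (2 * real L) * (2 * (?K * sqrt (real L))) ^ L = (exp 2 * (2 * (?K * sqrt (real L)))) ^ L"
      by (simp add: power_mult_distrib exp_of_nat_mult[symmetric] mult.commute)
    also have "\<dots> \<le> B ^ L" by (rule power_mono[OF BL]) simp
    finally show "(2 * (?K * sqrt (real L))) ^ L / B ^ L \<le> exp (- 2 * real L)"
      using Bpos by (simp add: exp_minus field_simps)
  qed simp
  \<comment> \<open>One factor \<open>exp (- L)\<close> absorbs the 2, since
    \<open>L \<ge> 1\<close>; the other becomes \<open>exp (- n p)\<close>.\<close>
  also have "\<dots> = real n * (2 * exp (- real L)) * exp (- real L)" by (simp add: mult_exp_exp)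
  also have "\<dots> \<le> real n * 1 * exp (- (real n * p))"
  proof (intro mult_mono)
    have "1 + real L \<le> exp (real L)" by (rule exp_ge_add_one_self)
    moreover have "1 \<le> real L" using L by simp
    ultimately have "2 \<le> exp (real L)" by linarith
    then show "2 * exp (- real L) \<le> 1" by (simp add: exp_minus field_simps)
  qed (use L in auto)
  finally show ?thesis by (simp add: B_def)
qed

end

section \<open>The signed stochastic block model\<close>

definition sgn_cl :: "(nat \<Rightarrow> nat) \<Rightarrow> nat \<Rightarrow> nat \<Rightarrow> real" where
  "sgn_cl cl i j = (if cl i = cl j then 1 else -1)"

definition mean_adj :: "nat \<Rightarrow> (nat \<Rightarrow> nat) \<Rightarrow> real \<Rightarrow> real \<Rightarrow> rmat" where
  "mean_adj n cl p \<eta> = (\<lambda>i j. if i < n \<and> j < n \<and> i \<noteq> j then p * (1 - 2 * \<eta>) * sgn_cl cl i j else 0)"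

definition mean_abs :: "nat \<Rightarrow> real \<Rightarrow> rmat" where
  "mean_abs n p = (\<lambda>i j. if i < n \<and> j < n \<and> i \<noteq> j then p else 0)"

text \<open>Everything that is used of the random graph. Once these properties hold, the argument up
  to the recovery of the clusters is deterministic.\<close>

definition typical_adj :: "nat \<Rightarrow> (nat \<Rightarrow> nat) \<Rightarrow> real \<Rightarrow> real \<Rightarrow> real \<Rightarrow> rmat \<Rightarrow> bool" where
  "typical_adj n cl p \<eta> B A \<longleftrightarrow>
     op_le n n (\<lambda>i j. A i j - mean_adj n cl p \<eta> i j) B \<and>
     op_le n n (\<lambda>i j. \<bar>A i j\<bar> - mean_abs n p i j) B \<and>
     (\<forall>j<n. dbar n p / 2 \<le> Defs.degree n A j)"

lemma degree_eq_sum_abs: "Defs.degree n A j = (\<Sum>j'<n. \<bar>A j j'\<bar>)"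
  unfolding Defs.degree_def Apos_def Aneg_def by (rule sum.cong) auto

lemma sym_mat_signed_adj:
  assumes "h \<in> pairs n \<rightarrow>\<^sub>E {-1, 0, 1 :: real}"
  shows "sym_mat n h \<in> signed_adj n"
  unfolding signed_adj_def
proof (intro CollectI conjI allI)
  fix i j
  show "sym_mat n h i j \<in> {-1, 0, 1}"
  proof (cases "i < n \<and> j < n \<and> i \<noteq> j")
    case True
    then have "(min i j, max i j) \<in> pairs n" by (auto simp: pairs_def min_def max_def)
    from PiE_mem[OF assms this] show ?thesis using True by (simp add: sym_mat_def)
  qed (auto simp: sym_mat_def)
  show "sym_mat n h i j = sym_mat n h j i" by (rule sym_mat_sym)
  show "sym_mat n h i i = 0" by (simp add: sym_mat_def)
qed (simp add: mat_dims_def sym_mat_def)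

locale ssbm =
  fixes n :: nat and cl :: "nat \<Rightarrow> nat" and p \<eta> :: real
  assumes p: "0 \<le> p" "p \<le> 1" and eta: "0 \<le> \<eta>" "\<eta> \<le> 1 / 2"
begin

definition wt :: "nat \<times> nat \<Rightarrow> real \<Rightarrow> real" where
  "wt e a = edge_prob p \<eta> (cl (fst e) = cl (snd e)) a"

sublocale finite_product "pairs n" "{-1, 0, 1 :: real}" wt
proof
  show "finite (pairs n)" by (rule finite_pairs)
  show "0 \<le> wt e a" for e a using p eta by (auto simp: wt_def edge_prob_def)
  show "(\<Sum>a\<in>{-1, 0, 1}. wt e a) = 1" for e
    by (auto simp: wt_def edge_prob_def algebra_simps)
qed simp

text \<open>A signed adjacency matrix is the same thing as its values above the diagonal, and its
  weight is the product weight of those values.\<close>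

lemma ssbm_prob_eq_Ex: "ssbm_prob n cl p \<eta> E = Ex (\<lambda>h. of_bool (E (sym_mat n h)))"
proof -
  let ?P = "pairs n \<rightarrow>\<^sub>E {-1, 0, 1 :: real}"
  have fin: "finite ?P" by (rule finite_PiE) (auto simp: finite_pairs)
  have inj: "inj_on (sym_mat n) ?P"
  proof (rule inj_onI)
    fix h h' assume h: "h \<in> ?P" "h' \<in> ?P" and eq: "sym_mat n h = sym_mat n h'"
    show "h = h'"
    proof (rule PiE_ext[OF h])
      fix e assume "e \<in> pairs n"
      then show "h e = h' e" using fun_cong[OF fun_cong[OF eq, of "fst e"], of "snd e"]
        by (auto simp: pairs_def sym_mat_def min_def max_def)
    qed
  qed
  have img: "signed_adj n = sym_mat n ` ?P"
  proof (intro equalityI subsetI)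
    fix A assume A: "A \<in> signed_adj n"
    let ?h = "\<lambda>e\<in>pairs n. A (fst e) (snd e)"
    have "?h \<in> ?P" using A by (auto simp: signed_adj_def)
    moreover have "A = sym_mat n ?h"
    proof (intro ext)
      fix i j
      show "A i j = sym_mat n ?h i j"
        using A by (auto simp: signed_adj_def sym_mat_def pairs_def mat_dims_def min_def max_def)
    qed
    ultimately show "A \<in> sym_mat n ` ?P" by blast
  next
    fix A assume "A \<in> sym_mat n ` ?P"
    then obtain h where h: "h \<in> ?P" "A = sym_mat n h" by blast
    then show "A \<in> signed_adj n" by (simp add: sym_mat_signed_adj)
  qed
  have "ssbm_prob n cl p \<eta> E = (\<Sum>A\<in>sym_mat n ` ?P. if E A then ssbm_weight n cl p \<eta> A else 0)"
    unfolding ssbm_prob_def img using fin by (simp add: sum.inter_filter)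
  also have "\<dots> = (\<Sum>h\<in>?P. if E (sym_mat n h) then ssbm_weight n cl p \<eta> (sym_mat n h) else 0)"
    by (subst sum.reindex[OF inj]) simp
  also have "\<dots> = Ex (\<lambda>h. of_bool (E (sym_mat n h)))"
    unfolding Ex_def
  proof (rule sum.cong[OF refl])
    fix h
    have "ssbm_weight n cl p \<eta> (sym_mat n h) = (\<Prod>e\<in>pairs n. wt e (h e))"
      unfolding ssbm_weight_def pairs_def[symmetric]
      by (rule prod.cong) (auto simp: wt_def pairs_def sym_mat_def min_def max_def)
    then show "(if E (sym_mat n h) then ssbm_weight n cl p \<eta> (sym_mat n h) else 0)
        = (\<Prod>e\<in>pairs n. wt e (h e)) * of_bool (E (sym_mat n h))" by simp
  qed
  finally show ?thesis .
qed

definition mu :: "nat \<times> nat \<Rightarrow> real" where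
  "mu e = p * (1 - 2 * \<eta>) * sgn_cl cl (fst e) (snd e)"

lemma mu_abs: "\<bar>mu e\<bar> \<le> 1"
proof -
  have "\<bar>mu e\<bar> = p * (1 - 2 * \<eta>)" using p eta by (auto simp: mu_def sgn_cl_def abs_mult)
  also have "\<dots> \<le> 1 * 1" by (intro mult_mono) (use p eta in auto)
  finally show ?thesis by simp
qed

lemma wt_mean: "(\<Sum>a\<in>{-1, 0, 1}. wt e a * a) = mu e"
  by (auto simp: wt_def edge_prob_def mu_def sgn_cl_def algebra_simps)

lemma wt_second: "(\<Sum>a\<in>{-1, 0, 1}. wt e a * a ^ 2) = p"
  by (auto simp: wt_def edge_prob_def algebra_simps)

lemma wt_sum1: "(\<Sum>a\<in>{-1, 0, 1}. wt e a) = 1"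
  by (auto simp: wt_def edge_prob_def algebra_simps)

interpretation signed: edge_product n "{-1, 0, 1 :: real}" wt "\<lambda>e a. a - mu e"
proof
  fix e
  have "(\<Sum>a\<in>{-1, 0, 1}. wt e a * (a - mu e)) = (\<Sum>a\<in>{-1, 0, 1}. wt e a * a) - mu e * (\<Sum>a\<in>{-1, 0, 1}. wt e a)"
    by (simp add: algebra_simps)
  then show "(\<Sum>a\<in>{-1, 0, 1}. wt e a * (a - mu e)) = 0" unfolding wt_mean wt_sum1 by simp
qed

interpretation absd: edge_product n "{-1, 0, 1 :: real}" wt "\<lambda>e a. \<bar>a\<bar> - p"
proof
  fix e show "(\<Sum>a\<in>{-1, 0, 1}. wt e a * (\<bar>a\<bar> - p)) = 0"
    by (auto simp: wt_def edge_prob_def algebra_simps)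
qed

lemma signed_tail:
  assumes "2 \<le> real n * p"
  shows "Ex (\<lambda>h. of_bool (\<not> op_le n n (\<lambda>i j. sym_mat n h i j - mean_adj n cl p \<eta> i j)
      (conc_const * sqrt (real n * p)))) \<le> real n * exp (- (real n * p))"
proof -
  have eq: "(\<lambda>i j. sym_mat n h i j - mean_adj n cl p \<eta> i j) = sym_mat n (\<lambda>e. h e - mu e)" for h
    by (intro ext) (auto simp: sym_mat_def mean_adj_def mu_def sgn_cl_def min_def max_def)
  show ?thesis unfolding eq
  proof (rule signed.op_norm_tail[OF p _ _ assms])
    fix e and a :: real assume "a \<in> {-1, 0, 1}"
    then show "\<bar>a - mu e\<bar> \<le> 2" using mu_abs[of e] by auto
  next
    fix e
    have "(\<Sum>a\<in>{-1, 0, 1}. wt e a * (a - mu e)\<^sup>2)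
        = (\<Sum>a\<in>{-1, 0, 1}. wt e a * a ^ 2) - 2 * mu e * (\<Sum>a\<in>{-1, 0, 1}. wt e a * a)
          + (mu e)\<^sup>2 * (\<Sum>a\<in>{-1, 0, 1}. wt e a)"
      by (simp add: power2_eq_square algebra_simps)
    also have "\<dots> = p - (mu e)\<^sup>2" unfolding wt_mean wt_second wt_sum1 by (simp add: power2_eq_square)
    finally show "(\<Sum>a\<in>{-1, 0, 1}. wt e a * (a - mu e)\<^sup>2) \<le> p" by simp
  qed
qed

lemma absd_tail:
  assumes "2 \<le> real n * p"
  shows "Ex (\<lambda>h. of_bool (\<not> op_le n n (\<lambda>i j. \<bar>sym_mat n h i j\<bar> - mean_abs n p i j)
      (conc_const * sqrt (real n * p)))) \<le> real n * exp (- (real n * p))"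
proof -
  have eq: "(\<lambda>i j. \<bar>sym_mat n h i j\<bar> - mean_abs n p i j) = sym_mat n (\<lambda>e. \<bar>h e\<bar> - p)" for h
    by (intro ext) (auto simp: sym_mat_def mean_abs_def)
  show ?thesis unfolding eq
  proof (rule absd.op_norm_tail[OF p _ _ assms])
    fix e and a :: real assume "a \<in> {-1, 0, 1}"
    then show "\<bar>\<bar>a\<bar> - p\<bar> \<le> 2" using p by auto
  next
    fix e
    have "(\<Sum>a\<in>{-1, 0, 1}. wt e a * (\<bar>a\<bar> - p)\<^sup>2) = p - p\<^sup>2"
      by (auto simp: wt_def edge_prob_def power2_eq_square algebra_simps)
    then show "(\<Sum>a\<in>{-1, 0, 1}. wt e a * (\<bar>a\<bar> - p)\<^sup>2) \<le> p" by simp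
  qed
qed

text \<open>Lower Chernoff bound with exponential parameter 1. Each incident pair contributes
  \<open>1 - p (1 - exp (-1)) \<le> exp (- 3 p / 5)\<close>, because
  \<open>exp 1 \<ge> 5 / 2\<close>; the exponent that remains is
  \<open>3/5 - 1/2 = 1/10\<close>.\<close>

lemma degree_tail:
  assumes j: "j < n"
  shows "Ex (\<lambda>h. of_bool (\<not> dbar n p / 2 \<le> Defs.degree n (sym_mat n h) j)) \<le> exp (- dbar n p / 10)"
proof -
  let ?c = "\<lambda>e :: nat \<times> nat. of_bool (fst e = j) + of_bool (snd e = j) :: real"
  have deg: "Defs.degree n (sym_mat n h) j = (\<Sum>e\<in>pairs n. ?c e * \<bar>h e\<bar>)" for h
  proof -
    have "Defs.degree n (sym_mat n h) j = (\<Sum>i<n. if i = j then \<Sum>k<n. \<bar>sym_mat n h i k\<bar> else 0)"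
      unfolding degree_eq_sum_abs using j by simp
    also have "\<dots> = (\<Sum>i<n. \<Sum>k<n. of_bool (i = j) * \<bar>sym_mat n h i k\<bar>)"
      by (rule sum.cong) auto
    also have "\<dots> = (\<Sum>e\<in>pairs n. of_bool (fst e = j) * \<bar>sym_mat n h (fst e) (snd e)\<bar>
        + of_bool (snd e = j) * \<bar>sym_mat n h (snd e) (fst e)\<bar>)"
      by (rule sum_pairs) (simp add: sym_mat_def)
    also have "\<dots> = (\<Sum>e\<in>pairs n. ?c e * \<bar>h e\<bar>)"
      by (rule sum.cong) (auto simp: pairs_def sym_mat_def min_def max_def)
    finally show ?thesis .
  qed
  have cnt: "(\<Sum>e\<in>pairs n. ?c e) = real n - 1"
  proof -
    have "(\<Sum>e\<in>pairs n. ?c e) = (\<Sum>e\<in>pairs n. (\<lambda>i k. if i \<noteq> k \<and> i = j then 1 else 0) (fst e) (snd e)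
        + (\<lambda>i k. if i \<noteq> k \<and> i = j then 1 else 0) (snd e) (fst e))"
      by (rule sum.cong) (auto simp: pairs_def)
    also have "\<dots> = (\<Sum>i<n. \<Sum>k<n. if i \<noteq> k \<and> i = j then 1 else 0)" by (rule sum_pairs[symmetric]) simp
    also have "\<dots> = (\<Sum>i<n. if i = j then \<Sum>k<n. if i \<noteq> k then 1 else 0 else 0)"
      by (rule sum.cong) auto
    also have "\<dots> = (\<Sum>k<n. if j \<noteq> k then 1 else 0)" using j by simp
    also have "\<dots> = (\<Sum>k\<in>{..<n} - {j}. 1)"
      by (rule sum.mono_neutral_cong_right) auto
    also have "\<dots> = real n - 1" using j by (simp add: of_nat_diff)
    finally show ?thesis .
  qed
  have e25: "(3 / 5 :: real) \<le> 1 - exp (- 1)"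
    using exp_lower_Taylor_quadratic[of "1::real"] by (simp add: exp_minus field_simps)
  have fac: "(\<Sum>a\<in>{-1, 0, 1}. wt e a * exp (- (?c e * \<bar>a\<bar>))) \<le> exp (- (3 / 5 * p) * ?c e)"
    if e: "e \<in> pairs n" for e
  proof -
    have "fst e \<noteq> snd e" using e by (auto simp: pairs_def)
    then consider "?c e = 0" | "?c e = 1"
      by (cases "fst e = j"; cases "snd e = j") auto
    then show ?thesis
    proof cases
      case 1
      then show ?thesis using wt_sum1[of e] by simp
    next
      case 2
      have "(\<Sum>a\<in>{-1, 0, 1}. wt e a * exp (- (?c e * \<bar>a\<bar>))) = 1 - p * (1 - exp (- 1))"
        unfolding 2 by (auto simp: wt_def edge_prob_def algebra_simps)
      also have "\<dots> \<le> 1 + - (3 / 5 * p)" using mult_left_mono[OF e25 p(1)] by simp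
      also have "\<dots> \<le> exp (- (3 / 5 * p))" by (rule exp_ge_add_one_self)
      finally show ?thesis unfolding 2 by simp
    qed
  qed
  have "Ex (\<lambda>h. of_bool (\<not> dbar n p / 2 \<le> Defs.degree n (sym_mat n h) j))
      \<le> Ex (\<lambda>h. exp (dbar n p / 2) * exp (- Defs.degree n (sym_mat n h) j))"
    by (rule Ex_mono) (auto simp: mult_exp_exp)
  also have "\<dots> = exp (dbar n p / 2) * Ex (\<lambda>h. exp (- Defs.degree n (sym_mat n h) j))"
    by (rule Ex_cmult)
  also have "Ex (\<lambda>h. exp (- Defs.degree n (sym_mat n h) j)) = Ex (\<lambda>h. \<Prod>e\<in>pairs n. exp (- (?c e * \<bar>h e\<bar>)))"
    unfolding deg by (simp add: sum_negf[symmetric] exp_sum[OF finite_pairs])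
  also have "\<dots> = (\<Prod>e\<in>pairs n. \<Sum>a\<in>{-1, 0, 1}. wt e a * exp (- (?c e * \<bar>a\<bar>)))" by (rule Ex_prod)
  also have "\<dots> \<le> (\<Prod>e\<in>pairs n. exp (- (3 / 5 * p) * ?c e))"
    by (intro prod_mono conjI fac sum_nonneg mult_nonneg_nonneg wt_nonneg) auto
  also have "\<dots> = exp (- (3 / 5 * p) * (\<Sum>e\<in>pairs n. ?c e))"
    unfolding sum_distrib_left by (rule exp_sum[OF finite_pairs, symmetric])
  also have "exp (dbar n p / 2) * \<dots> = exp (- dbar n p / 10)"
    unfolding cnt mult_exp_exp by (simp add: dbar_def field_simps)
  finally show ?thesis by simp
qed

text \<open>A union bound, carried out as a pointwise inequality between indicators under the
  expectation.\<close>

lemma typical_prob: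
  assumes np: "2 \<le> real n * p"
    and imp: "\<And>A. A \<in> signed_adj n \<Longrightarrow> typical_adj n cl p \<eta> (conc_const * sqrt (real n * p)) A \<Longrightarrow> E A"
  shows "1 - (2 * real n * exp (- (real n * p)) + real n * exp (- dbar n p / 10)) \<le> ssbm_prob n cl p \<eta> E"
proof -
  let ?B = "conc_const * sqrt (real n * p)"
  let ?F1 = "\<lambda>h. \<not> op_le n n (\<lambda>i j. sym_mat n h i j - mean_adj n cl p \<eta> i j) ?B"
  let ?F2 = "\<lambda>h. \<not> op_le n n (\<lambda>i j. \<bar>sym_mat n h i j\<bar> - mean_abs n p i j) ?B"
  let ?F3 = "\<lambda>j h. \<not> dbar n p / 2 \<le> Defs.degree n (sym_mat n h) j"
  have "1 = Ex (\<lambda>h. 1)" by (simp add: Ex_one)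
  also have "\<dots> \<le> Ex (\<lambda>h. of_bool (E (sym_mat n h)) + (of_bool (?F1 h) + (of_bool (?F2 h) + (\<Sum>j<n. of_bool (?F3 j h)))))"
  proof (rule Ex_mono)
    fix h assume h: "h \<in> pairs n \<rightarrow>\<^sub>E {-1, 0, 1 :: real}"
    have s0: "0 \<le> (\<Sum>j<n. of_bool (?F3 j h) :: real)" by (rule sum_nonneg) simp
    show "1 \<le> of_bool (E (sym_mat n h)) + (of_bool (?F1 h) + (of_bool (?F2 h) + (\<Sum>j<n. of_bool (?F3 j h) :: real)))"
    proof (cases "typical_adj n cl p \<eta> ?B (sym_mat n h)")
      case True
      then have "E (sym_mat n h)" using imp sym_mat_signed_adj[OF h] by blast
      then show ?thesis using s0 by simp
    next
      case False
      then consider "?F1 h" | "?F2 h" | j where "j < n" "?F3 j h" by (auto simp: typical_adj_def)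
      then show ?thesis
      proof cases
        case 1 then show ?thesis using s0 by simp
      next
        case 2 then show ?thesis using s0 by simp
      next
        case 3
        have "of_bool (?F3 j h) \<le> (\<Sum>j<n. of_bool (?F3 j h) :: real)"
          by (rule member_le_sum) (use 3 in auto)
        then have "1 \<le> (\<Sum>j<n. of_bool (?F3 j h) :: real)" using 3 by simp
        moreover have "0 \<le> (of_bool (E (sym_mat n h)) :: real)" "0 \<le> (of_bool (?F1 h) :: real)"
          "0 \<le> (of_bool (?F2 h) :: real)" by simp_all
        ultimately show ?thesis by linarith
      qed
    qed
  qed
  also have "\<dots> = Ex (\<lambda>h. of_bool (E (sym_mat n h))) + (Ex (\<lambda>h. of_bool (?F1 h)) + (Ex (\<lambda>h. of_bool (?F2 h))
      + (\<Sum>j<n. Ex (\<lambda>h. of_bool (?F3 j h)))))"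
    by (simp only: Ex_add Ex_sum)
  also have "\<dots> \<le> ssbm_prob n cl p \<eta> E + (real n * exp (- (real n * p)) + (real n * exp (- (real n * p))
      + (\<Sum>j<n. exp (- dbar n p / 10))))"
    by (intro add_mono sum_mono signed_tail absd_tail degree_tail np) (auto simp: ssbm_prob_eq_Ex)
  finally show ?thesis by simp
qed

lemma ssbm_prob_nonneg: "0 \<le> ssbm_prob n cl p \<eta> E"
  unfolding ssbm_prob_eq_Ex by (rule Ex_nonneg) simp

end

section \<open>Orthonormal frames\<close>

lemma ip_diff_left: "ip n (\<lambda>i. x i - y i) z = ip n x z - ip n y z"
  by (simp add: ip_def left_diff_distrib sum_subtractf)

lemma ip_add_left: "ip n (\<lambda>i. x i + y i) z = ip n x z + ip n y z"
  by (simp add: ip_def distrib_right sum.distrib)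

lemma ip_scale_left: "ip n (\<lambda>i. c * x i) z = c * ip n x z"
  by (simp add: ip_def sum_distrib_left mult.assoc)

lemma ip_diff_right: "ip n z (\<lambda>i. x i - y i) = ip n z x - ip n z y"
  by (simp add: ip_def right_diff_distrib sum_subtractf)

lemma ip_add_right: "ip n z (\<lambda>i. x i + y i) = ip n z x + ip n z y"
  by (simp add: ip_def distrib_left sum.distrib)

lemma ip_scale_right: "ip n z (\<lambda>i. c * x i) = c * ip n z x"
  by (simp add: ip_def sum_distrib_left mult.left_commute)

lemma mulv_diff: "mulv n M (\<lambda>i. x i - y i) = (\<lambda>i. mulv n M x i - mulv n M y i)"
  by (simp add: mulv_def right_diff_distrib sum_subtractf)

lemma mulv_add: "mulv n M (\<lambda>i. x i + y i) = (\<lambda>i. mulv n M x i + mulv n M y i)"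
  by (simp add: mulv_def distrib_left sum.distrib)

lemma mulv_scale: "mulv n M (\<lambda>i. c * x i) = (\<lambda>i. c * mulv n M x i)"
  by (simp add: mulv_def sum_distrib_left mult.left_commute)

text \<open>Gaussian elimination, one equation at a time. All dimension counts below (complete
  bases, Weyl and minimax arguments) are instances of this.\<close>

lemma homogeneous_system:
  fixes c :: "'e \<Rightarrow> 'i \<Rightarrow> real"
  assumes "finite E" "finite I" "card E < card I"
  shows "\<exists>y. (\<exists>i\<in>I. y i \<noteq> 0) \<and> (\<forall>e\<in>E. (\<Sum>i\<in>I. c e i * y i) = 0)"
  using assms
proof (induction E arbitrary: I c rule: finite_induct)
  case empty
  then obtain i where "i \<in> I" by fastforce
  then show ?case by (intro exI[of _ "\<lambda>_. 1"]) auto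
next
  case (insert e E)
  show ?case
  proof (cases "\<forall>i\<in>I. c e i = 0")
    case True
    have "card E < card I" using insert by simp
    from insert.IH[OF insert.prems(1) this, of c] True show ?thesis by auto
  next
    case False
    then obtain i0 where i0: "i0 \<in> I" "c e i0 \<noteq> 0" by blast
    \<comment> \<open>\<open>i0\<close> is the pivot of equation \<open>e\<close>; \<open>?c\<close>
      is the system after eliminating that unknown.\<close>
    let ?I = "I - {i0}" and ?c = "\<lambda>e' i. c e' i - c e' i0 * c e i / c e i0"
    have "finite ?I" "card E < card ?I" using insert i0 by auto
    from insert.IH[OF this, of ?c] obtain y where y: "\<exists>i\<in>?I. y i \<noteq> 0"
      "\<forall>e'\<in>E. (\<Sum>i\<in>?I. ?c e' i * y i) = 0" by blast
    define z where "z = y(i0 := - (\<Sum>i\<in>?I. c e i * y i) / c e i0)"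
    have sum: "(\<Sum>i\<in>I. c e' i * z i) = c e' i0 * z i0 + (\<Sum>i\<in>?I. c e' i * y i)" for e'
    proof -
      have "(\<Sum>i\<in>I. c e' i * z i) = c e' i0 * z i0 + (\<Sum>i\<in>?I. c e' i * z i)"
        using insert.prems i0 by (intro sum.remove) auto
      also have "(\<Sum>i\<in>?I. c e' i * z i) = (\<Sum>i\<in>?I. c e' i * y i)"
        by (rule sum.cong) (auto simp: z_def)
      finally show ?thesis .
    qed
    have "(\<Sum>i\<in>I. c e' i * z i) = 0" if e': "e' \<in> insert e E" for e'
    proof (cases "e' = e")
      case True
      then show ?thesis unfolding sum using i0 by (simp add: z_def)
    next
      case False
      then have "(\<Sum>i\<in>?I. ?c e' i * y i) = 0" using y(2) e' by blast
      then have "(\<Sum>i\<in>?I. c e' i * y i) = c e' i0 * (\<Sum>i\<in>?I. c e i * y i) / c e i0"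
      proof -
        have "(\<Sum>i\<in>?I. ?c e' i * y i) = (\<Sum>i\<in>?I. c e' i * y i - (c e' i0 / c e i0) * (c e i * y i))"
          by (rule sum.cong) (auto simp: algebra_simps)
        also have "\<dots> = (\<Sum>i\<in>?I. c e' i * y i) - (c e' i0 / c e i0) * (\<Sum>i\<in>?I. c e i * y i)"
          by (simp only: sum_subtractf sum_distrib_left)
        finally show ?thesis using \<open>(\<Sum>i\<in>?I. ?c e' i * y i) = 0\<close> by simp
      qed
      then show ?thesis unfolding sum by (simp add: z_def)
    qed
    moreover have "\<exists>i\<in>I. z i \<noteq> 0" using y(1) by (auto simp: z_def)
    ultimately show ?thesis by blast
  qed
qed

definition orthonormal :: "nat \<Rightarrow> nat \<Rightarrow> rmat \<Rightarrow> bool" where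
  "orthonormal n m W \<longleftrightarrow> (\<forall>a<m. \<forall>b<m. (\<Sum>i<n. W i a * W i b) = (if a = b then 1 else 0))"

definition mat_transp :: "rmat \<Rightarrow> rmat" where
  "mat_transp M = (\<lambda>i j. M j i)"

lemma ip_mulv_left: "ip r (mulv c M x) y = ip c x (mulv r (mat_transp M) y)"
  using ip_mulv[of r y c M x] by (simp add: ip_commute mat_transp_def)

lemma ip_mulv_right: "ip r x (mulv c M y) = ip c (mulv r (mat_transp M) x) y"
  using ip_mulv[of r x c M y] by (simp add: mat_transp_def)

lemma orthonormal_mulv:
  assumes "orthonormal n m W" "a < m"
  shows "mulv n (mat_transp W) (mulv m W y) a = y a"
proof -
  have "mulv n (mat_transp W) (mulv m W y) a = (\<Sum>b<m. (\<Sum>i<n. W i a * W i b) * y b)"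
    unfolding mulv_def mat_transp_def sum_distrib_left sum_distrib_right
    by (subst sum.swap) (simp add: mult_ac)
  also have "\<dots> = (\<Sum>b<m. if a = b then y b else 0)"
    by (rule sum.cong) (use assms in \<open>auto simp: orthonormal_def\<close>)
  finally show ?thesis using assms(2) by simp
qed

lemma ip_orthonormal:
  assumes "orthonormal n m W"
  shows "ip n (mulv m W x) (mulv m W y) = ip m x y"
  unfolding ip_mulv_left by (rule ip_cong) (use orthonormal_mulv[OF assms] in auto)

lemma vnorm_orthonormal:
  assumes "orthonormal n m W"
  shows "vnorm n (mulv m W x) = vnorm m x"
proof -
  have "(vnorm n (mulv m W x))\<^sup>2 = (vnorm m x)\<^sup>2"
    unfolding vnorm_sq_ip by (rule ip_orthonormal[OF assms])
  then show ?thesis by (simp add: power2_eq_iff_nonneg)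
qed

text \<open>The \<open>N\<close> columns together with \<open>x\<close> are linearly dependent. As
  the columns are independent, the coefficient of \<open>x\<close> in the relation is nonzero, so
  \<open>x\<close> lies in their span.\<close>

lemma orthonormal_square_expand:
  assumes U: "orthonormal N N U" and e: "e < N"
  shows "mulv N U (mulv N (mat_transp U) x) e = x e"
proof -
  \<comment> \<open>Index \<open>N\<close> stands for \<open>x\<close>, appended to the
    columns.\<close>
  let ?c = "\<lambda>e i. if i < N then U e i else x e"
  have "card {..<N} < card {..N}" by simp
  from homogeneous_system[OF _ _ this, of ?c] obtain y where
    y: "\<exists>i\<in>{..N}. y i \<noteq> 0" "\<forall>e\<in>{..<N}. (\<Sum>i\<le>N. ?c e i * y i) = 0" by auto
  have y': "mulv N U y e + x e * y N = 0" if "e < N" for e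
  proof -
    have "(\<Sum>i\<le>N. ?c e i * y i) = (\<Sum>i<N. ?c e i * y i) + x e * y N"
      by (simp add: lessThan_Suc_atMost[symmetric])
    also have "(\<Sum>i<N. ?c e i * y i) = mulv N U y e" unfolding mulv_def by (rule sum.cong) auto
    finally show ?thesis using y(2) that by auto
  qed
  have nz: "y N \<noteq> 0"
  proof
    assume z: "y N = 0"
    have "y a = 0" if "a < N" for a
    proof -
      have "y a = mulv N (mat_transp U) (mulv N U y) a" using orthonormal_mulv[OF U that] by simp
      also have "\<dots> = mulv N (mat_transp U) (\<lambda>_. 0) a"
        using mulv_cong[of N "mulv N U y" "\<lambda>_. 0" "mat_transp U"] y' z by auto
      finally show ?thesis by (simp add: mulv_def)
    qed
    with y(1) z show False by (auto simp: le_less)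
  qed
  define w where "w = (\<lambda>i. - y i / y N)"
  have x: "x e = mulv N U w e" if "e < N" for e
  proof -
    have "mulv N U w e = - (mulv N U y e) / y N"
      by (simp add: mulv_def w_def sum_negf sum_divide_distrib)
    moreover have "x e * y N = - mulv N U y e" using y'[OF that] by linarith
    then have "x e = - mulv N U y e / y N" using nz nonzero_mult_div_cancel_right[of "y N" "x e"] by simp
    ultimately show ?thesis by simp
  qed
  have "mulv N (mat_transp U) x = mulv N (mat_transp U) (mulv N U w)"
    by (rule mulv_cong) (simp add: x)
  then have "mulv N U (mulv N (mat_transp U) x) e = mulv N U w e"
    using mulv_cong[of N "mulv N (mat_transp U) x" w U] orthonormal_mulv[OF U] by auto
  then show ?thesis using x[OF e] by simp
qed

lemma orthonormal_square_transp:
  assumes U: "orthonormal N N U"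
  shows "orthonormal N N (mat_transp U)"
  unfolding orthonormal_def
proof (intro allI impI)
  fix a b assume ab: "a < N" "b < N"
  have "mulv N U (mulv N (mat_transp U) (\<lambda>i. if i = b then 1 else 0)) a = (if a = b then 1 else 0)"
    by (rule orthonormal_square_expand[OF U ab(1)])
  then show "(\<Sum>i<N. mat_transp U i a * mat_transp U i b) = (if a = b then 1 else 0)"
    using ab by (simp add: mulv_def mat_transp_def if_distrib cong: if_cong)
qed

lemma mat_transp_mat_transp [simp]: "mat_transp (mat_transp M) = M"
  by (simp add: mat_transp_def)

section \<open>Polar decomposition\<close>

lemma orthogonal_mat_iff: "orthogonal_mat m Q \<longleftrightarrow> mat_dims m m Q \<and> orthonormal m m Q"
  by (simp add: orthogonal_mat_def orthonormal_def)

text \<open>Matrices are functions on all pairs of naturals, so compactness is that of an infinite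
  product and comes from Tychonoff's theorem. For orthogonal matrices the unit columns and the
  vanishing of entries outside \<open>mat_dims\<close> confine the set to such a box.\<close>

lemma compact_fun_box:
  fixes K :: "'b :: topological_space set"
  assumes "compact K"
  shows "compact {f :: nat \<Rightarrow> 'b. \<forall>i. f i \<in> K}"
proof -
  have "compactin (product_topology (\<lambda>_. euclidean) UNIV) (PiE UNIV (\<lambda>_ :: nat. K))"
    using assms by (simp add: compactin_PiE)
  moreover have "PiE UNIV (\<lambda>_ :: nat. K) = {f. \<forall>i. f i \<in> K}" by (auto simp: PiE_def)
  ultimately show ?thesis by (simp add: euclidean_product_topology)
qed

lemma compact_box: "compact {Q :: rmat. \<forall>i j. Q i j \<in> {-1..1}}"
  using compact_fun_box[OF compact_fun_box[OF compact_Icc[of "-1 :: real" 1]]] by simp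

lemma continuous_on_entry: "continuous_on S (\<lambda>Q :: rmat. Q i j)"
proof -
  have "continuous_on S (\<lambda>Q :: rmat. Q i)"
    by (rule continuous_on_product_then_coordinatewise[OF continuous_on_id])
  then show ?thesis by (rule continuous_on_product_then_coordinatewise)
qed

lemma compact_orthogonal_mat: "compact {Q. orthogonal_mat m Q}"
proof -
  let ?B = "{Q :: rmat. \<forall>i j. Q i j \<in> {-1..1}}"
  let ?C1 = "\<Inter>e\<in>{e. m \<le> fst e \<or> m \<le> snd e}. {Q :: rmat. Q (fst e) (snd e) = 0}"
  let ?C2 = "\<Inter>a\<in>{..<m}. \<Inter>b\<in>{..<m}. {Q :: rmat. (\<Sum>j<m. Q j a * Q j b) = (if a = b then 1 else 0)}"
  have "closed ?C1"
    by (intro closed_INT ballI closed_Collect_eq continuous_on_entry continuous_on_const)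
  moreover have "closed ?C2"
    by (intro closed_INT ballI closed_Collect_eq continuous_on_const continuous_on_sum
        continuous_on_mult continuous_on_entry)
  ultimately have "compact (?B \<inter> (?C1 \<inter> ?C2))"
    by (intro compact_Int_closed compact_box closed_Int)
  moreover have "{Q. orthogonal_mat m Q} = ?B \<inter> (?C1 \<inter> ?C2)"
  proof (intro equalityI subsetI)
    fix Q assume "Q \<in> {Q. orthogonal_mat m Q}"
    then have Q: "mat_dims m m Q" "orthonormal m m Q" by (auto simp: orthogonal_mat_iff)
    have "Q i j \<in> {-1..1}" for i j
    proof (cases "i < m \<and> j < m")
      case True
      have "(Q i j)\<^sup>2 \<le> (\<Sum>k<m. (Q k j)\<^sup>2)" by (rule member_le_sum) (use True in auto)
      also have "\<dots> = 1" using Q(2) True by (auto simp: orthonormal_def power2_eq_square)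
      finally show ?thesis by (auto simp: abs_square_le_1 abs_le_iff)
    next
      case False
      then show ?thesis using Q(1) by (auto simp: mat_dims_def)
    qed
    then show "Q \<in> ?B \<inter> (?C1 \<inter> ?C2)" using Q by (simp add: mat_dims_def orthonormal_def)
  next
    fix Q assume "Q \<in> ?B \<inter> (?C1 \<inter> ?C2)"
    then show "Q \<in> {Q. orthogonal_mat m Q}"
      by (simp add: orthogonal_mat_def mat_dims_def)
  qed
  ultimately show ?thesis by simp
qed

text \<open>\<open>Q (I - 2 u u^T)\<close>, that is, \<open>Q\<close> composed with a Householder
  reflection when \<open>u\<close> is a unit vector, cut off outside the
  \<open>m\<close>-by-\<open>m\<close> block.\<close>

definition reflect :: "nat \<Rightarrow> (nat \<Rightarrow> real) \<Rightarrow> rmat \<Rightarrow> rmat" where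
  "reflect m u Q = (\<lambda>j a. if j < m \<and> a < m then Q j a - 2 * mulv m Q u j * u a else 0)"

lemma orthogonal_reflect:
  assumes Q: "orthogonal_mat m Q" and u: "ip m u u = 1"
  shows "orthogonal_mat m (reflect m u Q)"
  unfolding orthogonal_mat_def
proof (intro conjI allI impI)
  show "mat_dims m m (reflect m u Q)" by (auto simp: mat_dims_def reflect_def)
  fix a b assume ab: "a < m" "b < m"
  have O: "orthonormal m m Q" using Q by (simp add: orthogonal_mat_iff)
  let ?q = "mulv m Q u"
  have q1: "(\<Sum>j<m. Q j c * ?q j) = u c" if "c < m" for c
    using orthonormal_mulv[OF O that, of u] unfolding mulv_def[of m "mat_transp Q"] by (simp add: mat_transp_def)
  have q2: "(\<Sum>j<m. ?q j * ?q j) = 1" using ip_orthonormal[OF O, of u u] u by (simp add: ip_def)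
  have "(\<Sum>j<m. reflect m u Q j a * reflect m u Q j b)
      = (\<Sum>j<m. (Q j a * Q j b) - 2 * u b * (Q j a * ?q j) - 2 * u a * (Q j b * ?q j) + 4 * u a * u b * (?q j * ?q j))"
    by (rule sum.cong) (use ab in \<open>auto simp: reflect_def algebra_simps\<close>)
  also have "\<dots> = (\<Sum>j<m. Q j a * Q j b) - 2 * u b * (\<Sum>j<m. Q j a * ?q j) - 2 * u a * (\<Sum>j<m. Q j b * ?q j)
      + 4 * u a * u b * (\<Sum>j<m. ?q j * ?q j)"
    by (simp only: sum.distrib sum_subtractf sum_distrib_left)
  also have "\<dots> = (\<Sum>j<m. Q j a * Q j b)" unfolding q1[OF ab(1)] q1[OF ab(2)] q2 by simp
  also have "\<dots> = (if a = b then 1 else 0)" using O ab by (simp add: orthonormal_def)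
  finally show "(\<Sum>j<m. reflect m u Q j a * reflect m u Q j b) = (if a = b then 1 else 0)" .
qed

text \<open>
  \<open>Q\<close> maximises \<open>tr (Q\<^sup>T G)\<close> over the orthogonal group. Composing \<open>Q\<close> with one reflection cannot increase the
  trace, which makes \<open>Q\<^sup>T G\<close> positive semidefinite; composing it with two nearby ones (a small rotation) makes it
  symmetric.
\<close>

lemma polar_exists:
  fixes G :: rmat
  shows "\<exists>Q. orthogonal_mat m Q \<and>
    (\<forall>a<m. \<forall>b<m. (\<Sum>j<m. Q j a * G j b) = (\<Sum>j<m. Q j b * G j a)) \<and>
    (\<forall>x. 0 \<le> ip m (mulv m Q x) (mulv m G x))"
proof -
  define F where "F = (\<lambda>Q :: rmat. \<Sum>j<m. \<Sum>a<m. Q j a * G j a)"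
  let ?O = "{Q. orthogonal_mat m Q}"
  let ?id = "\<lambda>i j. if i = j \<and> i < m then 1 else (0::real)"
  have "(\<Sum>j<m. ?id j a * ?id j b) = (if a = b then 1 else 0)" if "a < m" for a b
  proof -
    have "(\<Sum>j<m. ?id j a * ?id j b) = (\<Sum>j<m. if j = a then (if a = b then 1 else 0) else 0)"
      by (rule sum.cong) auto
    then show ?thesis using that by simp
  qed
  then have "?id \<in> ?O" by (auto simp: orthogonal_mat_def mat_dims_def)
  then have ne: "?O \<noteq> {}" by blast
  have cont: "continuous_on ?O F"
    unfolding F_def by (intro continuous_on_sum continuous_on_mult continuous_on_entry continuous_on_const)
  obtain Q where Q: "orthogonal_mat m Q" and max: "\<And>Q'. orthogonal_mat m Q' \<Longrightarrow> F Q' \<le> F Q"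
    using continuous_attains_sup[OF compact_orthogonal_mat ne cont] by auto
  let ?s = "\<lambda>Q x y. ip m (mulv m Q x) (mulv m G y)"
  have Frefl: "F (reflect m u Q') = F Q' - 2 * ?s Q' u u" for u Q'
  proof -
    have "F (reflect m u Q') = (\<Sum>j<m. \<Sum>a<m. Q' j a * G j a - 2 * (mulv m Q' u j * (G j a * u a)))"
      unfolding F_def by (intro sum.cong refl) (auto simp: reflect_def algebra_simps)
    also have "\<dots> = F Q' - 2 * ?s Q' u u"
      by (simp only: F_def sum_subtractf sum_distrib_left[symmetric] ip_def mulv_def[of m G])
    finally show ?thesis .
  qed
  have pos1: "0 \<le> ?s Q u u" if "ip m u u = 1" for u
    using max[OF orthogonal_reflect[OF Q that]] unfolding Frefl by simp
  \<comment> \<open>Reflecting in \<open>u\<close> and then in \<open>w\<close> amounts to a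
    rotation of their plane; maximality of \<open>Q\<close> against it is this inequality.\<close>
  have two: "?s Q u u + ?s Q w w \<ge> 2 * ip m u w * ?s Q u w" if u: "ip m u u = 1" and w: "ip m w w = 1" for u w
  proof -
    have "F (reflect m w (reflect m u Q)) \<le> F Q"
      by (intro max orthogonal_reflect Q u w)
    then have "- 2 * ?s Q u u - 2 * ?s (reflect m u Q) w w \<le> 0" unfolding Frefl by simp
    moreover have "?s (reflect m u Q) w w = ?s Q w w - 2 * ip m u w * ?s Q u w"
    proof -
      have "mulv m (reflect m u Q) w j = mulv m Q w j - 2 * ip m u w * mulv m Q u j" if "j < m" for j
      proof -
        have "mulv m (reflect m u Q) w j = (\<Sum>a<m. Q j a * w a - 2 * mulv m Q u j * (u a * w a))"
          unfolding mulv_def[of m "reflect m u Q"]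
          by (rule sum.cong) (use that in \<open>auto simp: reflect_def algebra_simps\<close>)
        also have "\<dots> = mulv m Q w j - 2 * mulv m Q u j * ip m u w"
          by (simp only: sum_subtractf sum_distrib_left[symmetric] mulv_def[of m Q w] ip_def)
        finally show ?thesis by simp
      qed
      then have "?s (reflect m u Q) w w = ip m (\<lambda>j. mulv m Q w j - 2 * ip m u w * mulv m Q u j) (mulv m G w)"
        by (intro ip_cong) auto
      also have "\<dots> = ?s Q w w - 2 * ip m u w * ?s Q u w"
        by (simp only: ip_diff_left ip_scale_left)
      finally show ?thesis .
    qed
    ultimately show ?thesis by simp
  qed
  have pos: "0 \<le> ?s Q x x" for x
  proof (cases "vnorm m x = 0")
    case True
    then have "mulv m Q x = (\<lambda>_. 0)" by (auto simp: vnorm_def L2_set_eq_0_iff mulv_def)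
    then show ?thesis by (simp add: ip_def)
  next
    case False
    then have vp: "0 < vnorm m x" using vnorm_nonneg[of m x] by linarith
    let ?u = "\<lambda>i. (1 / vnorm m x) * x i"
    have "vnorm m ?u = 1" unfolding vnorm_scale using vp by simp
    then have "ip m ?u ?u = 1" unfolding vnorm_sq_ip[symmetric] by simp
    then have "0 \<le> ?s Q ?u ?u" by (rule pos1)
    also have "?s Q ?u ?u = (1 / vnorm m x)\<^sup>2 * ?s Q x x"
      by (simp only: mulv_scale ip_scale_left ip_scale_right power2_eq_square mult.assoc)
    finally show ?thesis using vp by (simp add: zero_le_mult_iff)
  qed
  define S where "S = (\<lambda>a b. \<Sum>j<m. Q j a * G j b)"
  let ?e = "\<lambda>a i. if i = a then 1 else (0::real)"
  have Se: "?s Q (\<lambda>i. c * ?e a i + d * ?e b i) (\<lambda>i. c' * ?e a i + d' * ?e b i)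
      = c * c' * S a a + c * d' * S a b + d * c' * S b a + d * d' * S b b"
    if "a < m" "b < m" for a b c d c' d'
  proof -
    have me: "mulv m M (?e a) = (\<lambda>j. M j a)" if "a < m" for M :: rmat and a
      using that by (simp add: mulv_def if_distrib cong: if_cong)
    have "?s Q (\<lambda>i. c * ?e a i + d * ?e b i) (\<lambda>i. c' * ?e a i + d' * ?e b i)
      = ip m (\<lambda>j. c * Q j a + d * Q j b) (\<lambda>j. c' * G j a + d' * G j b)"
      unfolding mulv_add mulv_scale me[OF that(1)] me[OF that(2)] ..
    also have "\<dots> = c * c' * S a a + c * d' * S a b + d * c' * S b a + d * d' * S b b"
      unfolding ip_add_left ip_add_right ip_scale_left ip_scale_right
      by (simp add: ip_def S_def algebra_simps)
    finally show ?thesis .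
  qed
  have half: "S a b \<le> S b a" if ab: "a < m" "b < m" "a \<noteq> b" for a b
  proof (rule ccontr)
    assume "\<not> S a b \<le> S b a"
    then have D: "0 < S a b - S b a" (is "0 < ?D") by simp
    let ?T = "S a a + S b b"
    \<comment> \<open>\<open>w\<close> is \<open>e_a\<close> turned towards \<open>e_b\<close> by
      the angle with tangent \<open>t\<close>. After division by \<open>t c^2\<close> the
      antisymmetric part \<open>?D\<close> stands alone on the left, and the diagonal terms keep a
      factor \<open>t\<close>, which can be made small.\<close>
    have key: "?D \<le> t * ?T" if t: "0 < t" for t
    proof -
      define c where "c = 1 / sqrt (1 + t\<^sup>2)"
      define s where "s = t * c"
      have t1: "0 < 1 + t\<^sup>2" by (simp add: add_pos_nonneg)
      have c: "0 < c" using t1 by (simp add: c_def)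
      have cs: "c * c + s * s = 1"
      proof -
        have cc: "c * c = 1 / (1 + t\<^sup>2)" using t1 by (simp add: c_def)
        have "c * c + s * s = (1 + t\<^sup>2) * (c * c)"
          by (simp add: s_def power2_eq_square algebra_simps)
        then show ?thesis unfolding cc using t1 by simp
      qed
      let ?u = "\<lambda>i. 1 * ?e a i + 0 * ?e b i" and ?w = "\<lambda>i. c * ?e a i + s * ?e b i"
      have ipw: "ip m (\<lambda>i. c1 * ?e a i + d1 * ?e b i) (\<lambda>i. c2 * ?e a i + d2 * ?e b i) = c1 * c2 + d1 * d2" for c1 d1 c2 d2
      proof -
        have "ip m (?e a) (?e b) = (if a = b then 1 else 0)" if "a < m" "b < m" for a b
        proof -
          have "ip m (?e a) (?e b) = (\<Sum>i<m. if i = a then ?e b i else 0)"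
            unfolding ip_def by (rule sum.cong) auto
          then show ?thesis using that by simp
        qed
        then show ?thesis using ab unfolding ip_add_left ip_add_right ip_scale_left ip_scale_right by simp
      qed
      have "ip m ?u ?u = 1" unfolding ipw by simp
      moreover have "ip m ?w ?w = 1" unfolding ipw by (rule cs)
      ultimately have "?s Q ?u ?u + ?s Q ?w ?w \<ge> 2 * ip m ?u ?w * ?s Q ?u ?w" by (rule two)
      then have "S a a + (c * c * S a a + c * s * S a b + s * c * S b a + s * s * S b b)
          \<ge> 2 * c * (c * S a a + s * S a b)"
        unfolding Se[OF ab(1,2)] ipw by simp
      moreover have "S a a = (c * c + s * s) * S a a" using cs by simp
      ultimately have "s * c * ?D \<le> s * s * ?T" by (simp add: algebra_simps)
      then have "(t * c * c) * ?D \<le> (t * c * c) * (t * ?T)" by (simp add: s_def mult_ac)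
      then show ?thesis using t c by simp
    qed
    show False
    proof (cases "?T \<le> 0")
      case True
      then show False using key[of 1] D by simp
    next
      case False
      then have T: "0 < ?T" by simp
      have "?D \<le> (?D / (2 * ?T)) * ?T" by (rule key) (use D T in simp)
      also have "\<dots> = ?D / 2"
      proof -
        have "(x / (2 * y)) * y = x / 2" if "0 < y" for x y :: real using that by simp
        then show ?thesis using T by blast
      qed
      finally show False using D by simp
    qed
  qed
  have "S a b = S b a" if "a < m" "b < m" for a b
    using half[OF that] half[OF that(2,1)] by (cases "a = b") auto
  then show ?thesis using Q pos unfolding S_def by blast
qed

section \<open>The Procrustes problem for two frames\<close>

text \<open>\<open>I - W W^T\<close>: for an orthonormal frame, the projection onto the orthogonal
  complement of its range.\<close>

definition compl_proj :: "nat \<Rightarrow> nat \<Rightarrow> rmat \<Rightarrow> (nat \<Rightarrow> real) \<Rightarrow> nat \<Rightarrow> real" where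
  "compl_proj n m W z = (\<lambda>i. z i - mulv m W (mulv n (mat_transp W) z) i)"

lemma mult_left_le_cancel:
  fixes p x y :: real
  assumes "0 \<le> p" "p * x \<le> p * y" "p = 0 \<Longrightarrow> x \<le> y"
  shows "x \<le> y"
proof (cases "p = 0")
  case False
  then have "0 < p" using assms(1) by simp
  then show ?thesis using assms(2) by simp
qed (use assms(3) in simp)

lemma vnorm_diff: "vnorm n (\<lambda>i. x i - y i) \<le> vnorm n x + vnorm n y"
  using vnorm_triangle[of n x "\<lambda>i. (-1) * y i"] vnorm_scale[of n "-1" y] by simp

lemma compl_proj_orth:
  assumes "orthonormal n m W" "a < m"
  shows "mulv n (mat_transp W) (compl_proj n m W z) a = 0"
  unfolding compl_proj_def mulv_diff using orthonormal_mulv[OF assms] by simp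

lemma ip_compl_proj_range:
  assumes "orthonormal n m W"
  shows "ip n (compl_proj n m W z) (mulv m W c) = 0"
proof -
  have "ip n (compl_proj n m W z) (mulv m W c) = ip m (mulv n (mat_transp W) (compl_proj n m W z)) c"
    by (rule ip_mulv_right)
  also have "\<dots> = ip m (\<lambda>_. 0) c" by (rule ip_cong) (use compl_proj_orth[OF assms] in auto)
  finally show ?thesis by (simp add: ip_def)
qed

lemma ip_compl_proj:
  assumes "orthonormal n m W"
  shows "ip n (compl_proj n m W x) (compl_proj n m W y) = ip n (compl_proj n m W x) y"
proof -
  have "ip n (compl_proj n m W x) (compl_proj n m W y)
      = ip n (compl_proj n m W x) y - ip n (compl_proj n m W x) (mulv m W (mulv n (mat_transp W) y))"
    unfolding compl_proj_def[of n m W y] by (rule ip_diff_right)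
  then show ?thesis by (simp add: ip_compl_proj_range[OF assms])
qed

lemma vnorm_compl_proj:
  assumes "orthonormal n m W"
  shows "vnorm n (compl_proj n m W z) \<le> vnorm n z"
proof -
  let ?p = "vnorm n (compl_proj n m W z)"
  have "?p * ?p = ip n (compl_proj n m W z) z"
    using ip_compl_proj[OF assms, of z z] vnorm_sq_ip[of n "compl_proj n m W z"] by (simp add: power2_eq_square)
  also have "\<dots> \<le> ?p * vnorm n z" using ip_le_vnorm abs_le_D1 by blast
  finally show ?thesis by (rule mult_left_le_cancel[OF vnorm_nonneg]) auto
qed

text \<open>
  With \<open>S = Q\<^sup>T W\<^sup>T V\<close> from the polar decomposition, \<open>(S + I) (S - I) = S\<^sup>2 - I\<close> and \<open>S + I \<ge> I\<close> give
  \<open>\<parallel>S - I\<parallel> \<le> \<parallel>S\<^sup>2 - I\<parallel> \<le> \<epsilon>\<^sup>2\<close>.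
\<close>

lemma procrustes_bound:
  assumes V: "orthonormal n m V" and W: "orthonormal n m W" and e: "0 \<le> \<epsilon>"
    and proj: "\<And>y. vnorm n (compl_proj n m W (mulv m V y)) \<le> \<epsilon> * vnorm m y"
  shows "\<exists>Q. orthogonal_mat m Q \<and>
    (\<forall>y. vnorm n (\<lambda>i. mulv m V y i - mulv m W (mulv m Q y) i) \<le> (\<epsilon> + \<epsilon>\<^sup>2) * vnorm m y)"
proof -
  define G where "G = (\<lambda>a b. \<Sum>i<n. W i a * V i b)"
  have G: "mulv m G y = mulv n (mat_transp W) (mulv m V y)" for y
    unfolding mulv_def mat_transp_def G_def sum_distrib_left sum_distrib_right
    by (subst sum.swap) (simp add: mult_ac)
  obtain Q where Q: "orthogonal_mat m Q"
    and symS: "\<forall>a<m. \<forall>b<m. (\<Sum>j<m. Q j a * G j b) = (\<Sum>j<m. Q j b * G j a)"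
    and pos: "\<And>x. 0 \<le> ip m (mulv m Q x) (mulv m G x)"
    using polar_exists[of m G] by blast
  have QO: "orthonormal m m Q" using Q by (simp add: orthogonal_mat_iff)
  let ?S = "\<lambda>y. mulv m (mat_transp Q) (mulv m G y)"
  have Sxy: "ip m x (?S y) = ip m (mulv m Q x) (mulv m G y)" for x y
    unfolding ip_mulv_right[of m x m "mat_transp Q"] by simp
  define T where "T = (\<lambda>a b. \<Sum>j<m. Q j a * G j b)"
  have Smat: "?S y a = (\<Sum>b<m. T a b * y b)" for y a
    unfolding mulv_def mat_transp_def T_def sum_distrib_left sum_distrib_right
    by (subst sum.swap) (simp add: mult_ac)
  have Tsym: "T a b = T b a" if "a < m" "b < m" for a b using symS that by (simp add: T_def)
  have Ssym: "ip m x (?S y) = ip m (?S x) y" for x y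
  proof -
    have "ip m x (?S y) = (\<Sum>a<m. \<Sum>b<m. x a * (T a b * y b))"
      unfolding ip_def Smat by (simp only: sum_distrib_left)
    also have "\<dots> = (\<Sum>b<m. \<Sum>a<m. x a * (T a b * y b))" by (rule sum.swap)
    also have "\<dots> = (\<Sum>b<m. \<Sum>a<m. T b a * x a * y b)"
      by (intro sum.cong refl) (use Tsym in \<open>simp add: mult_ac\<close>)
    also have "\<dots> = ip m (?S x) y"
      unfolding ip_def Smat sum_distrib_right ..
    finally show ?thesis .
  qed
  have QS: "mulv m Q (?S y) a = mulv m G y a" if "a < m" for y a
    by (rule orthonormal_square_expand[OF QO that])
  \<comment> \<open>\<open>S^2 = G^T G = V^T W W^T V = I - V^T (I - W W^T) V\<close>, because
    \<open>S\<close> is symmetric and \<open>Q S = G\<close>.\<close>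
  have SS: "ip m (?S x) (?S y) = ip m x y - ip n (compl_proj n m W (mulv m V x)) (compl_proj n m W (mulv m V y))" for x y
  proof -
    have "ip m (?S x) (?S y) = ip m (mulv m Q (?S x)) (mulv m Q (?S y))"
      by (rule ip_orthonormal[OF QO, symmetric])
    also have "\<dots> = ip m (mulv m G x) (mulv m G y)" by (rule ip_cong) (auto simp: QS)
    also have "\<dots> = ip n (mulv m W (mulv m G x)) (mulv m V y)" unfolding G by (rule ip_mulv_left[symmetric])
    also have "mulv m W (mulv m G x) = (\<lambda>i. mulv m V x i - compl_proj n m W (mulv m V x) i)"
      by (simp add: compl_proj_def G)
    also have "ip n \<dots> (mulv m V y) = ip n (mulv m V x) (mulv m V y) - ip n (compl_proj n m W (mulv m V x)) (mulv m V y)"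
      by (rule ip_diff_left)
    finally show ?thesis by (simp add: ip_orthonormal[OF V] ip_compl_proj[OF W])
  qed
  have Sid: "vnorm m (\<lambda>a. ?S y a - y a) \<le> \<epsilon>\<^sup>2 * vnorm m y" for y
  proof -
    let ?z = "\<lambda>a. ?S y a - y a"
    \<comment> \<open>Since \<open>S\<close> is positive semidefinite,
      \<open>|z|^2 \<le> (z, (S + I) z)\<close>; for \<open>z = (S - I) y\<close> the right side is
      \<open>(z, (S^2 - I) y)\<close>.\<close>
    have "(vnorm m ?z)\<^sup>2 \<le> ip m ?z (?S ?z) + ip m ?z ?z"
      unfolding vnorm_sq_ip Sxy using pos[of ?z] by simp
    also have "ip m ?z (?S ?z) = ip m (?S ?z) (?S y) - ip m (?S ?z) y"
      unfolding Ssym[of ?z ?z] by (rule ip_diff_right)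
    also have "ip m (?S ?z) y = ip m ?z (?S y)" by (rule Ssym[symmetric])
    also have "ip m ?z ?z = ip m ?z (?S y) - ip m ?z y" by (rule ip_diff_right)
    also have "ip m (?S ?z) (?S y) - ip m ?z (?S y) + (ip m ?z (?S y) - ip m ?z y)
        = - ip n (compl_proj n m W (mulv m V ?z)) (compl_proj n m W (mulv m V y))"
      unfolding SS by simp
    also have "\<dots> \<le> vnorm n (compl_proj n m W (mulv m V ?z)) * vnorm n (compl_proj n m W (mulv m V y))"
      using ip_le_vnorm[of n "compl_proj n m W (mulv m V ?z)" "compl_proj n m W (mulv m V y)"] by linarith
    also have "\<dots> \<le> (\<epsilon> * vnorm m ?z) * (\<epsilon> * vnorm m y)"
      by (intro mult_mono proj mult_nonneg_nonneg e vnorm_nonneg)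
    finally have "vnorm m ?z * vnorm m ?z \<le> vnorm m ?z * (\<epsilon>\<^sup>2 * vnorm m y)"
      by (simp add: power2_eq_square mult_ac)
    then show ?thesis by (rule mult_left_le_cancel[OF vnorm_nonneg]) (use e in auto)
  qed
  have "vnorm n (\<lambda>i. mulv m V y i - mulv m W (mulv m Q y) i) \<le> (\<epsilon> + \<epsilon>\<^sup>2) * vnorm m y" for y
  proof -
    let ?z = "\<lambda>a. ?S y a - y a"
    have "mulv m W (mulv m Q ?z) = mulv m W (\<lambda>a. mulv m G y a - mulv m Q y a)"
      by (rule mulv_cong) (simp add: mulv_diff QS)
    \<comment> \<open>\<open>V - W Q = (I - W W^T) V + W Q (S - I)\<close>, because
      \<open>W W^T V = W G = W Q S\<close>.\<close>
    then have "(\<lambda>i. mulv m V y i - mulv m W (mulv m Q y) i)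
        = (\<lambda>i. compl_proj n m W (mulv m V y) i + mulv m W (mulv m Q ?z) i)"
      by (simp add: compl_proj_def G mulv_diff)
    then have "vnorm n (\<lambda>i. mulv m V y i - mulv m W (mulv m Q y) i)
        \<le> vnorm n (compl_proj n m W (mulv m V y)) + vnorm n (mulv m W (mulv m Q ?z))"
      by (simp only: vnorm_triangle)
    also have "vnorm n (mulv m W (mulv m Q ?z)) = vnorm m ?z"
      unfolding vnorm_orthonormal[OF W] vnorm_orthonormal[OF QO] ..
    finally show ?thesis using proj[of y] Sid[of y] by (simp add: distrib_right)
  qed
  then show ?thesis using Q by blast
qed

section \<open>The Davis--Kahan bound\<close>

lemma sym_eigen_quadratic:
  assumes U: "orthonormal n n U" and ev: "\<forall>a<n. \<forall>j<n. (\<Sum>i<n. L j i * U i a) = lam a * U j a"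
  shows "ip n x (mulv n L x) = (\<Sum>a<n. lam a * (mulv n (mat_transp U) x a)\<^sup>2)"
proof -
  let ?c = "mulv n (mat_transp U) x"
  have x: "x i = mulv n U ?c i" if "i < n" for i using orthonormal_square_expand[OF U that] by simp
  have "mulv n L x j = mulv n U (\<lambda>a. lam a * ?c a) j" if j: "j < n" for j
  proof -
    have "mulv n L x = mulv n L (mulv n U ?c)" by (rule mulv_cong) (rule x)
    then have "mulv n L x j = mulv n L (mulv n U ?c) j" by (rule fun_cong)
    also have "\<dots> = (\<Sum>a<n. (\<Sum>i<n. L j i * U i a) * ?c a)"
      unfolding mulv_def[of n L] mulv_def[of n U] sum_distrib_left sum_distrib_right
      by (subst sum.swap) (simp add: mult_ac)
    also have "\<dots> = (\<Sum>a<n. U j a * (lam a * ?c a))"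
    proof (rule sum.cong[OF refl])
      fix a assume "a \<in> {..<n}"
      then have "(\<Sum>i<n. L j i * U i a) = lam a * U j a" using ev j by blast
      then show "(\<Sum>i<n. L j i * U i a) * ?c a = U j a * (lam a * ?c a)" by simp
    qed
    finally show ?thesis by (simp add: mulv_def[of n U])
  qed
  then have "ip n x (mulv n L x) = ip n x (mulv n U (\<lambda>a. lam a * ?c a))" by (intro ip_cong) auto
  also have "\<dots> = ip n ?c (\<lambda>a. lam a * ?c a)" by (rule ip_mulv_right)
  finally show ?thesis by (simp add: ip_def power2_eq_square mult_ac)
qed

lemma vnorm_eigen_coords:
  assumes U: "orthonormal n n U"
  shows "(vnorm n x)\<^sup>2 = (\<Sum>a<n. (mulv n (mat_transp U) x a)\<^sup>2)"
  using vnorm_orthonormal[OF orthonormal_square_transp[OF U], of x] unfolding vnorm_sq[symmetric] by simp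

lemma mulv_transp_eq_ip: "mulv n (mat_transp W) z a = ip n (\<lambda>i. W i a) z"
  by (simp add: mulv_def mat_transp_def ip_def)

lemma mulv_msub: "mulv n (\<lambda>i j. M i j - N i j) x = (\<lambda>i. mulv n M x i - mulv n N x i)"
  by (simp add: mulv_def left_diff_distrib sum_subtractf)

text \<open>
  The best constant \<open>M\<close> with \<open>\<parallel>P V y\<parallel> \<le> M \<parallel>y\<parallel>\<close> satisfies \<open>(\<beta> - s) M \<le> (a - s) M + \<epsilon>\<close>, where \<open>s\<close> and \<open>a\<close> are the
  smallest and the \<open>m\<close>-th eigenvalue of \<open>L\<close>. Unlike the column-wise argument this loses no factor \<open>sqrt m\<close>.
\<close>

lemma davis_kahan:
  assumes m: "0 < m" "m \<le> n"
    and U: "orthonormal n n U" and ev: "\<forall>a<n. \<forall>j<n. (\<Sum>i<n. L j i * U i a) = lam a * U j a"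
    and mono: "\<forall>a b. a \<le> b \<longrightarrow> b < n \<longrightarrow> lam a \<le> lam b"
    and V: "\<forall>j<n. \<forall>a<m. V j a = U j a"
    and W: "orthonormal n m W"
    and Wev: "\<And>a j. a < m \<Longrightarrow> j < n \<Longrightarrow> mulv n H (\<lambda>i. W i a) j = nu a * W j a"
    and Hsym: "\<And>i j. i < n \<Longrightarrow> j < n \<Longrightarrow> H i j = H j i"
    and nu: "\<And>a. a < m \<Longrightarrow> nu a \<le> \<alpha>"
    and gap: "\<And>z. (\<And>a. a < m \<Longrightarrow> mulv n (mat_transp W) z a = 0) \<Longrightarrow> \<beta> * (vnorm n z)\<^sup>2 \<le> ip n z (mulv n H z)"
    and E: "op_le n n (\<lambda>i j. L i j - H i j) \<epsilon>" and lt: "\<alpha> + \<epsilon> < \<beta>" and e0: "0 \<le> \<epsilon>"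
  shows "vnorm n (compl_proj n m W (mulv m V y)) \<le> \<epsilon> / (\<beta> - \<alpha> - \<epsilon>) * vnorm m y"
proof -
  let ?D = "\<lambda>i j. L i j - H i j"
  have LH: "mulv n L x = (\<lambda>i. mulv n H x i + mulv n ?D x i)" for x by (simp add: mulv_msub)
  have HW: "mulv n H (mulv m W y) j = mulv m W (\<lambda>a. nu a * y a) j" if j: "j < n" for j y
  proof -
    have "mulv n H (mulv m W y) j = (\<Sum>a<m. mulv n H (\<lambda>i. W i a) j * y a)"
      unfolding mulv_def sum_distrib_left sum_distrib_right
      by (subst sum.swap) (simp add: mult_ac)
    also have "\<dots> = (\<Sum>a<m. W j a * (nu a * y a))"
    proof (rule sum.cong[OF refl])
      fix a assume "a \<in> {..<m}"
      then have "mulv n H (\<lambda>i. W i a) j = nu a * W j a" using Wev j by blast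
      then show "mulv n H (\<lambda>i. W i a) j * y a = W j a * (nu a * y a)" by simp
    qed
    finally show ?thesis by (simp add: mulv_def[of m W])
  qed
  \<comment> \<open>Weyl's inequality by dimension count: \<open>m - 1\<close> linear conditions
    leave a nonzero vector in the range of \<open>W\<close> orthogonal to the first
    \<open>m - 1\<close> eigenvectors of \<open>L\<close>. Its Rayleigh quotients for
    \<open>L\<close> and \<open>H\<close> are then compared.\<close>
  have weyl: "lam (m - 1) \<le> \<alpha> + \<epsilon>"
  proof -
    let ?c = "\<lambda>e a. \<Sum>i<n. U i e * W i a"
    have "card {..<m - 1} < card {..<m}" using m by simp
    from homogeneous_system[OF _ _ this, of ?c] obtain y where
      y: "\<exists>a\<in>{..<m}. y a \<noteq> 0" "\<forall>e\<in>{..<m-1}. (\<Sum>a<m. ?c e a * y a) = 0" by auto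
    let ?x = "mulv m W y"
    have c0: "mulv n (mat_transp U) ?x e = 0" if "e < m - 1" for e
    proof -
      have "mulv n (mat_transp U) ?x e = (\<Sum>a<m. ?c e a * y a)"
        unfolding mulv_def mat_transp_def sum_distrib_left sum_distrib_right
        by (subst sum.swap) (simp add: mult_ac)
      then show ?thesis using y(2) that by simp
    qed
    have xn: "(vnorm n ?x)\<^sup>2 = (vnorm m y)\<^sup>2" by (simp add: vnorm_orthonormal[OF W])
    have pos: "0 < (vnorm m y)\<^sup>2"
      unfolding vnorm_sq using y(1) by (auto intro!: sum_pos2)
    have "lam (m - 1) * (vnorm n ?x)\<^sup>2 = (\<Sum>a<n. lam (m - 1) * (mulv n (mat_transp U) ?x a)\<^sup>2)"
      unfolding vnorm_eigen_coords[OF U] by (simp add: sum_distrib_left)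
    also have "\<dots> \<le> (\<Sum>a<n. lam a * (mulv n (mat_transp U) ?x a)\<^sup>2)"
    proof (rule sum_mono)
      fix a assume a: "a \<in> {..<n}"
      show "lam (m - 1) * (mulv n (mat_transp U) ?x a)\<^sup>2 \<le> lam a * (mulv n (mat_transp U) ?x a)\<^sup>2"
      proof (cases "a < m - 1")
        case True then show ?thesis using c0 by simp
      next
        case False
        then have "lam (m - 1) \<le> lam a" using mono a by auto
        then show ?thesis by (rule mult_right_mono) simp
      qed
    qed
    also have "\<dots> = ip n ?x (mulv n L ?x)" by (rule sym_eigen_quadratic[OF U ev, symmetric])
    also have "\<dots> = ip n ?x (mulv n H ?x) + ip n ?x (mulv n ?D ?x)"
      unfolding LH by (rule ip_add_right)
    also have "ip n ?x (mulv n H ?x) = ip n ?x (mulv m W (\<lambda>a. nu a * y a))"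
      by (rule ip_cong) (auto simp: HW)
    also have "\<dots> = (\<Sum>a<m. nu a * (y a)\<^sup>2)"
      unfolding ip_orthonormal[OF W] by (simp add: ip_def power2_eq_square mult_ac)
    also have "\<dots> \<le> (\<Sum>a<m. \<alpha> * (y a)\<^sup>2)" by (intro sum_mono mult_right_mono) (use nu in auto)
    also have "\<dots> = \<alpha> * (vnorm n ?x)\<^sup>2" unfolding xn unfolding vnorm_sq by (simp add: sum_distrib_left)
    also have "ip n ?x (mulv n ?D ?x) \<le> vnorm n ?x * (\<epsilon> * vnorm n ?x)"
      using ip_le_vnorm[of n ?x "mulv n ?D ?x"] E mult_left_mono[of "vnorm n (mulv n ?D ?x)" "\<epsilon> * vnorm n ?x" "vnorm n ?x"]
      by (auto simp: op_le_def)
    finally have "lam (m - 1) * (vnorm n ?x)\<^sup>2 \<le> (\<alpha> + \<epsilon>) * (vnorm n ?x)\<^sup>2"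
      by (simp add: power2_eq_square algebra_simps)
    then show ?thesis using pos xn by simp
  qed
  define s where "s = lam 0"
  define a where "a = lam (m - 1)"
  have sa: "s \<le> a" using mono m by (auto simp: s_def a_def)
  have ab: "a < \<beta>" using weyl lt by (simp add: a_def)
  let ?P = "compl_proj n m W"
  have Vorth: "orthonormal n m V"
    unfolding orthonormal_def
  proof (intro allI impI)
    fix x y assume "x < m" "y < m"
    then show "(\<Sum>i<n. V i x * V i y) = (if x = y then 1 else 0)"
      using U V m by (auto simp: orthonormal_def)
  qed
  have LV: "mulv n L (mulv m V y) j = mulv m V (\<lambda>a. lam a * y a) j" if j: "j < n" for j y
  proof -
    have "mulv n L (mulv m V y) j = (\<Sum>a<m. (\<Sum>i<n. L j i * V i a) * y a)"
      unfolding mulv_def sum_distrib_left sum_distrib_right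
      by (subst sum.swap) (simp add: mult_ac)
    also have "\<dots> = (\<Sum>a<m. V j a * (lam a * y a))"
    proof (rule sum.cong[OF refl])
      fix a assume a: "a \<in> {..<m}"
      have "(\<Sum>i<n. L j i * V i a) = (\<Sum>i<n. L j i * U i a)" by (rule sum.cong) (use V a in auto)
      also have "\<dots> = lam a * U j a" using ev a j m by simp
      also have "U j a = V j a" using V a j by simp
      finally show "(\<Sum>i<n. L j i * V i a) * y a = V j a * (lam a * y a)" by simp
    qed
    finally show ?thesis by (simp add: mulv_def[of m V])
  qed
  \<comment> \<open>The range of \<open>W\<close> is invariant under the symmetric matrix
    \<open>H\<close>, so \<open>H\<close> commutes with the projection.\<close>
  have HP: "mulv n H (?P z) j = ?P (mulv n H z) j" if j: "j < n" for j z
  proof -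
    have "mulv n (mat_transp W) (mulv n H z) a = nu a * mulv n (mat_transp W) z a" if a: "a < m" for a
    proof -
      have "mulv n (mat_transp W) (mulv n H z) a = ip n (\<lambda>i. W i a) (mulv n H z)"
        by (rule mulv_transp_eq_ip)
      also have "\<dots> = ip n (mulv n (mat_transp H) (\<lambda>i. W i a)) z" by (rule ip_mulv_right)
      also have "\<dots> = ip n (\<lambda>i. nu a * W i a) z"
      proof (rule ip_cong)
        fix i assume i: "i < n"
        have "mulv n (mat_transp H) (\<lambda>i. W i a) i = mulv n H (\<lambda>i. W i a) i"
          unfolding mulv_def mat_transp_def by (rule sum.cong) (use Hsym i in auto)
        then show "mulv n (mat_transp H) (\<lambda>i. W i a) i = nu a * W i a" using Wev[OF a i] by simp
      qed simp
      also have "\<dots> = nu a * ip n (\<lambda>i. W i a) z" by (rule ip_scale_left)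
      finally show ?thesis by (simp only: mulv_transp_eq_ip)
    qed
    then have "mulv m W (mulv n (mat_transp W) (mulv n H z)) = mulv m W (\<lambda>a. nu a * mulv n (mat_transp W) z a)"
      by (rule mulv_cong)
    then show ?thesis unfolding compl_proj_def mulv_diff by (simp add: HW[OF j])
  qed
  \<comment> \<open>The vector \<open>w = P V y\<close> satisfies
    \<open>(H - s) w = P V (\<Lambda> - s) y - P (L - H) V y\<close>, with \<open>\<Lambda>\<close>
    the diagonal of eigenvalues. Pairing with \<open>w\<close> uses the gap on the left; on the
    right \<open>M\<close> applies to \<open>(\<Lambda> - s) y\<close>, whose norm is at most
    \<open>(a - s) |y|\<close> since the shift makes all entries nonnegative.\<close>
  have step: "vnorm n (?P (mulv m V y)) \<le> ((a - s) * M + \<epsilon>) / (\<beta> - s) * vnorm m y"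
    if M: "0 \<le> M" "\<And>y. vnorm n (?P (mulv m V y)) \<le> M * vnorm m y" for M y
  proof -
    let ?v = "mulv m V y" and ?y' = "\<lambda>a. (lam a - s) * y a"
    let ?w = "?P ?v" and ?r = "?P (mulv n ?D ?v)"
    have y': "vnorm m ?y' \<le> (a - s) * vnorm m y"
    proof (rule power2_le_imp_le)
      have "(vnorm m ?y')\<^sup>2 \<le> (\<Sum>b<m. (a - s)\<^sup>2 * (y b)\<^sup>2)"
        unfolding vnorm_sq power_mult_distrib
      proof (intro sum_mono mult_right_mono power_mono)
        fix b assume "b \<in> {..<m}"
        then show "lam b - s \<le> a - s" "0 \<le> lam b - s" using mono m by (auto simp: a_def s_def)
      qed simp
      then show "(vnorm m ?y')\<^sup>2 \<le> ((a - s) * vnorm m y)\<^sup>2"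
        by (simp add: vnorm_sq power_mult_distrib sum_distrib_left)
    qed (use sa in simp)
    have eq: "mulv n H ?w j - s * ?w j = ?P (mulv m V ?y') j - ?r j" if j: "j < n" for j
    proof -
      have Pc: "?P z j = ?P z' j" if "\<And>i. i < n \<Longrightarrow> z i = z' i" for z z'
        using mulv_cong[of n z z' "mat_transp W"] that j by (simp add: compl_proj_def)
      have Plin: "?P (\<lambda>i. x i - c * x' i) j = ?P x j - c * ?P x' j" for x x' c
        unfolding compl_proj_def mulv_diff mulv_scale by (simp add: algebra_simps)
      have "mulv n H ?w j - s * ?w j = ?P (\<lambda>i. mulv n H ?v i - s * ?v i) j"
        unfolding HP[OF j] Plin ..
      also have "\<dots> = ?P (\<lambda>i. mulv m V ?y' i - 1 * mulv n ?D ?v i) j"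
      proof (rule Pc)
        fix i assume i: "i < n"
        have "mulv m V ?y' i = mulv m V (\<lambda>a. lam a * y a) i - s * ?v i"
          unfolding left_diff_distrib mulv_diff mulv_scale ..
        then show "mulv n H ?v i - s * ?v i = mulv m V ?y' i - 1 * mulv n ?D ?v i"
          using LV[OF i, of y] fun_cong[OF LH[of ?v], of i] by simp
      qed
      finally show ?thesis unfolding Plin by simp
    qed
    have "\<beta> * (vnorm n ?w)\<^sup>2 \<le> ip n ?w (mulv n H ?w)"
      by (rule gap) (rule compl_proj_orth[OF W])
    then have "(\<beta> - s) * (vnorm n ?w)\<^sup>2 \<le> ip n ?w (mulv n H ?w) - s * ip n ?w ?w"
      by (simp add: left_diff_distrib vnorm_sq_ip)
    also have "\<dots> = ip n ?w (\<lambda>j. mulv n H ?w j - s * ?w j)"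
      by (simp add: ip_diff_right ip_scale_right)
    also have "\<dots> = ip n ?w (\<lambda>j. ?P (mulv m V ?y') j - ?r j)" by (rule ip_cong) (auto simp: eq)
    also have "\<dots> \<le> vnorm n ?w * vnorm n (\<lambda>j. ?P (mulv m V ?y') j - ?r j)"
      using ip_le_vnorm abs_le_D1 by blast
    also have "\<dots> \<le> vnorm n ?w * (((a - s) * M + \<epsilon>) * vnorm m y)"
    proof (rule mult_left_mono)
      have "vnorm n (\<lambda>j. ?P (mulv m V ?y') j - ?r j) \<le> vnorm n (?P (mulv m V ?y')) + vnorm n ?r"
        by (rule vnorm_diff)
      also have "vnorm n (?P (mulv m V ?y')) \<le> M * ((a - s) * vnorm m y)"
        by (rule order_trans[OF M(2) mult_left_mono[OF y' M(1)]])
      also have "vnorm n ?r \<le> \<epsilon> * vnorm m y"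
      proof -
        have "vnorm n ?r \<le> vnorm n (mulv n ?D ?v)" by (rule vnorm_compl_proj[OF W])
        also have "\<dots> \<le> \<epsilon> * vnorm n ?v" using E by (simp add: op_le_def)
        finally show ?thesis by (simp add: vnorm_orthonormal[OF Vorth])
      qed
      finally show "vnorm n (\<lambda>j. ?P (mulv m V ?y') j - ?r j) \<le> ((a - s) * M + \<epsilon>) * vnorm m y"
        by (simp add: algebra_simps)
    qed simp
    finally have le: "vnorm n ?w * ((\<beta> - s) * vnorm n ?w) \<le> vnorm n ?w * (((a - s) * M + \<epsilon>) * vnorm m y)"
      by (simp add: power2_eq_square mult_ac)
    have "0 \<le> ((a - s) * M + \<epsilon>) * vnorm m y" using sa M e0 by simp
    then have "(\<beta> - s) * vnorm n ?w \<le> ((a - s) * M + \<epsilon>) * vnorm m y"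
      using mult_left_le_cancel[OF vnorm_nonneg le] by simp
    then show ?thesis using sa ab by (simp add: field_simps)
  qed
  \<comment> \<open>The admissible constants. Their infimum is itself admissible, and
    \<open>step\<close> maps admissible constants to admissible ones; this gives the fixed-point
    inequality for \<open>M\<close>.\<close>
  let ?I = "{M. 0 \<le> M \<and> (\<forall>y. vnorm n (?P (mulv m V y)) \<le> M * vnorm m y)}"
  have one: "1 \<in> ?I"
  proof -
    have "vnorm n (?P (mulv m V y)) \<le> 1 * vnorm m y" for y
      using vnorm_compl_proj[OF W, of "mulv m V y"] by (simp add: vnorm_orthonormal[OF Vorth])
    then show ?thesis by simp
  qed
  then have ne: "?I \<noteq> {}" by blast
  have bdd: "bdd_below ?I" by (rule bdd_belowI[of _ 0]) auto
  define M where "M = Inf ?I"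
  have M0: "0 \<le> M" unfolding M_def by (rule cInf_greatest[OF ne]) simp
  have MP: "vnorm n (?P (mulv m V y)) \<le> M * vnorm m y" for y
  proof (cases "vnorm m y = 0")
    case True
    then have "vnorm n (?P (mulv m V y)) \<le> 0"
      using vnorm_compl_proj[OF W, of "mulv m V y"] by (simp add: vnorm_orthonormal[OF Vorth])
    then show ?thesis using True by simp
  next
    case False
    then have vp: "0 < vnorm m y" using vnorm_nonneg[of m y] by linarith
    have "vnorm n (?P (mulv m V y)) / vnorm m y \<le> M"
      unfolding M_def by (rule cInf_greatest[OF ne]) (use vp in \<open>simp add: divide_le_eq\<close>)
    then show ?thesis using vp by (simp add: field_simps)
  qed
  have "((a - s) * M + \<epsilon>) / (\<beta> - s) \<in> ?I"
    using step[OF M0 MP] sa ab M0 e0 by simp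
  then have "M \<le> ((a - s) * M + \<epsilon>) / (\<beta> - s)" unfolding M_def by (rule cInf_lower[OF _ bdd])
  then have "M * (\<beta> - a) \<le> \<epsilon>" using sa ab by (simp add: field_simps)
  moreover have "M * (\<beta> - \<alpha> - \<epsilon>) \<le> M * (\<beta> - a)" using weyl M0 by (intro mult_left_mono) (auto simp: a_def)
  ultimately have "M \<le> \<epsilon> / (\<beta> - \<alpha> - \<epsilon>)" using lt by (simp add: field_simps)
  then have "M * vnorm m y \<le> \<epsilon> / (\<beta> - \<alpha> - \<epsilon>) * vnorm m y" by (rule mult_right_mono) simp
  then show ?thesis using MP[of y] by linarith
qed

section \<open>Spectrum of the population matrix\<close>

locale clusters =
  fixes n k :: nat and cl :: "nat \<Rightarrow> nat"
  assumes vp: "valid_partition n k cl" and k2: "2 \<le> k"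
    and rho_large: "sqrt (rho n k cl) > 1 - 1 / (4 * real k * (2 + sqrt (real k)))"
begin

abbreviation s :: "nat \<Rightarrow> real" where "s \<equiv> csize n cl"

lemma cl_less: "j < n \<Longrightarrow> cl j < k"
  using vp by (simp add: valid_partition_def)

lemma finite_cluster: "finite (cluster n cl i)"
  by (simp add: cluster_def)

lemma s_pos: "i < k \<Longrightarrow> 0 < s i"
  using vp finite_cluster[of i] by (auto simp: csize_def valid_partition_def cluster_def card_gt_0_iff)

lemma sum_cluster:
  fixes f :: "nat \<Rightarrow> nat \<Rightarrow> real"
  shows "(\<Sum>j<n. f (cl j) j) = (\<Sum>i<k. \<Sum>j\<in>cluster n cl i. f i j)"
proof -
  have "(\<Sum>i<k. \<Sum>j\<in>{j \<in> {..<n}. cl j = i}. f (cl j) j) = (\<Sum>j<n. f (cl j) j)"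
    by (rule sum.group) (use cl_less in auto)
  moreover have "(\<Sum>j\<in>{j \<in> {..<n}. cl j = i}. f (cl j) j) = (\<Sum>j\<in>cluster n cl i. f i j)" for i
    by (rule sum.cong) (auto simp: cluster_def)
  ultimately show ?thesis by simp
qed

lemma sum_s: "(\<Sum>i<k. s i) = real n"
  using sum_cluster[of "\<lambda>_ _. 1"] by (simp add: csize_def)

definition sM :: real where "sM = Max (s ` {..<k})"
definition sm :: real where "sm = Min (s ` {..<k})"

lemma s_le: "i < k \<Longrightarrow> s i \<le> sM"
  unfolding sM_def by (rule Max_ge) auto

lemma s_ge: "i < k \<Longrightarrow> sm \<le> s i"
  unfolding sm_def by (rule Min_le) auto

lemma s_attained: "\<exists>i<k. s i = sM" "\<exists>i<k. s i = sm"
proof -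
  have ne: "s ` {..<k} \<noteq> {}" using k2 by (auto simp: lessThan_empty_iff)
  show "\<exists>i<k. s i = sM" using Max_in[OF _ ne] unfolding sM_def[symmetric] by auto
  show "\<exists>i<k. s i = sm" using Min_in[OF _ ne] unfolding sm_def[symmetric] by auto
qed

lemma sm_pos: "0 < sm"
proof -
  obtain i where "i < k" "s i = sm" using s_attained(2) by blast
  then show ?thesis using s_pos[of i] by simp
qed

lemma sm_le_sM: "sm \<le> sM"
proof -
  obtain i where "i < k" "s i = sm" using s_attained(2) by blast
  then show ?thesis using s_le[of i] by simp
qed

text \<open>For \<open>k \<ge> 2\<close> the hypothesis implies \<open>sqrt rho > 23 / 24\<close>,
  and the square of \<open>23 / 24\<close> exceeds \<open>9 / 10\<close>. Later size comparisons use
  only this ratio.\<close>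

lemma sm_ge: "9 / 10 * sM \<le> sm"
proof -
  have sMp: "0 < sM" using sm_pos sm_le_sM by simp
  have rh: "rho n k cl = sm / sM" by (simp add: rho_def sm_def sM_def)
  have "4 * 2 * (2 + 1) \<le> 4 * real k * (2 + sqrt (real k))"
    using k2 by (intro mult_mono) auto
  then have "1 / (4 * real k * (2 + sqrt (real k))) \<le> 1 / 24" by (intro divide_left_mono) auto
  then have "23 / 24 \<le> sqrt (sm / sM)" using rho_large unfolding rh by linarith
  then have "(23 / 24)\<^sup>2 \<le> (sqrt (sm / sM))\<^sup>2" by (intro power_mono) auto
  then have "(23 / 24)\<^sup>2 \<le> sm / sM" using sm_pos sMp by simp
  moreover have "(9 / 10 :: real) \<le> (23 / 24)\<^sup>2" by (simp add: power2_eq_square)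
  ultimately show ?thesis using sMp by (simp add: field_simps)
qed

lemma n_le_k_sM: "real n \<le> real k * sM"
  using sum_bounded_above[of "{..<k}" s sM] s_le sum_s by simp

lemma sM_sm_le_n: "sM + sm \<le> real n"
proof -
  obtain i where i: "i < k" "s i = sM" using s_attained by blast
  obtain i' where i': "i' < k" "i' \<noteq> i" 
    using k2 that[of 0] that[of 1] by (cases "i = 0") auto
  have "sM + sm \<le> s i + s i'" using i s_ge[OF i'(1)] by simp
  also have "\<dots> = (\<Sum>x\<in>{i, i'}. s x)" using i' by simp
  also have "\<dots> \<le> (\<Sum>x<k. s x)" using i i' s_pos by (intro sum_mono2) (auto intro: less_imp_le)
  finally show ?thesis by (simp add: sum_s)
qed

lemma n_pos: "0 < n"
  using sM_sm_le_n sm_pos sm_le_sM by (cases n) auto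

text \<open>\<open>2 * sm\<close> bounds the first \<open>k - 1\<close> eigenvalues of the block
  matrix from below and \<open>2 * sM - n\<close> bounds the last one from above; the 0 stands for
  vectors orthogonal to the range of \<open>Th\<close>. If the maximum is 0, then
  \<open>2 sm \<ge> sM \<ge> n / k\<close>; otherwise \<open>n \<ge> sM + sm\<close> leaves at least
  \<open>3 sm - sM \<ge> sM\<close>.\<close>

lemma gap_sizes: "real n / real k \<le> 2 * sm - max 0 (2 * sM - real n)"
proof -
  have "real n / real k \<le> sM" using n_le_k_sM k2 by (simp add: field_simps)
  then show ?thesis using sm_ge sM_sm_le_n sm_pos sm_le_sM by (auto simp: max_def)
qed

abbreviation Th :: rmat where "Th \<equiv> Theta n k cl"

lemma Theta_mulv: "j < n \<Longrightarrow> mulv k Th u j = u (cl j) / sqrt (s (cl j))"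
proof -
  assume j: "j < n"
  have "mulv k Th u j = (\<Sum>i<k. if i = cl j then u (cl j) / sqrt (s (cl j)) else 0)"
    unfolding mulv_def by (rule sum.cong) (use j in \<open>auto simp: Theta_def\<close>)
  then show ?thesis using cl_less[OF j] by simp
qed

lemma Theta_orthonormal: "orthonormal n k Th"
  unfolding orthonormal_def
proof (intro allI impI)
  fix a b assume ab: "a < k" "b < k"
  have "(\<Sum>j<n. Th j a * Th j b) = (\<Sum>j<n. (\<lambda>i j. if i = a \<and> a = b then 1 / s a else 0) (cl j) j)"
    by (rule sum.cong) (use ab s_pos in \<open>auto simp: Theta_def less_imp_le\<close>)
  also have "\<dots> = (\<Sum>i<k. \<Sum>j\<in>cluster n cl i. if i = a \<and> a = b then 1 / s a else 0)"
    by (rule sum_cluster)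
  also have "\<dots> = (\<Sum>i<k. if i = a then (if a = b then 1 else 0) else 0)"
    by (rule sum.cong) (use s_pos[OF ab(1)] in \<open>auto simp: csize_def\<close>)
  finally show "(\<Sum>j<n. Th j a * Th j b) = (if a = b then 1 else 0)" using ab by simp
qed

text \<open>\<open>C = (1 + g) I - g M\<close> for the matrix \<open>C\<close> of the paper; on blocks \<open>M\<close> is the sign pattern of \<open>E A\<close>.\<close>

definition Mm :: rmat where
  "Mm = (\<lambda>i i'. (if i = i' then 2 * s i else 0) - sqrt (s i) * sqrt (s i'))"

definition vv :: "nat \<Rightarrow> real" where "vv i = sqrt (s i)"

lemma Mm_mulv: "i < k \<Longrightarrow> mulv k Mm u i = 2 * s i * u i - vv i * ip k vv u"
proof -
  assume i: "i < k"
  have "mulv k Mm u i = (\<Sum>j<k. (if i = j then 2 * s i * u i else 0) - vv i * (vv j * u j))"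
    unfolding mulv_def by (rule sum.cong) (auto simp: Mm_def vv_def left_diff_distrib)
  also have "\<dots> = (\<Sum>j<k. if i = j then 2 * s i * u i else 0) - vv i * ip k vv u"
    by (simp only: sum_subtractf sum_distrib_left ip_def)
  finally show ?thesis using i by simp
qed

lemma Mm_form: "ip k u (mulv k Mm u) = 2 * (\<Sum>i<k. s i * (u i)\<^sup>2) - (ip k vv u)\<^sup>2"
proof -
  have "ip k u (mulv k Mm u) = (\<Sum>i<k. 2 * (s i * (u i)\<^sup>2) - (vv i * u i) * ip k vv u)"
    unfolding ip_def[of k u] by (rule sum.cong) (auto simp: Mm_mulv power2_eq_square algebra_simps)
  also have "\<dots> = 2 * (\<Sum>i<k. s i * (u i)\<^sup>2) - (\<Sum>i<k. vv i * u i) * ip k vv u"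
    by (simp only: sum_subtractf sum_distrib_left sum_distrib_right)
  finally show ?thesis by (simp add: power2_eq_square ip_def)
qed

lemma vv_norm: "(vnorm k vv)\<^sup>2 = real n"
proof -
  have "(vnorm k vv)\<^sup>2 = (\<Sum>i<k. s i)"
    unfolding vnorm_sq by (rule sum.cong) (use s_pos in \<open>auto simp: vv_def less_imp_le\<close>)
  then show ?thesis by (simp add: sum_s)
qed

end

locale population = clusters +
  fixes p \<eta> :: real and R :: rmat
  assumes p0: "0 < p" and eta: "\<eta> < 1 / 2" and n2: "2 \<le> n"
    and R: "bottom_eigvecs k (k - 1) (Cbar n k cl p \<eta>) R"
begin

definition g :: real where "g = (1 - 2 * \<eta>) / (real n - 1)"

lemma g_pos: "0 < g"
  using eta n2 by (simp add: g_def)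

lemma Cbar_eq: "i < k \<Longrightarrow> j < k \<Longrightarrow> Cbar n k cl p \<eta> i j = (if i = j then 1 + g else 0) - g * Mm i j"
proof -
  assume ij: "i < k" "j < k"
  have pd: "p / dbar n p = 1 / (real n - 1)" using p0 by (simp add: dbar_def)
  have *: "x * p / dbar n p * (1 - 2 * \<eta>) = g * x" for x
    using arg_cong[OF pd, of "\<lambda>z. x * z * (1 - 2 * \<eta>)"] by (simp add: g_def mult_ac)
  show ?thesis
  proof (cases "i = j")
    case True
    have h1: "p / dbar n p * (1 - 2 * \<eta>) = g" using *[of 1] by simp
    have "Cbar n k cl p \<eta> i j = 1 + g - g * s j"
      using True ij unfolding Cbar_def by (simp only: h1 *) simp
    moreover have "Mm i j = s j" using True s_pos[OF ij(2)] by (simp add: Mm_def)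
    ultimately show ?thesis using True by simp
  next
    case False
    then show ?thesis using ij *[of "- sqrt (s i * s j)"] by (simp add: Cbar_def Mm_def real_sqrt_mult)
  qed
qed

text \<open>The bottom of the spectrum of \<open>Cbar\<close> is the top of that of
  \<open>Mm\<close>, hence the decreasing order of \<open>mu\<close>. The whole basis is kept
  because the one column missing in \<open>R\<close> governs the distances between the rows of
  \<open>R\<close>.\<close>

definition spec :: "rmat \<Rightarrow> (nat \<Rightarrow> real) \<Rightarrow> bool" where
  "spec U mu \<longleftrightarrow> orthonormal k k U \<and> (\<forall>a<k. \<forall>j<k. (\<Sum>i<k. Mm j i * U i a) = mu a * U j a) \<and>
     (\<forall>a b. a \<le> b \<longrightarrow> b < k \<longrightarrow> mu b \<le> mu a) \<and> (\<forall>j<k. \<forall>a<k - 1. R j a = U j a)"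

lemma spec_exists: "\<exists>U mu. spec U mu"
proof -
  obtain U lam where U: "\<forall>a<k. \<forall>b<k. (\<Sum>j<k. U j a * U j b) = (if a = b then 1 else 0)"
    and ev: "\<forall>a<k. \<forall>j<k. (\<Sum>i<k. Cbar n k cl p \<eta> j i * U i a) = lam a * U j a"
    and mono: "\<forall>a b. a \<le> b \<longrightarrow> b < k \<longrightarrow> lam a \<le> lam b" and RU: "\<forall>j<k. \<forall>a<k - 1. R j a = U j a"
    using R unfolding bottom_eigvecs_def by blast
  define mu where "mu = (\<lambda>a. (1 + g - lam a) / g)"
  have "(\<Sum>i<k. Mm j i * U i a) = mu a * U j a" if a: "a < k" and j: "j < k" for a j
  proof -
    have "lam a * U j a = (\<Sum>i<k. ((if j = i then 1 + g else 0) - g * Mm j i) * U i a)"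
      using ev a j by (simp add: Cbar_eq)
    also have "\<dots> = (\<Sum>i<k. (if j = i then (1 + g) * U i a else 0) - g * (Mm j i * U i a))"
      by (rule sum.cong) (auto simp: algebra_simps)
    also have "\<dots> = (1 + g) * U j a - g * (\<Sum>i<k. Mm j i * U i a)"
      using j by (simp add: sum_subtractf sum_distrib_left)
    finally show ?thesis using g_pos by (simp add: mu_def field_simps)
  qed
  moreover have "mu b \<le> mu a" if "a \<le> b" "b < k" for a b
    using mono that g_pos by (simp add: mu_def divide_right_mono)
  ultimately have "spec U mu" using U RU by (auto simp: spec_def orthonormal_def)
  then show ?thesis by blast
qed

section \<open>Eigenvalues of the block matrix and separation of the centres\<close>

context
  fixes U :: rmat and mu :: "nat \<Rightarrow> real"
  assumes spec: "spec U mu"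
begin

lemma U_orth: "orthonormal k k U" using spec by (simp add: spec_def)
lemma U_ev: "\<forall>a<k. \<forall>j<k. (\<Sum>i<k. Mm j i * U i a) = mu a * U j a" using spec by (simp add: spec_def)
lemma mu_mono: "a \<le> b \<Longrightarrow> b < k \<Longrightarrow> mu b \<le> mu a" using spec by (simp add: spec_def)
lemma R_U: "j < k \<Longrightarrow> a < k - 1 \<Longrightarrow> R j a = U j a" using spec by (simp add: spec_def)

lemma M_form_coords: "ip k x (mulv k Mm x) = (\<Sum>a<k. mu a * (mulv k (mat_transp U) x a)\<^sup>2)"
  by (rule sym_eigen_quadratic[OF U_orth U_ev])

text \<open>The Rayleigh quotient at \<open>vv\<close>: the value of the form is
  \<open>2 \<Sum> n_i^2 - n^2\<close>, at most \<open>(2 sM - n) n\<close>.\<close>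

lemma mu_last_le: "mu (k - 1) \<le> 2 * sM - real n"
proof -
  have "mu (k - 1) * (vnorm k vv)\<^sup>2 = (\<Sum>a<k. mu (k - 1) * (mulv k (mat_transp U) vv a)\<^sup>2)"
    unfolding vnorm_eigen_coords[OF U_orth] by (simp add: sum_distrib_left)
  also have "\<dots> \<le> (\<Sum>a<k. mu a * (mulv k (mat_transp U) vv a)\<^sup>2)"
    by (intro sum_mono mult_right_mono mu_mono) auto
  also have "\<dots> = ip k vv (mulv k Mm vv)" by (rule M_form_coords[symmetric])
  also have "\<dots> = 2 * (\<Sum>i<k. s i * (vv i)\<^sup>2) - (real n)\<^sup>2"
    unfolding Mm_form vnorm_sq_ip[symmetric] vv_norm ..
  also have "(\<Sum>i<k. s i * (vv i)\<^sup>2) \<le> (\<Sum>i<k. sM * (vv i)\<^sup>2)"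
    by (intro sum_mono mult_right_mono) (auto simp: s_le)
  also have "\<dots> = sM * real n" unfolding vv_norm[symmetric] vnorm_sq by (simp add: sum_distrib_left)
  finally have "mu (k - 1) * real n \<le> (2 * sM - real n) * real n"
    unfolding vv_norm by (simp add: power2_eq_square algebra_simps)
  then show ?thesis using n_pos by simp
qed

text \<open>Interlacing for a rank-one perturbation. The span of eigenvectors \<open>k - 2\<close>
  and \<open>k - 1\<close> contains a nonzero \<open>x\<close> orthogonal to \<open>vv\<close>;
  there the form is \<open>2 \<Sum> n_i x_i^2\<close>, yet it is at most
  \<open>mu (k - 2) |x|^2\<close>.\<close>

lemma mu_ge:
  assumes "a < k - 1"
  shows "2 * sm \<le> mu a"
proof -
  have "card {0::nat} < card {k - 2, k - 1}" using k2 by (auto simp: card_insert_if)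
  from homogeneous_system[OF _ _ this, of "\<lambda>_ a. ip k vv (\<lambda>i. U i a)"] obtain y where
    y: "y (k - 2) \<noteq> 0 \<or> y (k - 1) \<noteq> 0" and
    "(\<Sum>a\<in>{k - 2, k - 1}. ip k vv (\<lambda>i. U i a) * y a) = 0" by auto
  then have yv: "ip k vv (\<lambda>i. U i (k - 2)) * y (k - 2) + ip k vv (\<lambda>i. U i (k - 1)) * y (k - 1) = 0"
    using k2 by simp
  define x where "x = (\<lambda>i. y (k - 2) * U i (k - 2) + y (k - 1) * U i (k - 1))"
  have xv: "ip k vv x = 0" unfolding x_def ip_add_right ip_scale_right using yv by (simp add: mult.commute)
  define c where "c = (\<lambda>a. if a = k - 2 then y (k - 2) else if a = k - 1 then y (k - 1) else 0)"
  have xc: "x = mulv k U c"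
  proof
    fix i
    have "mulv k U c i = (\<Sum>a\<in>{k - 2, k - 1}. U i a * c a)"
      unfolding mulv_def by (rule sum.mono_neutral_right) (use k2 in \<open>auto simp: c_def\<close>)
    also have "\<dots> = x i" using k2 by (simp add: c_def x_def mult.commute)
    finally show "x i = mulv k U c i" ..
  qed
  have coord: "mulv k (mat_transp U) x a = c a" if "a < k" for a
    unfolding xc by (rule orthonormal_mulv[OF U_orth that])
  have "2 * sm * (vnorm k x)\<^sup>2 = 2 * (\<Sum>i<k. sm * (x i)\<^sup>2)"
    unfolding vnorm_sq by (simp only: sum_distrib_left mult.assoc)
  also have "\<dots> \<le> 2 * (\<Sum>i<k. s i * (x i)\<^sup>2)"
    by (intro mult_left_mono sum_mono mult_right_mono) (auto simp: s_ge)
  also have "\<dots> = ip k x (mulv k Mm x)" by (simp add: Mm_form xv)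
  also have "\<dots> = (\<Sum>a<k. mu a * (c a)\<^sup>2)" unfolding M_form_coords by (rule sum.cong) (auto simp: coord)
  also have "\<dots> \<le> (\<Sum>a<k. mu (k - 2) * (c a)\<^sup>2)"
  proof (rule sum_mono)
    fix b assume b: "b \<in> {..<k}"
    show "mu b * (c b)\<^sup>2 \<le> mu (k - 2) * (c b)\<^sup>2"
    proof (cases "b < k - 2")
      case True then show ?thesis by (simp add: c_def)
    next
      case False
      then show ?thesis using b by (intro mult_right_mono mu_mono) auto
    qed
  qed
  also have "\<dots> = mu (k - 2) * (vnorm k x)\<^sup>2"
  proof -
    have "(vnorm k x)\<^sup>2 = (vnorm k c)\<^sup>2" unfolding xc vnorm_orthonormal[OF U_orth] ..
    then show ?thesis by (simp add: vnorm_sq[of k c] sum_distrib_left)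
  qed
  finally have le: "2 * sm * (vnorm k x)\<^sup>2 \<le> mu (k - 2) * (vnorm k x)\<^sup>2" .
  have "(vnorm k x)\<^sup>2 = (\<Sum>a<k. (c a)\<^sup>2)" unfolding xc vnorm_orthonormal[OF U_orth] by (rule vnorm_sq)
  also have "\<dots> > 0"
  proof -
    have "c (k - 2) = y (k - 2)" "c (k - 1) = y (k - 1)" using k2 by (auto simp: c_def)
    then have "c (k - 2) \<noteq> 0 \<or> c (k - 1) \<noteq> 0" using y by simp
    moreover have "k - 2 < k" "k - 1 < k" using k2 by auto
    ultimately obtain b where "b < k" "c b \<noteq> 0" by blast
    then show ?thesis by (intro sum_pos2[of _ b]) auto
  qed
  finally have "2 * sm \<le> mu (k - 2)" using le by simp
  also have "mu (k - 2) \<le> mu a" using assms k2 by (intro mu_mono) auto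
  finally show ?thesis .
qed

text \<open>The rows of the square matrix \<open>U\<close> are orthonormal as well; dropping its
  last column removes one product.\<close>

lemma row_products:
  assumes "i < k" "j < k"
  shows "(\<Sum>a<k - 1. R i a * R j a) = (if i = j then 1 else 0) - U i (k - 1) * U j (k - 1)"
proof -
  have "(\<Sum>a<k. U i a * U j a) = (if i = j then 1 else 0)"
    using orthonormal_square_transp[OF U_orth] assms by (simp add: orthonormal_def mat_transp_def)
  moreover have "(\<Sum>a<k. U i a * U j a) = (\<Sum>a<k - 1. U i a * U j a) + U i (k - 1) * U j (k - 1)"
    using k2 sum.lessThan_Suc[of "\<lambda>a. U i a * U j a" "k - 1"] by simp
  moreover have "(\<Sum>a<k - 1. U i a * U j a) = (\<Sum>a<k - 1. R i a * R j a)"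
    by (rule sum.cong) (use assms in \<open>auto simp: R_U\<close>)
  ultimately show ?thesis by linarith
qed

text \<open>
  The eigenvalue equation for \<open>w = U (k - 1)\<close> reads \<open>(2 n\<^sub>i - \<mu>) w\<^sub>i = v\<^sub>i \<langle>v, w\<rangle>\<close>, so \<open>w\<^sub>i / v\<^sub>i\<close> depends on \<open>i\<close> only through
  \<open>n\<^sub>i\<close>.
\<close>

lemma last_vec_diff:
  assumes "i < k" "j < k"
  shows "(U i (k - 1) / sqrt (s i) - U j (k - 1) / sqrt (s j))\<^sup>2 \<le> 1 / 20 / s i"
proof -
  define m where "m = mu (k - 1)"
  define w where "w = (\<lambda>i. U i (k - 1))"
  define \<sigma> where "\<sigma> = ip k vv w"
  \<comment> \<open>A lower bound for all denominators \<open>2 s i - m\<close>. With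
    \<open>sM \<le> 10 n / 19\<close> and \<open>sM - sm \<le> sM / 10\<close> the subtracted term
    is at most \<open>2 n / 19\<close>.\<close>
  define q where "q = real n - 2 * (sM - sm)"
  have sMp: "0 < sM" using sm_pos sm_le_sM by simp
  have n1: "19 / 10 * sM \<le> real n" using sM_sm_le_n sm_ge by linarith
  have "2 * (sM - sm) \<le> 1 / 5 * sM" using sm_ge by simp
  moreover have "1 / 5 * sM \<le> 2 / 19 * real n" using n1 by simp
  ultimately have q1: "17 / 19 * real n \<le> q" unfolding q_def by simp
  have q2: "0 < q" using q1 n_pos by (simp add: less_le_trans[of 0 "17 / 19 * real n" q])
  note q = q1 q2
  have den: "q \<le> 2 * s i - m" if "i < k" for i
    using mu_last_le s_ge[OF that] by (simp add: q_def m_def)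
  have w: "w i / sqrt (s i) = \<sigma> / (2 * s i - m)" if i: "i < k" for i
  proof -
    have "mulv k Mm w i = m * w i" using U_ev i k2 by (simp add: mulv_def w_def m_def)
    then have e: "(2 * s i - m) * w i = vv i * \<sigma>" using Mm_mulv[OF i, of w] by (simp add: \<sigma>_def algebra_simps)
    have d: "0 < 2 * s i - m" using den[OF i] q by linarith
    have v: "0 < vv i" using s_pos[OF i] by (simp add: vv_def)
    show ?thesis using e d v unfolding vv_def[symmetric] by (simp add: field_simps)
  qed
  have "(vnorm k w)\<^sup>2 = 1"
    unfolding vnorm_sq w_def using U_orth k2 by (simp add: orthonormal_def power2_eq_square)
  then have w1: "vnorm k w = 1" by (simp add: power2_eq_1_iff) (use vnorm_nonneg[of k w] in linarith)
  have "\<bar>\<sigma>\<bar> \<le> vnorm k vv" using ip_le_vnorm[of k vv w] w1 by (simp add: \<sigma>_def)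
  then have "\<bar>\<sigma>\<bar>\<^sup>2 \<le> (vnorm k vv)\<^sup>2" by (intro power_mono) auto
  then have sig: "\<sigma>\<^sup>2 \<le> real n" using vv_norm by simp
  let ?a = "2 * s i - m" and ?b = "2 * s j - m"
  have ab: "q \<le> ?a" "q \<le> ?b" "0 < ?a" "0 < ?b" using den[OF assms(1)] den[OF assms(2)] q2 by simp_all
  have "w i / sqrt (s i) - w j / sqrt (s j) = \<sigma> * (2 * (s j - s i)) / (?a * ?b)"
    unfolding w[OF assms(1)] w[OF assms(2)] using ab by (simp add: field_simps)
  then have "(w i / sqrt (s i) - w j / sqrt (s j))\<^sup>2 = \<sigma>\<^sup>2 * (2 * (s j - s i))\<^sup>2 / (?a * ?b)\<^sup>2"
    by (simp add: power_divide power_mult_distrib)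
  also have "\<dots> \<le> real n * (sM / 5)\<^sup>2 / (q * q)\<^sup>2"
  proof (rule frac_le)
    have "s j - s i \<le> sM / 10" using s_le[OF assms(2)] s_ge[OF assms(1)] sm_ge by simp
    moreover have "s i - s j \<le> sM / 10" using s_le[OF assms(1)] s_ge[OF assms(2)] sm_ge by simp
    ultimately have "\<bar>s j - s i\<bar> \<le> sM / 10" by (simp add: abs_if)
    then have "\<bar>2 * (s j - s i)\<bar> \<le> sM / 5" by (simp only: abs_mult) simp
    then have "\<bar>2 * (s j - s i)\<bar>\<^sup>2 \<le> (sM / 5)\<^sup>2" by (intro power_mono) auto
    then show "\<sigma>\<^sup>2 * (2 * (s j - s i))\<^sup>2 \<le> real n * (sM / 5)\<^sup>2" using sig by (intro mult_mono) auto
    show "(q * q)\<^sup>2 \<le> (?a * ?b)\<^sup>2" using ab q by (intro power_mono mult_mono) auto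
  qed (use q in auto)
  \<comment> \<open>By \<open>sM \<le> 10 n / 19\<close> and \<open>q \<ge> 17 n / 19\<close>
    everything scales with \<open>n^4\<close>, and the numerical inequality
    \<open>(20 / 25) (10 / 19)^3 \<le> (17 / 19)^4\<close> remains.\<close>
  also have "\<dots> \<le> 1 / 20 / sM"
  proof -
    have np: "0 < real n" using n_pos by simp
    have sN: "sM \<le> 10 / 19 * real n" using n1 by simp
    have "sM ^ 3 \<le> (10 / 19 * real n) ^ 3" using sN sMp by (intro power_mono) auto
    then have "20 * (real n * (sM ^ 3 / 25)) \<le> 20 * (real n * ((10 / 19 * real n) ^ 3 / 25))"
      by (intro mult_left_mono divide_right_mono) auto
    moreover have "20 * (real n * (sM / 5)\<^sup>2 * sM) = 20 * (real n * (sM ^ 3 / 25))"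
      by (simp add: power2_eq_square power3_eq_cube)
    ultimately have 1: "20 * (real n * (sM / 5)\<^sup>2 * sM) \<le> 20 * (real n * ((10 / 19 * real n) ^ 3 / 25))"
      by (simp only:)
    have "(17 / 19 * real n) ^ 4 \<le> q ^ 4" using q np by (intro power_mono) auto
    moreover have "20 * (real n * ((10 / 19 * real n) ^ 3 / 25)) \<le> (17 / 19 * real n) ^ 4"
    proof -
      have "20 * (real n * ((10 / 19 * real n) ^ 3 / 25)) = (20 / 25 * (10 / 19) ^ 3) * real n ^ 4"
        by (simp add: power_mult_distrib power3_eq_cube power4_eq_xxxx)
      also have "\<dots> \<le> (17 / 19) ^ 4 * real n ^ 4"
        by (rule mult_right_mono) (simp_all add: power3_eq_cube power4_eq_xxxx)
      finally show ?thesis by (simp only: power_mult_distrib)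
    qed
    ultimately have "20 * (real n * (sM / 5)\<^sup>2 * sM) \<le> q ^ 4" using 1 by (meson order_trans)
    then have "20 * (real n * (sM / 5)\<^sup>2 * sM) \<le> (q * q)\<^sup>2"
      by (simp only: power2_eq_square power4_eq_xxxx mult.assoc)
    moreover have "0 < (q * q)\<^sup>2" using q by simp
    ultimately show ?thesis using sMp by (simp add: field_simps)
  qed
  also have "\<dots> \<le> 1 / 20 / s i" using s_le[OF assms(1)] s_pos[OF assms(1)] by (intro divide_left_mono) auto
  finally show ?thesis by (simp add: w_def)
qed

text \<open>Expanding the square by \<open>row_products\<close> gives
  \<open>1 / s i + 1 / s j\<close> minus the square bounded in \<open>last_vec_diff\<close>. As
  \<open>1 / s j \<ge> (9 / 10) / s i\<close>, the constant is
  \<open>1 + 9/10 - 1/20 = 37/20\<close>.\<close>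

lemma centre_separation_aux:
  assumes "i < k" "j < k" "i \<noteq> j"
  shows "37 / 20 / s i \<le> (\<Sum>a<k - 1. (R i a / sqrt (s i) - R j a / sqrt (s j))\<^sup>2)"
proof -
  have sp: "0 < s i" "0 < s j" using s_pos assms by auto
  let ?x = "1 / sqrt (s i)" and ?y = "1 / sqrt (s j)"
  have sq: "?x * ?x = 1 / s i" "?y * ?y = 1 / s j" using sp by auto
  have "(\<Sum>a<k - 1. (R i a / sqrt (s i) - R j a / sqrt (s j))\<^sup>2)
      = (\<Sum>a<k - 1. ?x * ?x * (R i a * R i a) - 2 * ?x * ?y * (R i a * R j a) + ?y * ?y * (R j a * R j a))"
    by (rule sum.cong) (auto simp: power2_eq_square algebra_simps)
  also have "\<dots> = ?x * ?x * (\<Sum>a<k - 1. R i a * R i a) - 2 * ?x * ?y * (\<Sum>a<k - 1. R i a * R j a)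
      + ?y * ?y * (\<Sum>a<k - 1. R j a * R j a)"
    by (simp only: sum.distrib sum_subtractf sum_distrib_left)
  also have "\<dots> = 1 / s i + 1 / s j - (U i (k - 1) / sqrt (s i) - U j (k - 1) / sqrt (s j))\<^sup>2"
  proof -
    define X where "X = ?x"
    define Y where "Y = ?y"
    have "U i (k - 1) / sqrt (s i) = X * U i (k - 1)" "U j (k - 1) / sqrt (s j) = Y * U j (k - 1)"
      by (simp_all add: X_def Y_def)
    then show ?thesis
      unfolding row_products[OF assms(1,1)] row_products[OF assms(1,2)] row_products[OF assms(2,2)]
        sq[symmetric] X_def[symmetric] Y_def[symmetric]
      using assms(3) by (simp add: power2_eq_square algebra_simps)
  qed
  also have "\<dots> \<ge> 1 / s i + 1 / s j - 1 / 20 / s i" using last_vec_diff[OF assms(1,2)] by simp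
  finally have "1 / s i + 1 / s j - 1 / 20 / s i \<le> (\<Sum>a<k - 1. (R i a / sqrt (s i) - R j a / sqrt (s j))\<^sup>2)" by simp
  moreover have "9 / 10 / s i \<le> 1 / s j"
  proof -
    have "9 / 10 * s j \<le> s i" using s_le[OF assms(2)] s_ge[OF assms(1)] sm_ge by linarith
    then show ?thesis using sp by (simp add: field_simps)
  qed
  ultimately show ?thesis by (simp add: field_simps)
qed

end

end

section \<open>Approximate k-means\<close>

context population
begin

lemma centre_separation:
  assumes "i < k" "j < k" "i \<noteq> j"
  shows "37 / 20 / s i \<le> (\<Sum>a<k - 1. (R i a / sqrt (s i) - R j a / sqrt (s j))\<^sup>2)"
  using spec_exists centre_separation_aux assms by blast

abbreviation Wm :: rmat where "Wm \<equiv> mmul k Th R"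

text \<open>The common row of \<open>\<Theta> R Q\<close> at the nodes of cluster
  \<open>i\<close>.\<close>

definition cen :: "rmat \<Rightarrow> nat \<Rightarrow> nat \<Rightarrow> real" where
  "cen Q i a = (\<Sum>b<k - 1. (R i b / sqrt (s i)) * Q b a)"

lemma Wm_entry: "j < n \<Longrightarrow> Wm j a = R (cl j) a / sqrt (s (cl j))"
  using Theta_mulv[of j "\<lambda>i. R i a"] by (simp add: mmul_def mulv_def)

lemma WQ_entry: "j < n \<Longrightarrow> mmul (k - 1) Wm Q j a = cen Q (cl j) a"
  unfolding mmul_def[of "k - 1"] cen_def by (rule sum.cong) (auto simp: Wm_entry)

lemma cen_separation:
  assumes Q: "orthogonal_mat (k - 1) Q" and ij: "i < k" "j < k" "i \<noteq> j"
  shows "37 / 20 / s i \<le> (\<Sum>a<k - 1. (cen Q i a - cen Q j a)\<^sup>2)"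
proof -
  let ?x = "\<lambda>b. R i b / sqrt (s i) - R j b / sqrt (s j)"
  have O: "orthonormal (k - 1) (k - 1) (mat_transp Q)"
    using Q orthonormal_square_transp by (simp add: orthogonal_mat_iff)
  have "cen Q i a - cen Q j a = mulv (k - 1) (mat_transp Q) ?x a" for a
    unfolding cen_def mulv_def mat_transp_def sum_subtractf[symmetric]
    by (rule sum.cong) (auto simp: algebra_simps)
  then have "(\<Sum>a<k - 1. (cen Q i a - cen Q j a)\<^sup>2) = (vnorm (k - 1) (mulv (k - 1) (mat_transp Q) ?x))\<^sup>2"
    by (simp add: vnorm_sq)
  also have "\<dots> = (\<Sum>a<k - 1. (?x a)\<^sup>2)" unfolding vnorm_orthonormal[OF O] by (rule vnorm_sq)
  finally show ?thesis using centre_separation[OF ij] by simp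
qed

lemma sq_sum_le: "(x + y)\<^sup>2 \<le> 2 * x\<^sup>2 + 2 * y\<^sup>2" for x y :: real
  using zero_le_power2[of "x - y"] by (simp add: power2_eq_square algebra_simps)

text \<open>\<open>\<Theta> R Q\<close> is constant on clusters, so the true clustering with these
  centres competes in the minimisation and bounds the optimal cost.\<close>

lemma kmeans_feasible:
  "\<exists>R'. mat_dims k (k - 1) R' \<and> membership_mat n k (Theta_hat n k cl) \<and>
    kmeans_cost n k V (Theta_hat n k cl) R' = frob2 n (k - 1) (msub V (mmul (k - 1) Wm Q))"
proof -
  define R' where "R' = (\<lambda>i a. if i < k \<and> a < k - 1 then cen Q i a else 0)"
  have 1: "mmul k (Theta_hat n k cl) R' j a = cen Q (cl j) a" if "j < n" "a < k - 1" for j a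
  proof -
    have "mmul k (Theta_hat n k cl) R' j a = (\<Sum>i<k. if i = cl j then cen Q (cl j) a else 0)"
      unfolding mmul_def by (rule sum.cong) (use that in \<open>auto simp: Theta_hat_def R'_def\<close>)
    then show ?thesis using cl_less[OF that(1)] by simp
  qed
  have "kmeans_cost n k V (Theta_hat n k cl) R' = frob2 n (k - 1) (msub V (mmul (k - 1) Wm Q))"
    unfolding kmeans_cost_def frob2_def msub_def
    by (intro sum.cong refl) (simp add: 1 WQ_entry power2_commute del: One_nat_def)
  moreover have "mat_dims k (k - 1) R'" by (auto simp: mat_dims_def R'_def)
  moreover have "membership_mat n k (Theta_hat n k cl)"
  proof -
    have "{i. i < k \<and> Theta_hat n k cl j i = 1} = {cl j}" if "j < n" for j
      using that cl_less by (auto simp: Theta_hat_def)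
    then show ?thesis by (auto simp: membership_mat_def mat_dims_def Theta_hat_def)
  qed
  ultimately show ?thesis by blast
qed

lemma approx_kmeans_cost:
  assumes ak: "approx_kmeans n k \<xi> V T Rt" and xi: "0 < \<xi>"
  shows "kmeans_cost n k V T Rt \<le> (1 + \<xi>) * frob2 n (k - 1) (msub V (mmul (k - 1) Wm Q))"
proof -
  let ?F = "{(T', R'). membership_mat n k T' \<and> mat_dims k (k - 1) R'}"
  obtain R' where R': "mat_dims k (k - 1) R'" "membership_mat n k (Theta_hat n k cl)"
    "kmeans_cost n k V (Theta_hat n k cl) R' = frob2 n (k - 1) (msub V (mmul (k - 1) Wm Q))"
    using kmeans_feasible by blast
  have bdd: "bdd_below ((\<lambda>TR. kmeans_cost n k V (fst TR) (snd TR)) ` ?F)"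
    by (rule bdd_belowI2[of _ 0]) (auto simp: kmeans_cost_def frob2_def intro!: sum_nonneg)
  have "(INF TR \<in> ?F. kmeans_cost n k V (fst TR) (snd TR)) \<le> kmeans_cost n k V (fst (Theta_hat n k cl, R')) (snd (Theta_hat n k cl, R'))"
    by (rule cINF_lower[OF bdd]) (use R' in auto)
  then have le: "(INF TR \<in> ?F. kmeans_cost n k V (fst TR) (snd TR)) \<le> frob2 n (k - 1) (msub V (mmul (k - 1) Wm Q))"
    using R' by simp
  have "kmeans_cost n k V T Rt \<le> (1 + \<xi>) * (INF TR \<in> ?F. kmeans_cost n k V (fst TR) (snd TR))"
    using ak unfolding approx_kmeans_def by blast
  also have "\<dots> \<le> (1 + \<xi>) * frob2 n (k - 1) (msub V (mmul (k - 1) Wm Q))"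
    by (rule mult_left_mono[OF le]) (use xi in simp)
  finally show ?thesis .
qed

lemma kmeans_recovery:
  assumes Q: "orthogonal_mat (k - 1) Q" and xi: "0 < \<xi>"
    and fr: "frob2 n (k - 1) (msub V (mmul (k - 1) Wm Q)) \<le> 4 * (real k - 1) * \<delta>\<^sup>2"
    and del: "96 * (2 + \<xi>) * (real k - 1) * \<delta>\<^sup>2 < 1"
    and ak: "approx_kmeans n k \<xi> V T Rt"
    and S_def: "S = (\<lambda>i. {j \<in> cluster n cl i.
        row_norm2 (k - 1) (msub (mmul k T Rt) (mmul (k - 1) Wm Q)) j \<ge> 2 / (3 * s i)})"
  shows "\<exists>P. perm_matrix k P \<and>
      (\<forall>j\<in>(\<Union>i<k. cluster n cl i - S i). \<forall>i<k. T j i = mmul k (Theta_hat n k cl) P j i) \<and>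
      (\<Sum>i<k. real (card (S i)) / s i) \<le> 96 * (2 + \<xi>) * (real k - 1) * \<delta>\<^sup>2 \<and>
      {j. j < n \<and> (\<exists>i<k. T j i \<noteq> mmul k (Theta_hat n k cl) P j i)} \<subseteq> (\<Union>i<k. S i)"
proof -
  let ?m = "k - 1" and ?TR = "mmul k T Rt" and ?U = "mmul (k - 1) Wm Q"
  define e where "e = (\<lambda>j. row_norm2 ?m (msub ?TR ?U) j)"
  define F where "F = (\<Sum>j<n. e j)"
  have e0: "0 \<le> e j" for j by (auto simp: e_def row_norm2_def intro!: sum_nonneg)
  \<comment> \<open>Passing through \<open>V\<close>: the approximate solution costs at most
    \<open>1 + \<xi>\<close> times what the true clustering costs, so both parts together give
    \<open>2 (2 + \<xi>)\<close> times \<open>4 (k - 1) \<delta>^2\<close>. Since 96 is 12 times 8,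
    \<open>del\<close> then makes \<open>F\<close> smaller than \<open>1 / 12\<close>.\<close>
  have F8: "F \<le> 8 * ((2 + \<xi>) * (real k - 1) * \<delta>\<^sup>2)"
  proof -
    have "F \<le> (\<Sum>j<n. \<Sum>a<?m. 2 * (?TR j a - V j a)\<^sup>2 + 2 * (V j a - ?U j a)\<^sup>2)"
      unfolding F_def e_def row_norm2_def msub_def
    proof (intro sum_mono)
      fix j a
      show "(?TR j a - ?U j a)\<^sup>2 \<le> 2 * (?TR j a - V j a)\<^sup>2 + 2 * (V j a - ?U j a)\<^sup>2"
        using sq_sum_le[of "?TR j a - V j a" "V j a - ?U j a"] by simp
    qed
    also have "\<dots> = 2 * kmeans_cost n k V T Rt + 2 * frob2 n ?m (msub V ?U)"
      by (simp add: kmeans_cost_def frob2_def msub_def sum.distrib sum_distrib_left)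
    also have "\<dots> \<le> 2 * ((1 + \<xi>) * frob2 n ?m (msub V ?U)) + 2 * frob2 n ?m (msub V ?U)"
      using approx_kmeans_cost[OF ak xi, of Q] by simp
    also have "\<dots> = 2 * (2 + \<xi>) * frob2 n ?m (msub V ?U)" by (simp add: algebra_simps)
    also have "\<dots> \<le> 2 * (2 + \<xi>) * (4 * (real k - 1) * \<delta>\<^sup>2)"
      by (rule mult_left_mono[OF fr]) (use xi in simp)
    also have "\<dots> = 8 * ((2 + \<xi>) * (real k - 1) * \<delta>\<^sup>2)" by algebra
    finally show ?thesis .
  qed
  moreover have "96 * ((2 + \<xi>) * (real k - 1) * \<delta>\<^sup>2) < 1" using del by (simp only: mult.assoc)
  ultimately have F12: "F \<le> 1 / 12" by linarith
  have F0: "0 \<le> F" unfolding F_def by (rule sum_nonneg) (use e0 in auto)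
  have Fcl: "F = (\<Sum>i<k. \<Sum>j\<in>cluster n cl i. e j)" unfolding F_def using sum_cluster[of "\<lambda>_. e"] .
  have T: "membership_mat n k T" using ak by (simp add: approx_kmeans_def)
  have "\<exists>\<tau>. \<forall>j<n. \<tau> j < k \<and> (\<forall>i<k. T j i = (if i = \<tau> j then 1 else 0))"
  proof -
    have "\<exists>t. t < k \<and> (\<forall>i<k. T j i = (if i = t then 1 else 0))" if j: "j < n" for j
    proof -
      have "card {i. i < k \<and> T j i = 1} = 1" using T j by (simp add: membership_mat_def)
      then obtain t where t: "{i. i < k \<and> T j i = 1} = {t}" by (rule card_1_singletonE)
      then have "t < k" "T j t = 1" by auto
      moreover have "T j i = 0" if "i < k" "i \<noteq> t" for i
      proof -
        have "T j i \<noteq> 1" using t that by blast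
        then show ?thesis using T j that by (auto simp: membership_mat_def)
      qed
      ultimately show ?thesis by (intro exI[of _ t]) auto
    qed
    then show ?thesis by metis
  qed
  then obtain \<tau> where \<tau>: "\<And>j. j < n \<Longrightarrow> \<tau> j < k" "\<And>j i. j < n \<Longrightarrow> i < k \<Longrightarrow> T j i = (if i = \<tau> j then 1 else 0)"
    by blast
  have TR: "?TR j a = Rt (\<tau> j) a" if j: "j < n" for j a
  proof -
    have "?TR j a = (\<Sum>i<k. if i = \<tau> j then Rt i a else 0)"
      unfolding mmul_def by (rule sum.cong) (use \<tau>(2)[OF j] in auto)
    then show ?thesis using \<tau>(1)[OF j] by simp
  qed
  have eval: "e j = (\<Sum>a<?m. (Rt (\<tau> j) a - cen Q (cl j) a)\<^sup>2)" if j: "j < n" for j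
    unfolding e_def row_norm2_def msub_def by (rule sum.cong) (use j in \<open>simp_all add: TR WQ_entry del: One_nat_def\<close>)
  \<comment> \<open>Nodes of different clusters in one k-means class share their centre, so the
    distance of the true centres is paid for by the two errors.\<close>
  have dist: "37 / 20 / s (cl j) \<le> 2 * e j + 2 * e j'"
    if j: "j < n" "j' < n" "cl j \<noteq> cl j'" "\<tau> j = \<tau> j'" for j j'
  proof -
    have "37 / 20 / s (cl j) \<le> (\<Sum>a<?m. (cen Q (cl j) a - cen Q (cl j') a)\<^sup>2)"
      by (rule cen_separation[OF Q]) (use j cl_less in auto)
    also have "\<dots> \<le> (\<Sum>a<?m. 2 * (Rt (\<tau> j) a - cen Q (cl j) a)\<^sup>2 + 2 * (Rt (\<tau> j') a - cen Q (cl j') a)\<^sup>2)"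
    proof (rule sum_mono)
      fix a
      show "(cen Q (cl j) a - cen Q (cl j') a)\<^sup>2 \<le> 2 * (Rt (\<tau> j) a - cen Q (cl j) a)\<^sup>2 + 2 * (Rt (\<tau> j') a - cen Q (cl j') a)\<^sup>2"
        using sq_sum_le[of "cen Q (cl j) a - Rt (\<tau> j) a" "Rt (\<tau> j') a - cen Q (cl j') a"] j(4)
        by (simp add: power2_commute)
    qed
    also have "\<dots> = 2 * e j + 2 * e j'" unfolding eval[OF j(1)] eval[OF j(2)] by (simp add: sum.distrib sum_distrib_left)
    finally show ?thesis .
  qed
  \<comment> \<open>Averaging: the errors within one cluster sum to at most
    \<open>F\<close>.\<close>
  have "\<exists>j. j < n \<and> cl j = i \<and> e j \<le> F / s i" if i: "i < k" for i
  proof (rule ccontr)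
    assume no: "\<not> ?thesis"
    have ne: "cluster n cl i \<noteq> {}" using s_pos[OF i] by (auto simp: csize_def)
    have "(\<Sum>j\<in>cluster n cl i. F / s i) < (\<Sum>j\<in>cluster n cl i. e j)"
      by (rule sum_strict_mono[OF finite_cluster ne]) (use no in \<open>auto simp: cluster_def not_le\<close>)
    moreover have "(\<Sum>j\<in>cluster n cl i. F / s i) = F"
      using s_pos[OF i] by (simp add: csize_def)
    moreover have "(\<Sum>j\<in>cluster n cl i. e j) \<le> F" unfolding Fcl
      by (rule member_le_sum) (use i e0 in \<open>auto intro!: sum_nonneg\<close>)
    ultimately show False by simp
  qed
  then obtain rep where rep: "\<And>i. i < k \<Longrightarrow> rep i < n" "\<And>i. i < k \<Longrightarrow> cl (rep i) = i" "\<And>i. i < k \<Longrightarrow> e (rep i) \<le> F / s i"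
    by metis
  \<comment> \<open>\<open>5 / 54\<close> is \<open>1 / 12\<close> times \<open>10 / 9\<close>, the
    latter bounding the ratio of two cluster sizes.\<close>
  have small: "F / s i' \<le> 5 / 54 / s i" if "i < k" "i' < k" for i i'
  proof -
    have sp: "0 < s i" "0 < s i'" using s_pos that by auto
    have "9 / 10 * s i \<le> s i'" using s_le[OF that(1)] s_ge[OF that(2)] sm_ge by simp
    then have "1 / s i' \<le> 10 / 9 / s i" using sp by (simp add: field_simps)
    then have "F * (1 / s i') \<le> (1 / 12) * (10 / 9 / s i)" using F12 F0 sp by (intro mult_mono) auto
    then show ?thesis by simp
  qed
  define \<sigma> where "\<sigma> = (\<lambda>i. \<tau> (rep i))"
  have inj: "inj_on \<sigma> {..<k}"
  proof (rule inj_onI, rule ccontr)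
    fix i i' assume i: "i \<in> {..<k}" "i' \<in> {..<k}" "\<sigma> i = \<sigma> i'" "i \<noteq> i'"
    then have ik: "i < k" "i' < k" by auto
    have "37 / 20 / s (cl (rep i)) \<le> 2 * e (rep i) + 2 * e (rep i')"
      by (rule dist) (use i ik rep in \<open>auto simp: \<sigma>_def\<close>)
    then have "37 / 20 / s i \<le> 2 * e (rep i) + 2 * e (rep i')" using rep(2)[OF ik(1)] by simp
    also have "\<dots> \<le> 2 * (5 / 54 / s i) + 2 * (5 / 54 / s i)"
      using rep(3)[OF ik(1)] rep(3)[OF ik(2)] small[OF ik(1,1)] small[OF ik] by linarith
    also have "\<dots> = 10 / 27 / s i" by simp
    also have "\<dots> < 37 / 20 / s i" using s_pos[OF ik(1)] by (intro divide_strict_right_mono) auto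
    finally show False by simp
  qed
  \<comment> \<open>An injective self-map of a finite set is onto, so every k-means class contains
    the representative of some cluster.\<close>
  have img: "\<sigma> ` {..<k} = {..<k}"
    by (rule endo_inj_surj[OF _ _ inj]) (use rep \<tau> in \<open>auto simp: \<sigma>_def\<close>)
  \<comment> \<open>Otherwise \<open>j\<close> shares its class with the representative of another
    cluster. The two errors amount to less than \<open>2 * 2/3 + 2 * 5/54 = 41/27\<close> over
    \<open>s (cl j)\<close>, below the separation \<open>37/20\<close>.\<close>
  have good: "\<tau> j = \<sigma> (cl j)" if j: "j < n" "j \<notin> S (cl j)" for j
  proof (rule ccontr)
    assume ne: "\<tau> j \<noteq> \<sigma> (cl j)"
    have cj: "cl j < k" using cl_less j by simp
    have ej: "e j < 2 / (3 * s (cl j))" using j by (auto simp: S_def cluster_def e_def not_le)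
    have "\<tau> j \<in> \<sigma> ` {..<k}" unfolding img using \<tau>(1)[OF j(1)] by simp
    then obtain i' where i': "i' < k" "\<tau> j = \<sigma> i'" by auto
    then have "i' \<noteq> cl j" using ne by auto
    have "37 / 20 / s (cl j) \<le> 2 * e j + 2 * e (rep i')"
      by (rule dist) (use i' j rep \<open>i' \<noteq> cl j\<close> in \<open>auto simp: \<sigma>_def\<close>)
    also have "\<dots> < 2 * (2 / 3 / s (cl j)) + 2 * (5 / 54 / s (cl j))"
      using ej rep(3)[OF i'(1)] small[OF cj i'(1)] by simp
    also have "\<dots> = 41 / 27 / s (cl j)" by simp
    also have "\<dots> \<le> 37 / 20 / s (cl j)" using s_pos[OF cj] by (intro divide_right_mono) auto
    finally show False by simp
  qed
  define P where "P = (\<lambda>i l. if i < k \<and> l < k \<and> l = \<sigma> i then 1 else (0::real))"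
  have sk: "\<sigma> i < k" if "i < k" for i using img that by auto
  have perm: "perm_matrix k P"
    unfolding perm_matrix_def
  proof (intro conjI allI impI)
    show "mat_dims k k P" by (auto simp: mat_dims_def P_def)
    show "P i j \<in> {0, 1}" for i j by (simp add: P_def)
    fix i assume i: "i < k"
    have "{j. j < k \<and> P i j = 1} = {\<sigma> i}" using sk[OF i] i by (auto simp: P_def)
    then show "card {j. j < k \<and> P i j = 1} = 1" by simp
  next
    fix l assume l: "l < k"
    then have "l \<in> \<sigma> ` {..<k}" using img by simp
    then obtain i0 where i0: "i0 < k" "l = \<sigma> i0" by auto
    have "i = i0" if "i < k" "\<sigma> i = l" for i using inj_onD[OF inj, of i i0] i0 that by simp
    then have "{i. i < k \<and> P i l = 1} = {i0}" using i0 l by (auto simp: P_def)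
    then show "card {i. i < k \<and> P i l = 1} = 1" by simp
  qed
  have ThP: "mmul k (Theta_hat n k cl) P j l = P (cl j) l" if j: "j < n" for j l
  proof -
    have "mmul k (Theta_hat n k cl) P j l = (\<Sum>i<k. if i = cl j then P (cl j) l else 0)"
      unfolding mmul_def by (rule sum.cong) (use j in \<open>auto simp: Theta_hat_def\<close>)
    then show ?thesis using cl_less[OF j] by simp
  qed
  have agree: "T j l = mmul k (Theta_hat n k cl) P j l" if "j < n" "j \<notin> S (cl j)" "l < k" for j l
    unfolding ThP[OF that(1)] using \<tau>(2)[OF that(1,3)] good[OF that(1,2)] cl_less[OF that(1)] that(3)
    by (simp add: P_def)
  have A: "\<forall>j\<in>(\<Union>i<k. cluster n cl i - S i). \<forall>i<k. T j i = mmul k (Theta_hat n k cl) P j i"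
    using agree by (auto simp: cluster_def)
  have B: "{j. j < n \<and> (\<exists>i<k. T j i \<noteq> mmul k (Theta_hat n k cl) P j i)} \<subseteq> (\<Union>i<k. S i)"
    using agree cl_less by blast
  have "(\<Sum>i<k. real (card (S i)) / s i) \<le> (\<Sum>i<k. 3 / 2 * (\<Sum>j\<in>cluster n cl i. e j))"
  proof (rule sum_mono)
    fix i assume "i \<in> {..<k}"
    then have sp: "0 < s i" using s_pos by simp
    have sub: "S i \<subseteq> cluster n cl i" by (auto simp: S_def)
    have "(\<Sum>j\<in>S i. 2 / (3 * s i)) \<le> (\<Sum>j\<in>S i. e j)" by (rule sum_mono) (auto simp: S_def e_def)
    also have "\<dots> \<le> (\<Sum>j\<in>cluster n cl i. e j)" by (rule sum_mono2[OF finite_cluster sub]) (use e0 in auto)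
    finally have le: "real (card (S i)) * (2 / (3 * s i)) \<le> (\<Sum>j\<in>cluster n cl i. e j)" by simp
    have eq: "real (card (S i)) / s i = 3 / 2 * (real (card (S i)) * (2 / (3 * s i)))" by simp
    show "real (card (S i)) / s i \<le> 3 / 2 * (\<Sum>j\<in>cluster n cl i. e j)"
      unfolding eq by (rule mult_left_mono[OF le]) simp
  qed
  also have "\<dots> = 3 / 2 * F" unfolding Fcl by (simp add: sum_distrib_left)
  also have "\<dots> \<le> 3 / 2 * (8 * ((2 + \<xi>) * (real k - 1) * \<delta>\<^sup>2))"
    by (rule mult_left_mono[OF F8]) simp
  also have "\<dots> \<le> 96 * (2 + \<xi>) * (real k - 1) * \<delta>\<^sup>2"
  proof -
    have "0 \<le> (2 + \<xi>) * (real k - 1) * \<delta>\<^sup>2" using xi k2 by simp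
    then have "3 / 2 * (8 * ((2 + \<xi>) * (real k - 1) * \<delta>\<^sup>2)) \<le> 96 * ((2 + \<xi>) * (real k - 1) * \<delta>\<^sup>2)" by linarith
    then show ?thesis by (simp only: mult.assoc)
  qed
  finally have D: "(\<Sum>i<k. real (card (S i)) / s i) \<le> 96 * (2 + \<xi>) * (real k - 1) * \<delta>\<^sup>2" .
  show ?thesis using perm A B D by blast
qed

end

section \<open>From spectral closeness to recovery\<close>

lemma mulv_mmul: "mulv c (mmul m M N) y = mulv m M (mulv c N y)"
  unfolding mulv_def mmul_def sum_distrib_left sum_distrib_right
  by (intro ext, subst sum.swap) (simp add: mult_ac)

lemma opnorm_le:
  assumes "0 \<le> B" "\<And>y. vnorm r (mulv c M y) \<le> B * vnorm c y"
  shows "opnorm r c M \<le> B"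
proof -
  define S where "S = {sqrt (\<Sum>i<r. (\<Sum>j<c. M i j * x j)\<^sup>2) | x. (\<Sum>j<c. (x j)\<^sup>2) \<le> 1}"
  have "sqrt (\<Sum>i<r. (\<Sum>j<c. M i j * 0)\<^sup>2) \<in> S"
    unfolding S_def by (intro CollectI exI[of _ "\<lambda>_. 0"]) simp
  then have ne: "S \<noteq> {}" by blast
  have "z \<le> B" if "z \<in> S" for z
  proof -
    from that obtain x where z: "z = sqrt (\<Sum>i<r. (\<Sum>j<c. M i j * x j)\<^sup>2)" and x: "(\<Sum>j<c. (x j)\<^sup>2) \<le> 1"
      unfolding S_def by blast
    have "z = vnorm r (mulv c M x)" by (simp add: z vnorm_def L2_set_def mulv_def)
    also have "\<dots> \<le> B * vnorm c x" by (rule assms(2))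
    also have "\<dots> \<le> B * 1" by (rule mult_left_mono[OF _ assms(1)]) (simp add: vnorm_def L2_set_def x)
    finally show ?thesis by simp
  qed
  then show ?thesis unfolding opnorm_def S_def[symmetric] by (rule cSup_least[OF ne])
qed

text \<open>Each of the \<open>c\<close> columns is the image of a unit vector.\<close>

lemma frob2_le:
  assumes "0 \<le> B" "\<And>y. vnorm r (mulv c M y) \<le> B * vnorm c y"
  shows "frob2 r c M \<le> real c * B\<^sup>2"
proof -
  have "frob2 r c M = (\<Sum>a<c. \<Sum>i<r. (M i a)\<^sup>2)" unfolding frob2_def by (rule sum.swap)
  also have "\<dots> \<le> (\<Sum>a<c. B\<^sup>2)"
  proof (rule sum_mono)
    fix a assume a: "a \<in> {..<c}"
    let ?e = "\<lambda>b. if b = a then 1 else (0::real)"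
    have "(vnorm c ?e)\<^sup>2 = 1" unfolding vnorm_sq using a by (simp add: if_distrib[of "\<lambda>z. z\<^sup>2"] cong: if_cong)
    moreover have "vnorm r (mulv c M ?e) \<le> B * vnorm c ?e" by (rule assms(2))
    then have "(vnorm r (mulv c M ?e))\<^sup>2 \<le> (B * vnorm c ?e)\<^sup>2" by (rule power_mono) simp
    ultimately have "(vnorm r (mulv c M ?e))\<^sup>2 \<le> B\<^sup>2" by (simp add: power_mult_distrib)
    moreover have "mulv c M ?e = (\<lambda>i. M i a)" using a by (simp add: mulv_def if_distrib cong: if_cong)
    ultimately show "(\<Sum>i<r. (M i a)\<^sup>2) \<le> B\<^sup>2" by (simp add: vnorm_sq)
  qed
  finally show ?thesis by simp
qed

context population
begin

text \<open>The population Laplacian: its diagonal is exactly 1, and off the diagonal it is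
  \<open>- E A / dbar\<close>. The sign matrix on its right is \<open>\<Theta> M \<Theta>^T\<close>,
  as \<open>sgn_cl_Mm\<close> shows entrywise.\<close>

definition Hm :: rmat where
  "Hm = (\<lambda>i j. (if i = j then 1 + g else 0) - g * sgn_cl cl i j)"

lemma sgn_cl_Mm: "j < n \<Longrightarrow> j' < n \<Longrightarrow> mulv k Mm (\<lambda>i. Th j' i) (cl j) / sqrt (s (cl j)) = sgn_cl cl j j'"
proof -
  assume j: "j < n" "j' < n"
  have sp: "0 < s (cl j)" "0 < s (cl j')" using s_pos cl_less j by auto
  have "mulv k Mm (\<lambda>i. Th j' i) (cl j) = (\<Sum>i<k. if i = cl j' then Mm (cl j) (cl j') / sqrt (s (cl j')) else 0)"
    unfolding mulv_def by (rule sum.cong) (use j in \<open>auto simp: Theta_def\<close>)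
  also have "\<dots> = Mm (cl j) (cl j') / sqrt (s (cl j'))" using cl_less[OF j(2)] by simp
  finally show ?thesis using sp by (auto simp: Mm_def sgn_cl_def)
qed

lemma Hm_mulv:
  assumes "j < n"
  shows "mulv n Hm z j = (1 + g) * z j - g * mulv k Th (mulv k Mm (mulv n (mat_transp Th) z)) j"
proof -
  have 1: "mulv n Hm z j = (1 + g) * z j - g * (\<Sum>j'<n. sgn_cl cl j j' * z j')"
  proof -
    have "mulv n Hm z j = (\<Sum>j'<n. (if j = j' then (1 + g) * z j else 0) - g * (sgn_cl cl j j' * z j'))"
      unfolding mulv_def Hm_def by (rule sum.cong) (auto simp: algebra_simps)
    then show ?thesis using assms by (simp add: sum_subtractf sum_distrib_left)
  qed
  have "mulv k Th (mulv k Mm (mulv n (mat_transp Th) z)) j = mulv k Mm (mulv n (mat_transp Th) z) (cl j) / sqrt (s (cl j))"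
    by (rule Theta_mulv[OF assms])
  also have "mulv k Mm (mulv n (mat_transp Th) z) (cl j) = (\<Sum>j'<n. mulv k Mm (\<lambda>i. Th j' i) (cl j) * z j')"
    unfolding mulv_def mat_transp_def sum_distrib_left sum_distrib_right
    by (subst sum.swap) (simp add: mult_ac)
  also have "\<dots> / sqrt (s (cl j)) = (\<Sum>j'<n. (mulv k Mm (\<lambda>i. Th j' i) (cl j) / sqrt (s (cl j))) * z j')"
    by (simp add: sum_divide_distrib)
  also have "\<dots> = (\<Sum>j'<n. sgn_cl cl j j' * z j')"
    by (rule sum.cong) (use assms in \<open>auto simp: sgn_cl_Mm\<close>)
  finally show ?thesis using 1 by simp
qed

lemma k_le_n: "k \<le> n"
proof -
  have "1 \<le> s i" if "i < k" for i using s_pos[OF that] by (simp add: csize_def)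
  then have "real k \<le> (\<Sum>i<k. s i)" using sum_mono[of "{..<k}" "\<lambda>_. 1" s] by simp
  then show ?thesis by (simp add: sum_s)
qed

text \<open>With spectral gap at least \<open>D\<close> and
  \<open>\<epsilon> \<le> \<delta> D / 2\<close>, the denominator in \<open>davis_kahan\<close> is
  at least \<open>D / 2\<close>, so the projection error is at most \<open>\<delta>\<close>. The
  Procrustes bound turns it into \<open>\<delta> + \<delta>^2 \<le> 2 \<delta>\<close>.\<close>

lemma spectral_recovery:
  assumes E: "op_le n n (\<lambda>i j. L i j - Hm i j) \<epsilon>" and e0: "0 \<le> \<epsilon>"
    and small: "\<epsilon> \<le> \<delta> * ((1 - 2 * \<eta>) / real k) / 2" and d: "0 < \<delta>" "\<delta> \<le> 1"
    and V: "bottom_eigvecs n (k - 1) L V"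
  shows "\<exists>Q. orthogonal_mat (k - 1) Q \<and>
    (\<forall>y. vnorm n (mulv (k - 1) (msub V (mmul (k - 1) Wm Q)) y) \<le> 2 * \<delta> * vnorm (k - 1) y)"
proof -
  let ?m = "k - 1"
  obtain U mu where sp: "spec U mu" using spec_exists by blast
  note Uo = U_orth[OF sp] and Uev = U_ev[OF sp] and RU = R_U[OF sp]
  obtain UL lam where UL: "orthonormal n n UL" and ev: "\<forall>a<n. \<forall>j<n. (\<Sum>i<n. L j i * UL i a) = lam a * UL j a"
    and mono: "\<forall>a b. a \<le> b \<longrightarrow> b < n \<longrightarrow> lam a \<le> lam b" and VU: "\<forall>j<n. \<forall>a<?m. V j a = UL j a"
    using V unfolding bottom_eigvecs_def orthonormal_def by blast
  have m: "0 < ?m" "?m \<le> n" using k2 k_le_n by auto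
  have Vo: "orthonormal n ?m V"
    unfolding orthonormal_def
  proof (intro allI impI)
    fix x y assume xy: "x < ?m" "y < ?m"
    have "(\<Sum>i<n. V i x * V i y) = (\<Sum>i<n. UL i x * UL i y)" by (rule sum.cong) (use VU xy in auto)
    then show "(\<Sum>i<n. V i x * V i y) = (if x = y then 1 else 0)"
      using UL xy m by (auto simp: orthonormal_def)
  qed
  have Ro: "(\<Sum>i<k. R i a * R i b) = (if a = b then 1 else 0)" if "a < ?m" "b < ?m" for a b
  proof -
    have "(\<Sum>i<k. R i a * R i b) = (\<Sum>i<k. U i a * U i b)" by (rule sum.cong) (use RU that in auto)
    then show ?thesis using Uo that by (auto simp: orthonormal_def)
  qed
  have Wcol: "(\<lambda>j. Wm j a) = mulv k Th (\<lambda>i. R i a)" for a by (simp add: mmul_def mulv_def)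
  have Wo: "orthonormal n ?m Wm"
    unfolding orthonormal_def
  proof (intro allI impI)
    fix a b assume ab: "a < ?m" "b < ?m"
    have "(\<Sum>j<n. Wm j a * Wm j b) = ip n (mulv k Th (\<lambda>i. R i a)) (mulv k Th (\<lambda>i. R i b))"
      unfolding Wcol[symmetric] ip_def ..
    also have "\<dots> = ip k (\<lambda>i. R i a) (\<lambda>i. R i b)" by (rule ip_orthonormal[OF Theta_orthonormal])
    finally show "(\<Sum>j<n. Wm j a * Wm j b) = (if a = b then 1 else 0)" using Ro[OF ab] by (simp add: ip_def)
  qed
  have MR: "mulv k Mm (\<lambda>i. R i a) i = mu a * R i a" if "a < ?m" "i < k" for a i
  proof -
    have "mulv k Mm (\<lambda>i. R i a) i = (\<Sum>j<k. Mm i j * U j a)" unfolding mulv_def by (rule sum.cong) (use RU that in auto)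
    also have "\<dots> = mu a * U i a" using Uev that by simp
    finally show ?thesis using RU that by simp
  qed
  have Wev: "mulv n Hm (\<lambda>i. Wm i a) j = (1 + g - g * mu a) * Wm j a" if a: "a < ?m" and j: "j < n" for a j
  proof -
    have "mulv k Mm (mulv n (mat_transp Th) (\<lambda>i. Wm i a)) = mulv k Mm (\<lambda>i. R i a)"
      unfolding Wcol by (rule mulv_cong) (rule orthonormal_mulv[OF Theta_orthonormal])
    then have "mulv k Th (mulv k Mm (mulv n (mat_transp Th) (\<lambda>i. Wm i a))) j = mulv k Th (\<lambda>i. mu a * R i a) j"
      using mulv_cong[of k "mulv k Mm (\<lambda>i. R i a)" "\<lambda>i. mu a * R i a" Th] MR[OF a] by simp
    also have "\<dots> = mu a * Wm j a" unfolding mulv_scale using fun_cong[OF Wcol[of a], of j] by simp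
    finally show ?thesis unfolding Hm_mulv[OF j] by (simp add: algebra_simps)
  qed
  \<comment> \<open>\<open>\<alpha>\<close> bounds the eigenvalues of \<open>Hm\<close> on the range
    of \<open>\<Theta> R\<close> from above, \<open>\<beta>\<close> the form on its complement from
    below. The complement contains the last block eigenvector and the vectors killed by
    \<open>\<Theta>^T\<close>, on which \<open>Hm\<close> is \<open>1 + g\<close>; hence the maximum
    with 0.\<close>
  define \<alpha> where "\<alpha> = 1 + g - g * (2 * sm)"
  define \<beta> where "\<beta> = 1 + g - g * max 0 (2 * sM - real n)"
  have nu: "1 + g - g * mu a \<le> \<alpha>" if "a < ?m" for a
    using mult_left_mono[OF mu_ge[OF sp that], of g] g_pos by (simp add: \<alpha>_def)
  have gap: "\<beta> * (vnorm n z)\<^sup>2 \<le> ip n z (mulv n Hm z)"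
    if z: "\<And>a. a < ?m \<Longrightarrow> mulv n (mat_transp Wm) z a = 0" for z
  proof -
    let ?u = "mulv n (mat_transp Th) z"
    have u0: "mulv k (mat_transp U) ?u a = 0" if "a < ?m" for a
    proof -
      have "mulv n (mat_transp Wm) z a = ip n (mulv k Th (\<lambda>i. R i a)) z"
        unfolding mulv_transp_eq_ip Wcol ..
      also have "\<dots> = ip k (\<lambda>i. R i a) ?u" by (rule ip_mulv_left)
      also have "\<dots> = ip k (\<lambda>i. U i a) ?u" by (rule ip_cong) (use RU that in auto)
      finally show ?thesis using z[OF that] by (simp add: mulv_transp_eq_ip)
    qed
    have uz: "(vnorm k ?u)\<^sup>2 \<le> (vnorm n z)\<^sup>2"
    proof -
      have "vnorm k ?u * vnorm k ?u = ip k ?u ?u" using vnorm_sq_ip[of k ?u] by (simp add: power2_eq_square)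
      also have "\<dots> = ip n (mulv k Th ?u) z" by (rule ip_mulv_left[symmetric])
      also have "\<dots> \<le> vnorm n (mulv k Th ?u) * vnorm n z" using ip_le_vnorm abs_le_D1 by blast
      also have "\<dots> = vnorm k ?u * vnorm n z" by (simp add: vnorm_orthonormal[OF Theta_orthonormal])
      finally have "vnorm k ?u \<le> vnorm n z" by (rule mult_left_le_cancel[OF vnorm_nonneg]) simp
      then show ?thesis by (intro power_mono) auto
    qed
    \<comment> \<open>If \<open>z\<close> is orthogonal to \<open>\<Theta> R\<close>, then
      \<open>\<Theta>^T z\<close> has no component along the first \<open>k - 1\<close> block
      eigenvectors, and only this coordinate survives.\<close>
    let ?c = "(mulv k (mat_transp U) ?u (k - 1))\<^sup>2"
    have only: "(\<Sum>a<k. f a * (mulv k (mat_transp U) ?u a)\<^sup>2) = f (k - 1) * ?c" for f :: "nat \<Rightarrow> real"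
    proof -
      have "(\<Sum>a<k. f a * (mulv k (mat_transp U) ?u a)\<^sup>2) = (\<Sum>a\<in>{k - 1}. f a * (mulv k (mat_transp U) ?u a)\<^sup>2)"
      proof (rule sum.mono_neutral_right)
        show "\<forall>i\<in>{..<k} - {k - 1}. f i * (mulv k (mat_transp U) ?u i)\<^sup>2 = 0"
        proof
          fix i assume "i \<in> {..<k} - {k - 1}"
          then have "i < ?m" by auto
          then show "f i * (mulv k (mat_transp U) ?u i)\<^sup>2 = 0" using u0 by simp
        qed
      qed (use k2 in auto)
      then show ?thesis by simp
    qed
    have cu: "?c = (vnorm k ?u)\<^sup>2" using only[of "\<lambda>_. 1"] unfolding vnorm_eigen_coords[OF Uo] by simp
    have "ip k ?u (mulv k Mm ?u) = mu (k - 1) * ?c" unfolding M_form_coords[OF sp] by (rule only)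
    also have "\<dots> \<le> max 0 (2 * sM - real n) * ?c" using mu_last_le[OF sp] by (intro mult_right_mono) auto
    also have "\<dots> \<le> max 0 (2 * sM - real n) * (vnorm n z)\<^sup>2" unfolding cu by (intro mult_left_mono uz) auto
    finally have M: "g * ip k ?u (mulv k Mm ?u) \<le> g * (max 0 (2 * sM - real n) * (vnorm n z)\<^sup>2)"
      using g_pos by (intro mult_left_mono) auto
    have "ip n z (mulv n Hm z) = ip n z (\<lambda>j. (1 + g) * z j - g * mulv k Th (mulv k Mm ?u) j)"
      by (rule ip_cong) (auto simp: Hm_mulv)
    also have "\<dots> = (1 + g) * (vnorm n z)\<^sup>2 - g * ip k ?u (mulv k Mm ?u)"
      unfolding ip_diff_right ip_scale_right ip_mulv_right[of n z k Th] vnorm_sq_ip ..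
    finally show ?thesis using M by (simp add: \<beta>_def algebra_simps)
  qed
  have Hsym: "Hm i j = Hm j i" for i j by (simp add: Hm_def sgn_cl_def)
  define D where "D = (1 - 2 * \<eta>) / real k"
  have D0: "0 < D" using eta k2 by (simp add: D_def)
  have gapD: "D \<le> \<beta> - \<alpha>"
  proof -
    have "1 \<le> real n / (real n - 1)" using n2 by (simp add: field_simps)
    then have "D * 1 \<le> D * (real n / (real n - 1))" using D0 by (intro mult_left_mono) auto
    also have "\<dots> = g * (real n / real k)" by (simp add: g_def D_def)
    also have "\<dots> \<le> g * (2 * sm - max 0 (2 * sM - real n))" using g_pos by (intro mult_left_mono gap_sizes) auto
    finally show ?thesis by (simp add: \<alpha>_def \<beta>_def right_diff_distrib)
  qed
  have small': "\<epsilon> \<le> \<delta> * D / 2" using small by (simp add: D_def)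
  have dD: "\<delta> * D \<le> D" using mult_right_mono[OF d(2), of D] D0 by simp
  have lt: "\<alpha> + \<epsilon> < \<beta>" using small' dD gapD D0 by linarith
  let ?x = "\<epsilon> / (\<beta> - \<alpha> - \<epsilon>)"
  have x: "0 \<le> ?x" "?x \<le> \<delta>"
  proof -
    have h: "D / 2 \<le> \<beta> - \<alpha> - \<epsilon>" using small' dD gapD by linarith
    show "0 \<le> ?x" using e0 lt by simp
    have "\<epsilon> \<le> \<delta> * (D / 2)" using small' by simp
    also have "\<dots> \<le> \<delta> * (\<beta> - \<alpha> - \<epsilon>)" using h d by (intro mult_left_mono) auto
    finally show "?x \<le> \<delta>" using lt by (simp add: divide_le_eq)
  qed
  have "vnorm n (compl_proj n ?m Wm (mulv ?m V y)) \<le> ?x * vnorm ?m y" for y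
    by (rule davis_kahan[OF m UL ev mono VU Wo Wev Hsym nu gap E lt e0])
  from procrustes_bound[OF Vo Wo x(1) this] obtain Q where Q: "orthogonal_mat ?m Q"
    and b: "\<And>y. vnorm n (\<lambda>i. mulv ?m V y i - mulv ?m Wm (mulv ?m Q y) i) \<le> (?x + ?x\<^sup>2) * vnorm ?m y" by blast
  have "?x\<^sup>2 \<le> \<delta>"
  proof -
    have "?x\<^sup>2 \<le> \<delta>\<^sup>2" by (intro power_mono x)
    also have "\<dots> \<le> \<delta>" using d by (simp add: power2_eq_square mult_left_le)
    finally show ?thesis .
  qed
  then have xx: "?x + ?x\<^sup>2 \<le> 2 * \<delta>" using x(2) by linarith
  have "vnorm n (mulv ?m (msub V (mmul ?m Wm Q)) y) \<le> 2 * \<delta> * vnorm ?m y" for y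
  proof -
    have "mulv ?m (msub V (mmul ?m Wm Q)) y = (\<lambda>i. mulv ?m V y i - mulv ?m Wm (mulv ?m Q y) i)"
      unfolding msub_def mulv_msub mulv_mmul ..
    then show ?thesis using b[of y] mult_right_mono[OF xx vnorm_nonneg[of ?m y]] by simp
  qed
  then show ?thesis using Q by blast
qed

text \<open>As \<open>12 (16 + 8 \<xi>) = 96 (2 + \<xi>)\<close>, the bound on
  \<open>\<delta>\<close> is precisely the smallness condition of \<open>kmeans_recovery\<close>.
  The factor \<open>k - 1\<close> there comes from passing from operator to Frobenius norm.\<close>

lemma recovery_of_close:
  assumes E: "op_le n n (\<lambda>i j. L A i j - Hm i j) \<epsilon>" and e0: "0 \<le> \<epsilon>"
    and small: "\<epsilon> \<le> \<delta> * ((1 - 2 * \<eta>) / real k) / 2" and xi: "0 < \<xi>"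
    and d: "0 < \<delta>" "\<delta> < sqrt (1 / (12 * (16 + 8 * \<xi>) * (real k - 1)))"
  shows "recovery_event n k cl \<xi> \<delta> R L A"
proof -
  have k1: "1 \<le> real k - 1" using k2 by simp
  let ?q = "12 * (16 + 8 * \<xi>) * (real k - 1)"
  have q1: "1 \<le> ?q"
  proof -
    have "1 * 1 \<le> (12 * (16 + 8 * \<xi>)) * (real k - 1)" using xi k1 by (intro mult_mono) auto
    then show ?thesis by simp
  qed
  have "\<delta>\<^sup>2 < (sqrt (1 / ?q))\<^sup>2" using d by (intro power_strict_mono) auto
  then have "\<delta>\<^sup>2 < 1 / ?q" using q1 by simp
  then have q2: "\<delta>\<^sup>2 * ?q < 1" using q1 by (simp add: less_divide_eq)
  have "?q = 96 * (2 + \<xi>) * (real k - 1)" by (simp add: algebra_simps)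
  then have del: "96 * (2 + \<xi>) * (real k - 1) * \<delta>\<^sup>2 < 1" using q2 by (simp only: mult.commute)
  have d1: "\<delta> \<le> 1"
  proof (rule ccontr)
    assume "\<not> \<delta> \<le> 1"
    then have "1 \<le> \<delta>\<^sup>2" by simp
    then have "1 * 1 \<le> \<delta>\<^sup>2 * ?q" using q1 by (intro mult_mono) auto
    then show False using q2 by simp
  qed
  show ?thesis
    unfolding recovery_event_def
  proof (intro allI impI)
    fix V assume V: "bottom_eigvecs n (k - 1) (L A) V"
    from spectral_recovery[OF E e0 small d(1) d1 V] obtain Q where Q: "orthogonal_mat (k - 1) Q"
      and b: "\<And>y. vnorm n (mulv (k - 1) (msub V (mmul (k - 1) Wm Q)) y) \<le> 2 * \<delta> * vnorm (k - 1) y" by blast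
    have b0: "0 \<le> 2 * \<delta>" using d by simp
    have "frob2 n (k - 1) (msub V (mmul (k - 1) Wm Q)) \<le> real (k - 1) * (2 * \<delta>)\<^sup>2" by (rule frob2_le[OF b0 b])
    also have "\<dots> = 4 * (real k - 1) * \<delta>\<^sup>2" using k2 by (simp add: of_nat_diff power_mult_distrib)
    finally have fr: "frob2 n (k - 1) (msub V (mmul (k - 1) Wm Q)) \<le> 4 * (real k - 1) * \<delta>\<^sup>2" .
    show "\<exists>Q. orthogonal_mat (k - 1) Q \<and>
             opnorm n (k - 1) (msub V (mmul (k - 1) (mmul k (Theta n k cl) R) Q)) \<le> 2 * \<delta> \<and>
             (\<forall>T Rt. approx_kmeans n k \<xi> V T Rt \<longrightarrow>
                (let TR = mmul k T Rt;
                     ThRO = mmul (k - 1) (mmul k (Theta n k cl) R) Q;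
                     S = (\<lambda>i. {j \<in> cluster n cl i.
                            row_norm2 (k - 1) (msub TR ThRO) j \<ge> 2 / (3 * csize n cl i)});
                     Vt = (\<Union>i<k. cluster n cl i - S i)
                 in \<exists>P. perm_matrix k P \<and>
                      (\<forall>j\<in>Vt. \<forall>i<k. T j i = mmul k (Theta_hat n k cl) P j i) \<and>
                      (\<Sum>i<k. real (card (S i)) / csize n cl i)
                          \<le> 96 * (2 + \<xi>) * (real k - 1) * \<delta>\<^sup>2 \<and>
                      {j. j < n \<and> (\<exists>i<k. T j i \<noteq> mmul k (Theta_hat n k cl) P j i)}
                          \<subseteq> (\<Union>i<k. S i)))"
      unfolding Let_def
      using Q opnorm_le[OF b0 b] kmeans_recovery[OF Q xi fr del _ refl] by blast
  qed
qed

end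

section \<open>Perturbation of the Laplacian\<close>

lemma op_le_add:
  assumes "op_le r c M B" "op_le r c N C"
  shows "op_le r c (\<lambda>i j. M i j + N i j) (B + C)"
  unfolding op_le_def
proof
  fix x
  have "mulv c (\<lambda>i j. M i j + N i j) x = (\<lambda>i. mulv c M x i + mulv c N x i)"
    by (simp add: mulv_def distrib_right sum.distrib)
  then have "vnorm r (mulv c (\<lambda>i j. M i j + N i j) x) \<le> vnorm r (mulv c M x) + vnorm r (mulv c N x)"
    by (simp only: vnorm_triangle)
  also have "\<dots> \<le> B * vnorm c x + C * vnorm c x"
    using assms by (intro add_mono) (auto simp: op_le_def)
  finally show "vnorm r (mulv c (\<lambda>i j. M i j + N i j) x) \<le> (B + C) * vnorm c x"
    by (simp add: distrib_right)
qed

lemma op_le_mono: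
  assumes "op_le r c M B" "B \<le> C"
  shows "op_le r c M C"
  unfolding op_le_def
proof
  fix x
  have "vnorm r (mulv c M x) \<le> B * vnorm c x" using assms(1) by (simp add: op_le_def)
  also have "\<dots> \<le> C * vnorm c x" by (rule mult_right_mono[OF assms(2)]) simp
  finally show "vnorm r (mulv c M x) \<le> C * vnorm c x" .
qed

lemma op_le_cong:
  assumes "\<And>i j. i < r \<Longrightarrow> j < c \<Longrightarrow> M i j = N i j" "op_le r c M B"
  shows "op_le r c N B"
proof -
  have "vnorm r (mulv c N x) = vnorm r (mulv c M x)" for x
    by (rule vnorm_cong) (auto simp: mulv_def assms(1) intro!: sum.cong)
  then show ?thesis using assms(2) by (simp add: op_le_def)
qed

lemma op_le_frob_bound:
  assumes "(\<Sum>i<r. \<Sum>j<c. (M i j)\<^sup>2) \<le> C\<^sup>2" "0 \<le> C"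
  shows "op_le r c M C"
  by (rule op_le_mono[OF op_le_frob]) (use real_sqrt_le_mono[OF assms(1)] assms(2) in simp)

lemma vnorm_diag_le:
  assumes "\<And>i. i < n \<Longrightarrow> \<bar>a i\<bar> \<le> c" "0 \<le> c"
  shows "vnorm n (\<lambda>i. a i * x i) \<le> c * vnorm n x"
proof (rule power2_le_imp_le)
  have "(vnorm n (\<lambda>i. a i * x i))\<^sup>2 \<le> (\<Sum>i<n. c\<^sup>2 * (x i)\<^sup>2)"
    unfolding vnorm_sq power_mult_distrib
  proof (intro sum_mono mult_right_mono)
    fix i assume "i \<in> {..<n}"
    then have "\<bar>a i\<bar>\<^sup>2 \<le> c\<^sup>2" using assms(1) by (intro power_mono) auto
    then show "(a i)\<^sup>2 \<le> c\<^sup>2" by simp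
  qed simp
  then show "(vnorm n (\<lambda>i. a i * x i))\<^sup>2 \<le> (c * vnorm n x)\<^sup>2"
    by (simp add: vnorm_sq power_mult_distrib sum_distrib_left)
qed (use assms in simp)

lemma op_le_diag_scale:
  assumes X: "op_le n n X B" "0 \<le> B" and a: "\<And>i. i < n \<Longrightarrow> \<bar>a i\<bar> \<le> c" "0 \<le> c"
  shows "op_le n n (\<lambda>i j. a i * X i j * a j) (c * c * B)"
  unfolding op_le_def
proof
  fix x
  have "mulv n (\<lambda>i j. a i * X i j * a j) x = (\<lambda>i. a i * mulv n X (\<lambda>j. a j * x j) i)"
    by (simp add: mulv_def sum_distrib_left mult_ac)
  then have "vnorm n (mulv n (\<lambda>i j. a i * X i j * a j) x) = vnorm n (\<lambda>i. a i * mulv n X (\<lambda>j. a j * x j) i)"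
    by (simp only:)
  also have "\<dots> \<le> c * vnorm n (mulv n X (\<lambda>j. a j * x j))" by (rule vnorm_diag_le[OF a])
  also have "\<dots> \<le> c * (B * vnorm n (\<lambda>j. a j * x j))"
    using X(1) a(2) by (intro mult_left_mono) (auto simp: op_le_def)
  also have "\<dots> \<le> c * (B * (c * vnorm n x))"
    by (intro mult_left_mono vnorm_diag_le a X)
  finally show "vnorm n (mulv n (\<lambda>i j. a i * X i j * a j) x) \<le> c * c * B * vnorm n x"
    by (simp add: mult_ac)
qed

lemma Lsym_eq_Lgamma: "Lsym n A = Lgamma n 0 0 A"
  by (intro ext) (simp add: Lsym_def Lgamma_def)

text \<open>For \<open>x = sqrt (d / D)\<close> one has
  \<open>(x - 1)^2 x^2 \<le> (x^2 - 1)^2\<close>, which replaces the root by the deviation of the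
  degree.\<close>

lemma sqrt_ratio_diff_sq:
  fixes d D :: real
  assumes d: "0 < d" and D: "d / 2 \<le> D"
  shows "(sqrt (d / D) - 1)\<^sup>2 \<le> 2 * (d - D)\<^sup>2 / d\<^sup>2" and "(sqrt (d / D))\<^sup>2 \<le> 2"
proof -
  have Dp: "0 < D" using d D by simp
  have "d / D \<le> 2" using D Dp by (simp add: divide_le_eq)
  then show "(sqrt (d / D))\<^sup>2 \<le> 2" using d Dp by simp
  define x where "x = sqrt (d / D)"
  have x: "0 \<le> x" "x\<^sup>2 = d / D" using d Dp by (auto simp: x_def)
  have "(x - 1)\<^sup>2 * x\<^sup>2 \<le> (x - 1)\<^sup>2 * (x + 1)\<^sup>2"
    by (intro mult_left_mono power_mono) (use x in auto)
  also have "\<dots> = (x\<^sup>2 - 1)\<^sup>2" by algebra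
  also have "\<dots> = (d - D)\<^sup>2 / D\<^sup>2" unfolding x(2) using Dp by (simp add: field_simps power2_eq_square)
  finally have "(x - 1)\<^sup>2 * (d / D) \<le> (d - D)\<^sup>2 / D\<^sup>2" unfolding x(2) .
  then have "(x - 1)\<^sup>2 * (d / D) * (D / d) \<le> (d - D)\<^sup>2 / D\<^sup>2 * (D / d)"
    by (rule mult_right_mono) (use d Dp in simp)
  then have "(x - 1)\<^sup>2 \<le> (d - D)\<^sup>2 / (D * d)" using d Dp by (simp add: power2_eq_square)
  also have "\<dots> \<le> (d - D)\<^sup>2 / (d / 2 * d)"
    using d D by (intro divide_left_mono mult_right_mono) auto
  also have "\<dots> = 2 * (d - D)\<^sup>2 / d\<^sup>2" by (simp add: power2_eq_square)
  finally show "(sqrt (d / D) - 1)\<^sup>2 \<le> 2 * (d - D)\<^sup>2 / d\<^sup>2" by (simp add: x_def)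
qed

context population
begin

lemma degree_dev_sum:
  assumes typical: "typical_adj n cl p \<eta> B A" and B: "0 \<le> B"
  shows "(\<Sum>i<n. (Defs.degree n A i - dbar n p)\<^sup>2) \<le> B\<^sup>2 * real n"
proof -
  let ?Y = "\<lambda>i j. \<bar>A i j\<bar> - mean_abs n p i j"
  have row: "mulv n ?Y (\<lambda>_. 1) i = Defs.degree n A i - dbar n p" if i: "i < n" for i
  proof -
    have "(\<Sum>j<n. mean_abs n p i j) = (\<Sum>j\<in>{..<n} - {i}. p)"
      by (rule sum.mono_neutral_cong_right) (use i in \<open>auto simp: mean_abs_def\<close>)
    also have "\<dots> = dbar n p" using i by (simp add: dbar_def of_nat_diff mult.commute)
    finally show ?thesis by (simp add: mulv_def sum_subtractf degree_eq_sum_abs)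
  qed
  have "(\<Sum>i<n. (Defs.degree n A i - dbar n p)\<^sup>2) = (vnorm n (mulv n ?Y (\<lambda>_. 1)))\<^sup>2"
    unfolding vnorm_sq by (rule sum.cong) (auto simp: row)
  also have "\<dots> \<le> (B * vnorm n (\<lambda>_. 1))\<^sup>2"
    using typical by (intro power_mono) (auto simp: typical_adj_def op_le_def)
  also have "\<dots> = B\<^sup>2 * real n" by (simp add: power_mult_distrib vnorm_sq)
  finally show ?thesis .
qed

text \<open>Three contributions, each over \<open>dbar n p\<close>: the rescaled noise, bounded in
  operator norm by \<open>2 B\<close>; the rank-one regulariser, in Frobenius norm by
  \<open>2 \<gamma>\<close>; and the error of the normalisation on \<open>E A\<close>, in Frobenius
  norm by \<open>6 (B + \<gamma>)\<close>.\<close>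

lemma laplacian_close:
  assumes typical: "typical_adj n cl p \<eta> B A" and B: "0 \<le> B" and gam: "0 \<le> gp" "0 \<le> gm"
    and eta0: "0 \<le> \<eta>" and n10: "10 \<le> n"
  shows "op_le n n (\<lambda>i j. Lgamma n gp gm A i j - Hm i j) (8 * (B + (gp + gm)) / dbar n p)"
proof -
  define d where "d = dbar n p"
  define \<gamma> where "\<gamma> = gp + gm"
  define Dg where "Dg = (\<lambda>i. Defs.degree n A i + \<gamma>)"
  define a where "a = (\<lambda>i. 1 / sqrt (Dg i))"
  have np: "1 < real n" using n10 by simp
  have d: "0 < d" using p0 np by (simp add: d_def dbar_def)
  have g0: "0 \<le> \<gamma>" using gam by (simp add: \<gamma>_def)
  have D: "d / 2 \<le> Dg i" if "i < n" for i
  proof -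
    have "d / 2 \<le> Defs.degree n A i" using typical that by (simp add: typical_adj_def d_def)
    then show ?thesis using g0 by (simp add: Dg_def)
  qed
  have Dp: "0 < Dg i" if "i < n" for i using D[OF that] d by simp
  have ai: "\<bar>a i\<bar> \<le> sqrt (2 / d)" if "i < n" for i
  proof -
    have "1 / Dg i \<le> 2 / d" using D[OF that] Dp[OF that] d by (simp add: field_simps)
    then have "sqrt (1 / Dg i) \<le> sqrt (2 / d)" by simp
    then show ?thesis using Dp[OF that] by (simp add: a_def real_sqrt_divide)
  qed
  have a2: "(a i)\<^sup>2 \<le> 2 / d" if "i < n" for i
  proof -
    have "\<bar>a i\<bar>\<^sup>2 \<le> (sqrt (2 / d))\<^sup>2" by (intro power_mono ai that) simp
    then show ?thesis using d by simp
  qed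
  let ?X = "\<lambda>i j. A i j - mean_adj n cl p \<eta> i j"
  let ?c = "(gp - gm) / real n"
  let ?M1 = "\<lambda>i j. a i * ?X i j * a j"
  let ?M1' = "\<lambda>i j. - (a i * ?X i j * a j)"
  let ?M2 = "\<lambda>i j. - (?c * a i * a j)"
  let ?M3 = "\<lambda>i j. mean_adj n cl p \<eta> i j * (1 / d - a i * a j)"
  have M1: "op_le n n ?M1' (2 / d * B)"
  proof -
    have "op_le n n ?M1 (sqrt (2 / d) * sqrt (2 / d) * B)"
      by (rule op_le_diag_scale[OF _ B]) (use typical ai d in \<open>auto simp: typical_adj_def\<close>)
    then have o: "op_le n n ?M1 (2 / d * B)" using d by simp
    have "vnorm n (mulv n ?M1' x) = vnorm n (mulv n ?M1 x)" for x
    proof -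
      have "mulv n ?M1' x = (\<lambda>i. (-1) * mulv n ?M1 x i)" by (simp add: mulv_def sum_negf)
      then show ?thesis using vnorm_scale[of n "-1" "mulv n ?M1 x"] by simp
    qed
    then show ?thesis using o by (simp add: op_le_def)
  qed
  have M2: "op_le n n ?M2 (2 / d * \<gamma>)"
  proof (rule op_le_frob_bound)
    have "(\<Sum>i<n. \<Sum>j<n. (?M2 i j)\<^sup>2) \<le> (\<Sum>i<n. \<Sum>j<n. ?c\<^sup>2 * ((2 / d) * (2 / d)))"
    proof (intro sum_mono)
      fix i j assume ij: "i \<in> {..<n}" "j \<in> {..<n}"
      have "(?M2 i j)\<^sup>2 = ?c\<^sup>2 * ((a i)\<^sup>2 * (a j)\<^sup>2)" by (simp only: power2_minus power_mult_distrib mult.assoc)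
      also have "\<dots> \<le> ?c\<^sup>2 * ((2 / d) * (2 / d))" using ij a2 d by (intro mult_left_mono mult_mono) auto
      finally show "(?M2 i j)\<^sup>2 \<le> ?c\<^sup>2 * ((2 / d) * (2 / d))" .
    qed
    also have "\<dots> = (real n * ?c)\<^sup>2 * (2 / d)\<^sup>2" by (simp add: power2_eq_square)
    also have "real n * ?c = gp - gm" using np by simp
    also have "(gp - gm)\<^sup>2 * (2 / d)\<^sup>2 \<le> \<gamma>\<^sup>2 * (2 / d)\<^sup>2"
    proof (rule mult_right_mono)
      have "\<bar>gp - gm\<bar>\<^sup>2 \<le> \<gamma>\<^sup>2" using gam by (intro power_mono) (auto simp: \<gamma>_def)
      then show "(gp - gm)\<^sup>2 \<le> \<gamma>\<^sup>2" by simp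
    qed simp
    also have "\<gamma>\<^sup>2 * (2 / d)\<^sup>2 = (2 / d * \<gamma>)\<^sup>2" by (simp add: power_mult_distrib power_divide)
    finally show "(\<Sum>i<n. \<Sum>j<n. (?M2 i j)\<^sup>2) \<le> (2 / d * \<gamma>)\<^sup>2" .
  qed (use d g0 in simp)
  \<comment> \<open>Normalised so that \<open>d a_i a_j = t_i t_j\<close>; the ideal value is 1, and
    only the mean square deviation from it is controlled.\<close>
  define t where "t = (\<lambda>i. sqrt (d / Dg i))"
  have ta: "t i = sqrt d * a i" for i by (simp add: t_def a_def real_sqrt_divide)
  have tsum: "(\<Sum>i<n. (t i - 1)\<^sup>2) \<le> 4 * real n * (B + \<gamma>)\<^sup>2 / d\<^sup>2"
  proof -
    have "(\<Sum>i<n. (t i - 1)\<^sup>2) \<le> (\<Sum>i<n. 2 / d\<^sup>2 * (2 * (Defs.degree n A i - d)\<^sup>2 + 2 * \<gamma>\<^sup>2))"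
    proof (rule sum_mono)
      fix i assume "i \<in> {..<n}"
      then have "(t i - 1)\<^sup>2 \<le> 2 * (d - Dg i)\<^sup>2 / d\<^sup>2" unfolding t_def by (intro sqrt_ratio_diff_sq(1)[OF d]) (use D in auto)
      also have "(d - Dg i)\<^sup>2 = ((Defs.degree n A i - d) + \<gamma>)\<^sup>2" by (simp add: Dg_def power2_eq_square algebra_simps)
      also have "2 * ((Defs.degree n A i - d) + \<gamma>)\<^sup>2 / d\<^sup>2 \<le> 2 * (2 * (Defs.degree n A i - d)\<^sup>2 + 2 * \<gamma>\<^sup>2) / d\<^sup>2"
        by (intro divide_right_mono mult_left_mono sq_sum_le) auto
      finally show "(t i - 1)\<^sup>2 \<le> 2 / d\<^sup>2 * (2 * (Defs.degree n A i - d)\<^sup>2 + 2 * \<gamma>\<^sup>2)" by simp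
    qed
    also have "\<dots> = 2 / d\<^sup>2 * (2 * (\<Sum>i<n. (Defs.degree n A i - d)\<^sup>2) + 2 * (real n * \<gamma>\<^sup>2))"
      by (simp add: sum_distrib_left sum.distrib distrib_left)
    also have "\<dots> \<le> 2 / d\<^sup>2 * (2 * (B\<^sup>2 * real n) + 2 * (real n * \<gamma>\<^sup>2))"
      by (intro mult_left_mono add_right_mono) (use degree_dev_sum[OF typical B] in \<open>auto simp: d_def\<close>)
    also have "\<dots> = 4 * real n * (B\<^sup>2 + \<gamma>\<^sup>2) / d\<^sup>2" by (simp add: algebra_simps add_divide_distrib)
    also have "\<dots> \<le> 4 * real n * (B + \<gamma>)\<^sup>2 / d\<^sup>2"
      using B g0 by (intro divide_right_mono mult_left_mono) (auto simp: power2_eq_square algebra_simps)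
    finally show ?thesis .
  qed
  have M3: "op_le n n ?M3 (6 * (B + \<gamma>) / d)"
  proof (rule op_le_frob_bound)
    have "(\<Sum>i<n. \<Sum>j<n. (?M3 i j)\<^sup>2) \<le> (\<Sum>i<n. \<Sum>j<n. (p / d)\<^sup>2 * (4 * (t i - 1)\<^sup>2 + 2 * (t j - 1)\<^sup>2))"
    proof (intro sum_mono)
      fix i j assume ij: "i \<in> {..<n}" "j \<in> {..<n}"
      have "\<bar>mean_adj n cl p \<eta> i j\<bar> \<le> p"
      proof -
        have "p * (1 - 2 * \<eta>) \<le> p * 1" using p0 eta0 by (intro mult_left_mono) auto
        then show ?thesis using p0 eta by (auto simp: mean_adj_def sgn_cl_def abs_mult)
      qed
      then have "\<bar>mean_adj n cl p \<eta> i j\<bar>\<^sup>2 \<le> p\<^sup>2" by (intro power_mono) auto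
      then have m2: "(mean_adj n cl p \<eta> i j)\<^sup>2 \<le> p\<^sup>2" by simp
      have "t i * t j = (sqrt d * sqrt d) * (a i * a j)" unfolding ta by (simp only: mult_ac)
      then have "t i * t j = d * (a i * a j)" using d by simp
      then have "a i * a j = t i * t j / d" using d by simp
      then have "1 / d - a i * a j = (1 - t i * t j) / d" by (simp add: diff_divide_distrib)
      then have "(?M3 i j)\<^sup>2 = (mean_adj n cl p \<eta> i j)\<^sup>2 * ((1 - t i * t j)\<^sup>2 / d\<^sup>2)"
        by (simp add: power_mult_distrib power_divide)
      also have "\<dots> \<le> p\<^sup>2 * ((4 * (t i - 1)\<^sup>2 + 2 * (t j - 1)\<^sup>2) / d\<^sup>2)"
      proof (intro mult_mono m2 divide_right_mono)
        \<comment> \<open>The remaining factor \<open>t j\<close> is bounded by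
          \<open>sqrt 2\<close> because the degrees are at least \<open>d / 2\<close>.\<close>
        have "(1 - t i * t j)\<^sup>2 = ((t i - 1) * t j + (t j - 1))\<^sup>2" by (simp add: power2_eq_square algebra_simps)
        also have "\<dots> \<le> 2 * ((t i - 1) * t j)\<^sup>2 + 2 * (t j - 1)\<^sup>2" by (rule sq_sum_le)
        also have "((t i - 1) * t j)\<^sup>2 \<le> (t i - 1)\<^sup>2 * 2"
          unfolding power_mult_distrib t_def
          by (intro mult_left_mono sqrt_ratio_diff_sq(2)[OF d]) (use D ij in auto)
        finally show "(1 - t i * t j)\<^sup>2 \<le> 4 * (t i - 1)\<^sup>2 + 2 * (t j - 1)\<^sup>2" by simp
      qed auto
      finally show "(?M3 i j)\<^sup>2 \<le> (p / d)\<^sup>2 * (4 * (t i - 1)\<^sup>2 + 2 * (t j - 1)\<^sup>2)"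
        by (simp add: power_divide)
    qed
    also have "\<dots> = (p / d)\<^sup>2 * (6 * real n * (\<Sum>i<n. (t i - 1)\<^sup>2))"
    proof -
      let ?T = "\<Sum>i<n. (t i - 1)\<^sup>2"
      have "(\<Sum>i<n. \<Sum>j<n. 4 * (t i - 1)\<^sup>2 + 2 * (t j - 1)\<^sup>2) = 4 * (real n * ?T) + 2 * (real n * ?T)"
        by (simp add: sum.distrib sum_distrib_left[symmetric])
      then show ?thesis by (simp add: sum_distrib_left[symmetric])
    qed
    also have "\<dots> \<le> (p / d)\<^sup>2 * (6 * real n * (4 * real n * (B + \<gamma>)\<^sup>2 / d\<^sup>2))"
      by (intro mult_left_mono tsum) auto
    also have "\<dots> = 24 * (real n * p / d)\<^sup>2 * ((B + \<gamma>)\<^sup>2 / d\<^sup>2)"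
      by (simp add: power_divide power_mult_distrib power2_eq_square)
    \<comment> \<open>Here \<open>n \<ge> 10\<close> enters:
      \<open>n / (n - 1) \<le> 10 / 9\<close>, whose square is below \<open>3 / 2\<close>.\<close>
    also have "\<dots> \<le> 36 * ((B + \<gamma>)\<^sup>2 / d\<^sup>2)"
    proof (rule mult_right_mono)
      have "real n * p / d = real n / (real n - 1)" using p0 by (simp add: d_def dbar_def)
      also have "\<dots> \<le> 10 / 9" using n10 by (simp add: divide_le_eq)
      finally have "(real n * p / d)\<^sup>2 \<le> (10 / 9)\<^sup>2" using d p0 by (intro power_mono) auto
      also have "(10 / 9 :: real)\<^sup>2 \<le> 3 / 2" by (simp add: power2_eq_square)
      finally show "24 * (real n * p / d)\<^sup>2 \<le> 36" by simp
    qed simp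
    also have "\<dots> = (6 * (B + \<gamma>) / d)\<^sup>2" unfolding power_divide power_mult_distrib by simp
    finally show "(\<Sum>i<n. \<Sum>j<n. (?M3 i j)\<^sup>2) \<le> (6 * (B + \<gamma>) / d)\<^sup>2" .
  qed (use B g0 d in simp)
  have "op_le n n (\<lambda>i j. ?M1' i j + (?M2 i j + ?M3 i j)) (2 / d * B + (2 / d * \<gamma> + 6 * (B + \<gamma>) / d))"
    by (intro op_le_add M1 M2 M3)
  then have "op_le n n (\<lambda>i j. Lgamma n gp gm A i j - Hm i j) (2 / d * B + (2 / d * \<gamma> + 6 * (B + \<gamma>) / d))"
  proof (rule op_le_cong[rotated])
    fix i j assume ij: "i < n" "j < n"
    have H: "Hm i j = (if i = j then 1 else 0) - mean_adj n cl p \<eta> i j / d"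
    proof (cases "i = j")
      case True
      then show ?thesis by (simp add: Hm_def sgn_cl_def mean_adj_def)
    next
      case False
      have "mean_adj n cl p \<eta> i j / d = g * sgn_cl cl i j"
        using False ij p0 by (simp add: mean_adj_def d_def dbar_def g_def)
      then show ?thesis using False by (simp add: Hm_def)
    qed
    have Lg: "Lgamma n gp gm A i j = (if i = j then 1 else 0) - (A i j + ?c) * (a i * a j)"
      using ij by (simp add: Lgamma_def a_def Dg_def \<gamma>_def)
    show "?M1' i j + (?M2 i j + ?M3 i j) = Lgamma n gp gm A i j - Hm i j"
      unfolding H Lg by (simp add: algebra_simps)
  qed
  moreover have "2 / d * B + (2 / d * \<gamma> + 6 * (B + \<gamma>) / d) = 8 * (B + (gp + gm)) / dbar n p"
    unfolding d_def[symmetric] \<gamma>_def[symmetric] by (simp add: add_divide_distrib algebra_simps)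
  ultimately show ?thesis by simp
qed

end

section \<open>Constants and the main theorem\<close>

text \<open>
  The exponential is there to force \<open>81 K\<^sup>2 \<le> ln n\<close> outside the vacuous range, which absorbs the constant \<open>K\<close> of the
  norm bound in the dense case.
\<close>

definition prob_const :: real where
  "prob_const = exp (81 * conc_const\<^sup>2) + 100"

lemma prob_const_ge: "100 \<le> prob_const" "exp (81 * conc_const\<^sup>2) \<le> prob_const"
  by (auto simp: prob_const_def)

text \<open>The assumption says \<open>n p > c ln n\<close> for \<open>c = prob_const\<close>. Since
  \<open>n \<ge> 3 \<ge> exp 1\<close>, the logarithm is at least 1, and \<open>p \<le> 1\<close>
  turns \<open>n p > c\<close> into \<open>n > c\<close>.\<close>

lemma nonvacuous_regime:
  assumes n: "10 \<le> n" and p: "0 < p" "p \<le> 1"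
    and nv: "real n * exp (- real n * p / prob_const) < 1"
  shows "prob_const < real n * p" "81 * conc_const\<^sup>2 \<le> ln (real n)"
proof -
  have n0: "0 < real n" using n by simp
  have c0: "0 < prob_const" using prob_const_ge(1) by simp
  have "exp 1 \<le> (3::real)" using exp_le by simp
  also have "3 \<le> real n" using n by simp
  finally have ln1: "1 \<le> ln (real n)" using n0 by (simp add: ln_ge_iff)
  have "real n < exp (real n * p / prob_const)"
    using nv by (simp add: exp_minus field_simps)
  then have "ln (real n) < ln (exp (real n * p / prob_const))" using n0 by (subst ln_less_cancel_iff) auto
  then have "ln (real n) < real n * p / prob_const" by simp
  then have ln2: "ln (real n) * prob_const < real n * p" using c0 by (simp add: less_divide_eq)
  have "1 * prob_const \<le> ln (real n) * prob_const" using ln1 c0 by (intro mult_right_mono) auto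
  then show big: "prob_const < real n * p" using ln2 by simp
  have "real n * p \<le> real n * 1" using p by (intro mult_left_mono) auto
  then have "exp (81 * conc_const\<^sup>2) \<le> real n" using big prob_const_ge(2) by linarith
  then show "81 * conc_const\<^sup>2 \<le> ln (real n)" using n0 by (simp add: ln_ge_iff)
qed

lemma dbar_ge: "10 \<le> n \<Longrightarrow> 0 < p \<Longrightarrow> 9 / 10 * (real n * p) \<le> dbar n p"
proof -
  assume n: "10 \<le> n" and p: "0 < p"
  have "9 / 10 * real n \<le> real n - 1" using n by simp
  then have "(9 / 10 * real n) * p \<le> (real n - 1) * p" using p by (intro mult_right_mono) auto
  then show ?thesis by (simp add: dbar_def mult.commute mult.left_commute)
qed

text \<open>With \<open>q = n p\<close>, the failure terms sum to at most
  \<open>3 n exp (- 9 q / 100)\<close>. As \<open>q > 100\<close>, the factor 3 is absorbed by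
  \<open>exp (8 q / 100)\<close>, leaving \<open>exp (- q / 100)\<close>; this is why
  \<open>prob_const\<close> is at least 100.\<close>

lemma ssbm_prob_ge:
  assumes n: "10 \<le> n" and pp: "0 < p" "p \<le> 1" and et: "0 \<le> \<eta>" "\<eta> < 1 / 2"
    and imp: "\<And>A. real n * exp (- real n * p / prob_const) < 1 \<Longrightarrow> A \<in> signed_adj n \<Longrightarrow>
      typical_adj n cl p \<eta> (conc_const * sqrt (real n * p)) A \<Longrightarrow> E A"
  shows "1 - real n * exp (- real n * p / prob_const) \<le> ssbm_prob n cl p \<eta> E"
proof -
  interpret ssbm n cl p \<eta> by unfold_locales (use pp et in auto)
  show ?thesis
  proof (cases "real n * exp (- real n * p / prob_const) < 1")
    case False
    then show ?thesis using ssbm_prob_nonneg[of E] by linarith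
  next
    case True
    define q where "q = real n * p"
    have qc: "prob_const < q" using nonvacuous_regime(1)[OF n pp True] by (simp add: q_def)
    then have q100: "100 < q" using prob_const_ge(1) by linarith
    have "1 - (2 * real n * exp (- (real n * p)) + real n * exp (- dbar n p / 10)) \<le> ssbm_prob n cl p \<eta> E"
      by (rule typical_prob) (use q100 imp[OF True] in \<open>auto simp: q_def\<close>)
    moreover have "2 * real n * exp (- (real n * p)) + real n * exp (- dbar n p / 10)
        \<le> real n * exp (- real n * p / prob_const)"
    proof -
      have e1: "exp (- q) \<le> exp (- (9 / 100 * q))" using q100 by simp
      have e2: "exp (- dbar n p / 10) \<le> exp (- (9 / 100 * q))"
        using dbar_ge[OF n pp(1)] unfolding q_def[symmetric] by simp
      have "1 + 8 / 100 * q \<le> exp (8 / 100 * q)" by (rule exp_ge_add_one_self)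
      then have "3 \<le> exp (8 / 100 * q)" using q100 by linarith
      then have "3 * exp (- (9 / 100 * q)) \<le> exp (8 / 100 * q) * exp (- (9 / 100 * q))"
        by (rule mult_right_mono) simp
      also have "\<dots> = exp (- (q / 100))" unfolding mult_exp_exp by (rule arg_cong[of _ _ exp]) simp
      also have "\<dots> \<le> exp (- q / prob_const)"
      proof -
        have "q / prob_const \<le> q / 100" using prob_const_ge(1) q100 by (intro divide_left_mono) auto
        then show ?thesis by simp
      qed
      finally have e3: "3 * exp (- (9 / 100 * q)) \<le> exp (- q / prob_const)" .
      have "2 * exp (- q) + exp (- dbar n p / 10) \<le> exp (- q / prob_const)" using e1 e2 e3 by linarith
      then have "real n * (2 * exp (- q) + exp (- dbar n p / 10)) \<le> real n * exp (- q / prob_const)"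
        by (rule mult_left_mono) simp
      then show ?thesis by (simp add: q_def distrib_left mult_ac)
    qed
    ultimately show ?thesis by linarith
  qed
qed

lemma delta_le_one:
  assumes "2 \<le> k" "0 < \<xi>" "\<delta> < sqrt (1 / (12 * (16 + 8 * \<xi>) * (real k - 1)))"
  shows "\<delta> \<le> 1"
proof -
  have "1 * 1 \<le> (12 * (16 + 8 * \<xi>)) * (real k - 1)" using assms by (intro mult_mono) auto
  then have "1 / (12 * (16 + 8 * \<xi>) * (real k - 1)) \<le> 1" by simp
  then have "sqrt (1 / (12 * (16 + 8 * \<xi>) * (real k - 1))) \<le> sqrt 1" by (rule real_sqrt_le_mono)
  then show ?thesis using assms(3) unfolding real_sqrt_one by linarith
qed

text \<open>With \<open>x = k / (\<delta> (1 - 2 \<eta>))\<close> the right side is the tolerance of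
  \<open>spectral_recovery\<close>. The number 81 makes \<open>(2 x)^2 * 81 K^2\<close> the square
  of \<open>18 K x\<close>, and \<open>8 * (10 / 9) / 18 = 40 / 81\<close> stays below
  \<open>1 / 2\<close>.\<close>

lemma dense_error_small:
  assumes n: "10 \<le> n" and p: "0 < p" and x: "0 < x"
    and ln: "81 * conc_const\<^sup>2 \<le> ln (real n)"
    and big: "p > (2 * x)\<^sup>2 * ln (real n) / real n"
  shows "8 * (conc_const * sqrt (real n * p)) / dbar n p \<le> 1 / x / 2"
proof -
  define q where "q = real n * p"
  have n0: "0 < real n" using n by simp
  have q0: "0 < q" using n0 p by (simp add: q_def)
  have "(2 * x)\<^sup>2 * (81 * conc_const\<^sup>2) \<le> (2 * x)\<^sup>2 * ln (real n)" by (intro mult_left_mono ln) simp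
  also have "\<dots> < q" using big n0 by (simp add: q_def field_simps)
  finally have "(2 * x)\<^sup>2 * (81 * conc_const\<^sup>2) \<le> q" by simp
  moreover have "(18 * conc_const * x)\<^sup>2 = (2 * x)\<^sup>2 * (81 * conc_const\<^sup>2)" by algebra
  ultimately have "(18 * conc_const * x)\<^sup>2 \<le> q" by simp
  then have "sqrt ((18 * conc_const * x)\<^sup>2) \<le> sqrt q" by (rule real_sqrt_le_mono)
  then have r: "18 * conc_const * x \<le> sqrt q" using x conc_const_pos by simp
  have d: "9 / 10 * q \<le> dbar n p" using dbar_ge[OF n p] by (simp add: q_def)
  have "8 * (conc_const * sqrt q) / dbar n p \<le> 8 * (conc_const * sqrt q) / (9 / 10 * q)"
    using d q0 conc_const_pos by (intro divide_left_mono) auto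
  also have "\<dots> = 80 / 9 * conc_const / sqrt q"
    using q0 by (simp add: field_simps)
  also have "\<dots> \<le> 80 / 9 * conc_const / (18 * conc_const * x)"
    using r x conc_const_pos q0 by (intro divide_left_mono) auto
  also have "\<dots> = 40 / 81 * (1 / x)" using conc_const_pos by simp
  also have "\<dots> \<le> 1 / x / 2" using x by (simp add: divide_simps)
  finally show ?thesis by (simp add: q_def)
qed

text \<open>Twice the numerator \<open>8 (2 K + 1)\<close> to which the perturbation bound reduces
  in the sparse case; it is the witness for \<open>C\<close>.\<close>

definition sparse_const :: real where
  "sparse_const = 32 * conc_const + 16"

text \<open>In terms of \<open>z = d^(1/8)\<close> the regulariser is \<open>z^7\<close> and the
  noise at most \<open>2 K z^4 \<le> 2 K z^7\<close>, so division by \<open>d = z^8\<close> leaves a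
  constant over \<open>z\<close>. The factor 2 in \<open>big\<close> compensates for
  \<open>d \<ge> (9 / 10) n p\<close>, so that \<open>z > y\<close>.\<close>

lemma sparse_error_small:
  assumes n: "10 \<le> n" and p: "0 < p" and x: "1 \<le> x" and y: "2 * x * sparse_const \<le> y"
    and big: "p > y ^ 8 * 2 / real n" and gam: "\<gamma> = dbar n p powr (7 / 8)"
  shows "8 * (conc_const * sqrt (real n * p) + \<gamma>) / dbar n p \<le> 1 / x / 2"
proof -
  define d where "d = dbar n p"
  define z where "z = d powr (1 / 8)"
  have n0: "0 < real n" using n by simp
  have K: "0 < conc_const" by (rule conc_const_pos)
  have "2 * 1 * 16 \<le> 2 * x * sparse_const" using x K by (intro mult_mono) (auto simp: sparse_const_def)
  then have y1: "1 \<le> y" using y by linarith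
  have q: "y ^ 8 * 2 < real n * p" using big n0 by (simp add: field_simps)
  have dq: "9 / 10 * (real n * p) \<le> d" using dbar_ge[OF n p] by (simp add: d_def)
  have "1 \<le> y ^ 8" using y1 by simp
  then have d8: "y ^ 8 < d" using q dq by linarith
  then have d0: "0 < d" using \<open>1 \<le> y ^ 8\<close> by simp
  have z0: "0 < z" using d0 by (simp add: z_def)
  have z8: "z ^ 8 = d" using d0 by (simp add: z_def powr_realpow[symmetric] powr_powr)
  have yz: "y < z"
  proof (rule ccontr)
    assume "\<not> y < z"
    then have "z ^ 8 \<le> y ^ 8" using z0 by (intro power_mono) auto
    then show False using z8 d8 by simp
  qed
  have z1: "1 \<le> z" using yz y1 by simp
  have gz: "\<gamma> = z ^ 7"
    using d0 unfolding gam d_def[symmetric] z_def by (simp add: powr_realpow[symmetric] powr_powr)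
  have "sqrt (real n * p) \<le> sqrt (4 * d)" using dq d0 by simp
  also have "\<dots> = 2 * sqrt ((z ^ 4)\<^sup>2)" by (simp add: real_sqrt_mult z8[symmetric] power_mult[symmetric])
  also have "\<dots> = 2 * z ^ 4" unfolding real_sqrt_abs using z0 by simp
  also have "\<dots> \<le> 2 * z ^ 7" using z1 by (intro mult_left_mono power_increasing) auto
  finally have "conc_const * sqrt (real n * p) \<le> conc_const * (2 * z ^ 7)" using K by (intro mult_left_mono) auto
  then have "conc_const * sqrt (real n * p) + \<gamma> \<le> (2 * conc_const + 1) * z ^ 7"
    by (simp add: gz algebra_simps)
  then have "8 * (conc_const * sqrt (real n * p) + \<gamma>) / d \<le> 8 * ((2 * conc_const + 1) * z ^ 7) / z ^ 8"
    using z0 unfolding z8 using d0 by (intro divide_right_mono mult_left_mono) auto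
  also have "\<dots> = (sparse_const / 2) / z"
    using z0 by (simp add: sparse_const_def power_eq_if[of z 8] field_simps)
  also have "\<dots> \<le> (sparse_const / 2) / y"
    using yz y1 K by (intro divide_left_mono) (auto simp: sparse_const_def)
  also have "\<dots> \<le> (sparse_const / 2) / (2 * x * sparse_const)"
    using y y1 x K by (intro divide_left_mono) (auto simp: sparse_const_def intro!: mult_pos_pos)
  also have "\<dots> = 1 / x / 4"
  proof -
    have "0 < sparse_const" using K by (simp add: sparse_const_def)
    then show ?thesis by simp
  qed
  also have "\<dots> \<le> 1 / x / 2" using x by (simp add: divide_simps)
  finally show ?thesis by (simp add: d_def)
qed

theorem mainTheorem7:
  shows "\<exists>C\<^sub>0 C c :: real. 0 < C\<^sub>0 \<and> C\<^sub>0 < 43 \<and> C > 1 \<and> c > 0 \<and>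
    (\<forall>n k cl p \<eta> \<xi> \<delta> R.
       valid_partition n k cl \<and> k \<ge> 2 \<and> n \<ge> 10 \<and> 0 < p \<and> p \<le> 1 \<and>
       0 \<le> \<eta> \<and> \<eta> < 1/2 \<and>
       sqrt (rho n k cl) > 1 - 1 / (4 * real k * (2 + sqrt (real k))) \<and>
       \<xi> > 0 \<and> 0 < \<delta> \<and> \<delta> < sqrt (1 / (12 * (16 + 8 * \<xi>) * (real k - 1))) \<and>
       bottom_eigvecs k (k - 1) (Cbar n k cl p \<eta>) R \<and>
       p > (2 * C\<^sub>0 * real k / (\<delta> * (1 - 2 * \<eta>)))\<^sup>2 * ln (real n) / real n
       \<longrightarrow> ssbm_prob n cl p \<eta> (recovery_event n k cl \<xi> \<delta> R (Lsym n))
             \<ge> 1 - 2 / real n - real n * exp (- real n * p / c)) \<and>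
    (\<forall>n k cl p \<eta> \<xi> \<delta> R r \<gamma>p \<gamma>m.
       valid_partition n k cl \<and> k \<ge> 2 \<and> n \<ge> 10 \<and> 0 < p \<and> p \<le> 1 \<and>
       0 \<le> \<eta> \<and> \<eta> < 1/2 \<and>
       sqrt (rho n k cl) > 1 - 1 / (4 * real k * (2 + sqrt (real k))) \<and>
       \<xi> > 0 \<and> 0 < \<delta> \<and> \<delta> < sqrt (1 / (12 * (16 + 8 * \<xi>) * (real k - 1))) \<and>
       bottom_eigvecs k (k - 1) (Cbar n k cl p \<eta>) R \<and>
       r \<ge> 1 \<and>
       p > (2 * real k * (128 * C * r\<^sup>2 + 1) / (\<delta> * (1 - 2 * \<eta>))) ^ 8 * 2 / real n \<and>
       \<gamma>p \<ge> 0 \<and> \<gamma>m \<ge> 0 \<and> \<gamma>p + \<gamma>m = dbar n p powr (7/8)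
       \<longrightarrow> ssbm_prob n cl p \<eta> (recovery_event n k cl \<xi> \<delta> R (Lgamma n \<gamma>p \<gamma>m))
             \<ge> 1 - 7 * exp (- 2 * r) - 2 / real n - real n * exp (- real n * p / c))"
\<comment> \<open>\<open>C\<^sub>0 = 1\<close>: in the dense case \<open>conc_const\<close> is
  absorbed by \<open>ln n\<close>, through the size of \<open>prob_const\<close>. In the sparse case
  \<open>C\<close> carries it, and \<open>c\<close> is common to both.\<close>
proof (rule exI[of _ 1], rule exI[of _ sparse_const], rule exI[of _ prob_const], intro conjI allI impI)
  show "1 < sparse_const" using conc_const_pos by (simp add: sparse_const_def)
  show "0 < prob_const" using prob_const_ge(1) by simp
next
  fix n k cl p \<eta> \<xi> \<delta> R
  assume h: "valid_partition n k cl \<and> k \<ge> 2 \<and> n \<ge> 10 \<and> 0 < p \<and> p \<le> 1 \<and>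
       0 \<le> \<eta> \<and> \<eta> < 1/2 \<and>
       sqrt (rho n k cl) > 1 - 1 / (4 * real k * (2 + sqrt (real k))) \<and>
       \<xi> > 0 \<and> 0 < \<delta> \<and> \<delta> < sqrt (1 / (12 * (16 + 8 * \<xi>) * (real k - 1))) \<and>
       bottom_eigvecs k (k - 1) (Cbar n k cl p \<eta>) R \<and>
       p > (2 * 1 * real k / (\<delta> * (1 - 2 * \<eta>)))\<^sup>2 * ln (real n) / real n"
  then interpret population n k cl p \<eta> R by unfold_locales auto
  have n: "10 \<le> n" and pp: "0 < p" "p \<le> 1" and eta0: "0 \<le> \<eta>" and xi: "0 < \<xi>" and d: "0 < \<delta>"
    "\<delta> < sqrt (1 / (12 * (16 + 8 * \<xi>) * (real k - 1)))" using h by auto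
  define x where "x = real k / (\<delta> * (1 - 2 * \<eta>))"
  have x0: "0 < x" using k2 d eta by (simp add: x_def)
  have "p > (2 * x)\<^sup>2 * ln (real n) / real n" using h by (simp add: x_def)
  note small = dense_error_small[OF n pp(1) x0 _ this]
  have xinv: "1 / x / 2 = \<delta> * ((1 - 2 * \<eta>) / real k) / 2" by (simp add: x_def)
  have "1 - real n * exp (- real n * p / prob_const) \<le> ssbm_prob n cl p \<eta> (recovery_event n k cl \<xi> \<delta> R (Lsym n))"
  proof (rule ssbm_prob_ge[OF n pp eta0 eta])
    fix A assume nv: "real n * exp (- real n * p / prob_const) < 1"
      and ty: "typical_adj n cl p \<eta> (conc_const * sqrt (real n * p)) A"
    have B0: "0 \<le> conc_const * sqrt (real n * p)" using conc_const_pos pp by simp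
    let ?e = "8 * (conc_const * sqrt (real n * p) + (0 + 0)) / dbar n p"
    have d0: "0 < dbar n p" using n pp by (simp add: dbar_def)
    show "recovery_event n k cl \<xi> \<delta> R (Lsym n) A"
    proof (rule recovery_of_close[OF _ _ _ xi d])
      show "op_le n n (\<lambda>i j. Lsym n A i j - Hm i j) ?e"
        unfolding Lsym_eq_Lgamma by (rule laplacian_close[OF ty B0 order_refl order_refl eta0 n])
      show "0 \<le> ?e" using B0 d0 by simp
      show "?e \<le> \<delta> * ((1 - 2 * \<eta>) / real k) / 2"
        using small[OF nonvacuous_regime(2)[OF n pp nv]] unfolding xinv by simp
    qed
  qed
  then show "ssbm_prob n cl p \<eta> (recovery_event n k cl \<xi> \<delta> R (Lsym n))
             \<ge> 1 - 2 / real n - real n * exp (- real n * p / prob_const)"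
    using divide_nonneg_nonneg[of 2 "real n"] by linarith
next
  fix n k cl p \<eta> \<xi> \<delta> R r \<gamma>p \<gamma>m
  assume h: "valid_partition n k cl \<and> k \<ge> 2 \<and> n \<ge> 10 \<and> 0 < p \<and> p \<le> 1 \<and>
       0 \<le> \<eta> \<and> \<eta> < 1/2 \<and>
       sqrt (rho n k cl) > 1 - 1 / (4 * real k * (2 + sqrt (real k))) \<and>
       \<xi> > 0 \<and> 0 < \<delta> \<and> \<delta> < sqrt (1 / (12 * (16 + 8 * \<xi>) * (real k - 1))) \<and>
       bottom_eigvecs k (k - 1) (Cbar n k cl p \<eta>) R \<and>
       r \<ge> 1 \<and>
       p > (2 * real k * (128 * sparse_const * r\<^sup>2 + 1) / (\<delta> * (1 - 2 * \<eta>))) ^ 8 * 2 / real n \<and>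
       \<gamma>p \<ge> 0 \<and> \<gamma>m \<ge> 0 \<and> \<gamma>p + \<gamma>m = dbar n p powr (7/8)"
  then interpret population n k cl p \<eta> R by unfold_locales auto
  have n: "10 \<le> n" and pp: "0 < p" "p \<le> 1" and eta0: "0 \<le> \<eta>" and xi: "0 < \<xi>" and d: "0 < \<delta>"
    "\<delta> < sqrt (1 / (12 * (16 + 8 * \<xi>) * (real k - 1)))" and r: "1 \<le> r"
    and gam: "0 \<le> \<gamma>p" "0 \<le> \<gamma>m" "\<gamma>p + \<gamma>m = dbar n p powr (7/8)" using h by auto
  define x where "x = real k / (\<delta> * (1 - 2 * \<eta>))"
  define y where "y = 2 * real k * (128 * sparse_const * r\<^sup>2 + 1) / (\<delta> * (1 - 2 * \<eta>))"
  have "\<delta> * (1 - 2 * \<eta>) \<le> 1 * 1"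
    using delta_le_one[OF k2 xi d(2)] d eta eta0 by (intro mult_mono) auto
  then have x1: "1 \<le> x" using k2 d eta by (simp add: x_def le_divide_eq)
  have y: "2 * x * sparse_const \<le> y"
  proof -
    have s0: "0 < sparse_const" using conc_const_pos by (simp add: sparse_const_def)
    have "1 \<le> r\<^sup>2" using r by simp
    then have "sparse_const * 1 \<le> sparse_const * r\<^sup>2" using s0 by (intro mult_left_mono) auto
    then have "sparse_const \<le> 128 * sparse_const * r\<^sup>2 + 1" using s0 by linarith
    then have "2 * x * sparse_const \<le> 2 * x * (128 * sparse_const * r\<^sup>2 + 1)"
      using x1 by (intro mult_left_mono) auto
    also have "\<dots> = y" by (simp add: x_def y_def)
    finally show ?thesis .
  qed
  have "p > y ^ 8 * 2 / real n" using h by (simp add: y_def)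
  note small = sparse_error_small[OF n pp(1) x1 y this gam(3)]
  have xinv: "1 / x / 2 = \<delta> * ((1 - 2 * \<eta>) / real k) / 2" by (simp add: x_def)
  have "1 - real n * exp (- real n * p / prob_const) \<le> ssbm_prob n cl p \<eta> (recovery_event n k cl \<xi> \<delta> R (Lgamma n \<gamma>p \<gamma>m))"
  proof (rule ssbm_prob_ge[OF n pp eta0 eta])
    fix A assume ty: "typical_adj n cl p \<eta> (conc_const * sqrt (real n * p)) A"
    have B0: "0 \<le> conc_const * sqrt (real n * p)" using conc_const_pos pp by simp
    let ?e = "8 * (conc_const * sqrt (real n * p) + (\<gamma>p + \<gamma>m)) / dbar n p"
    have d0: "0 < dbar n p" using n pp by (simp add: dbar_def)
    show "recovery_event n k cl \<xi> \<delta> R (Lgamma n \<gamma>p \<gamma>m) A"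
    proof (rule recovery_of_close[OF _ _ _ xi d])
      show "op_le n n (\<lambda>i j. Lgamma n \<gamma>p \<gamma>m A i j - Hm i j) ?e"
        by (rule laplacian_close[OF ty B0 gam(1,2) eta0 n])
      show "0 \<le> ?e" using B0 d0 gam by simp
      show "?e \<le> \<delta> * ((1 - 2 * \<eta>) / real k) / 2" using small unfolding xinv .
    qed
  qed
  then show "ssbm_prob n cl p \<eta> (recovery_event n k cl \<xi> \<delta> R (Lgamma n \<gamma>p \<gamma>m))
             \<ge> 1 - 7 * exp (- 2 * r) - 2 / real n - real n * exp (- real n * p / prob_const)"
    using divide_nonneg_nonneg[of 2 "real n"] exp_ge_zero[of "- 2 * r"] by linarith
qed simp_all

end
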